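(* There is a constant $C>0$ such that for every $R>0$, every function $f$ (with finite $H^4$ norm) such that $\operatorname{supp}f\subseteq B(0,R)$, and every $t>0$, $$\Big\|\frac{\sin(t|\nabla|)}{|\nabla|}f\Big\|_{L^\infty(\mathbb{R}^3)}\le C\min\{1,(1+t)^{-1}R\}\,\|f\|_{H^4(B(0,R))},$$ $$\|\cos(t|\nabla|)f\|_{L^\infty(\mathbb{R}^3)}\le C\min\{1,(1+t)^{-1}R\}\,\|f\|_{H^4(B(0,R))}.$$
   Context: $B(0,R)=\{y\in\mathbb{R}^3:|y|\le R\}$. $\frac{\sin(t|\nabla|)}{|\nabla|}$ and $\cos(t|\nabla|)$ are the Fourier multipliers on $\mathbb{R}^3$ with symbols $\frac{\sin(t|\xi|)}{|\xi|}$ and $\cos(t|\xi|)$. *)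

theory Defs
  imports "HOL-Analysis.Analysis" "HOL-Probability.Essential_Supremum"
begin

type_synonym R3 = "real ^ 3"

section \<open>Test functions and weak derivatives\<close>

definition partial :: "3 \<Rightarrow> (R3 \<Rightarrow> complex) \<Rightarrow> R3 \<Rightarrow> complex" where
  "partial i \<phi> x = frechet_derivative \<phi> (at x) (axis i 1)"

text \<open>A function is smooth iff all its iterated partial derivatives, in any order, exist and are
  (totally) differentiable.\<close>

definition smooth :: "(R3 \<Rightarrow> complex) \<Rightarrow> bool" where
  "smooth \<phi> \<longleftrightarrow> (\<forall>is x. foldr partial is \<phi> differentiable (at x))"

definition test_function :: "R3 set \<Rightarrow> (R3 \<Rightarrow> complex) \<Rightarrow> bool" where
  "test_function U \<phi> \<longleftrightarrow>
     smooth \<phi> \<and> compact (closure {x. \<phi> x \<noteq> 0}) \<and> closure {x. \<phi> x \<noteq> 0} \<subseteq> U"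

type_synonym multi_index = "nat ^ 3"

definition mi_order :: "multi_index \<Rightarrow> nat" where
  "mi_order \<alpha> = (\<Sum>i\<in>UNIV. \<alpha> $ i)"

definition mi_deriv :: "multi_index \<Rightarrow> (R3 \<Rightarrow> complex) \<Rightarrow> R3 \<Rightarrow> complex" where
  "mi_deriv \<alpha> \<phi> =
     (partial 1 ^^ (\<alpha> $ 1)) ((partial 2 ^^ (\<alpha> $ 2)) ((partial 3 ^^ (\<alpha> $ 3)) \<phi>))"

definition locally_integrable :: "R3 set \<Rightarrow> (R3 \<Rightarrow> complex) \<Rightarrow> bool" where
  "locally_integrable U f \<longleftrightarrow> (\<forall>K. compact K \<and> K \<subseteq> U \<longrightarrow> integrable (lebesgue_on K) f)"

definition has_weak_deriv ::
  "R3 set \<Rightarrow> multi_index \<Rightarrow> (R3 \<Rightarrow> complex) \<Rightarrow> (R3 \<Rightarrow> complex) \<Rightarrow> bool" where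
  "has_weak_deriv U \<alpha> f g \<longleftrightarrow>
     locally_integrable U f \<and> locally_integrable U g \<and>
     (\<forall>\<phi>. test_function U \<phi> \<longrightarrow>
        (LINT x|lebesgue_on U. f x * mi_deriv \<alpha> \<phi> x) =
        (-1) ^ mi_order \<alpha> * (LINT x|lebesgue_on U. g x * \<phi> x))"

text \<open>Weak derivatives are unique only up to null sets, so the choice of representative does not
  matter as long as it is used under integrals over \<open>U\<close>.\<close>

definition weak_deriv :: "R3 set \<Rightarrow> multi_index \<Rightarrow> (R3 \<Rightarrow> complex) \<Rightarrow> R3 \<Rightarrow> complex" where
  "weak_deriv U \<alpha> f = (SOME g. has_weak_deriv U \<alpha> f g)"

section \<open>Sobolev spaces\<close>

definition square_integrable :: "R3 set \<Rightarrow> (R3 \<Rightarrow> complex) \<Rightarrow> bool" where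
  "square_integrable U f \<longleftrightarrow>
     f \<in> borel_measurable (lebesgue_on U) \<and> integrable (lebesgue_on U) (\<lambda>x. (norm (f x))\<^sup>2)"

definition sobolev_space :: "nat \<Rightarrow> R3 set \<Rightarrow> (R3 \<Rightarrow> complex) set" where
  "sobolev_space k U =
     {f. square_integrable U f \<and>
         (\<forall>\<alpha>. mi_order \<alpha> \<le> k \<longrightarrow> (\<exists>g. has_weak_deriv U \<alpha> f g \<and> square_integrable U g))}"

text \<open>Meaningful only for \<open>f \<in> sobolev_space k U\<close> (or the restriction to \<open>U\<close> of a Sobolev
  function on a larger open set).\<close>

definition sobolev_norm :: "nat \<Rightarrow> R3 set \<Rightarrow> (R3 \<Rightarrow> complex) \<Rightarrow> real" where
  "sobolev_norm k U f =
     sqrt (\<Sum>\<alpha> | mi_order \<alpha> \<le> k. LINT x|lebesgue_on U. (norm (weak_deriv U \<alpha> f x))\<^sup>2)"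

text \<open>Support of a function defined up to null sets: the complement of the largest open set on
  which it vanishes almost everywhere.\<close>

definition ess_supp :: "(R3 \<Rightarrow> complex) \<Rightarrow> R3 set" where
  "ess_supp f = - \<Union>{U. open U \<and> (AE x in lebesgue. x \<in> U \<longrightarrow> f x = 0)}"

definition Linf_norm :: "(R3 \<Rightarrow> complex) \<Rightarrow> ereal" where
  "Linf_norm u = esssup lebesgue (\<lambda>x. ereal (norm (u x)))"

section \<open>Fourier multipliers\<close>

definition fourier :: "(R3 \<Rightarrow> complex) \<Rightarrow> R3 \<Rightarrow> complex" where
  "fourier f \<xi> = (LINT x|lebesgue. cis (- (x \<bullet> \<xi>)) * f x)"

definition inverse_fourier :: "(R3 \<Rightarrow> complex) \<Rightarrow> R3 \<Rightarrow> complex" where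
  "inverse_fourier F x = (LINT \<xi>|lebesgue. cis (x \<bullet> \<xi>) * F \<xi>) / complex_of_real ((2 * pi) ^ 3)"

text \<open>The integrals are Lebesgue integrals. For compactly supported \<open>f \<in> H\<^sup>4\<close> and bounded measurable
  \<open>m\<close> both converge absolutely: \<open>f\<close> is in \<open>L\<^sup>1\<close>, and so is \<open>(1 - \<Delta>)\<^sup>2 f\<close>, whence \<open>fourier f \<xi>\<close> is
  \<open>O((1 + |\<xi>|\<^sup>2) powr -2)\<close>, which is integrable in dimension 3.\<close>

definition fourier_multiplier :: "(R3 \<Rightarrow> complex) \<Rightarrow> (R3 \<Rightarrow> complex) \<Rightarrow> R3 \<Rightarrow> complex" where
  "fourier_multiplier m f = inverse_fourier (\<lambda>\<xi>. m \<xi> * fourier f \<xi>)"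

text \<open>At \<open>\<xi> = 0\<close> the quotient is \<open>0\<close> instead of \<open>t\<close>, which is irrelevant under the integral.\<close>

definition sin_propagator :: "real \<Rightarrow> (R3 \<Rightarrow> complex) \<Rightarrow> R3 \<Rightarrow> complex" where
  "sin_propagator t = fourier_multiplier (\<lambda>\<xi>. complex_of_real (sin (t * norm \<xi>) / norm \<xi>))"

definition cos_propagator :: "real \<Rightarrow> (R3 \<Rightarrow> complex) \<Rightarrow> R3 \<Rightarrow> complex" where
  "cos_propagator t = fourier_multiplier (\<lambda>\<xi>. complex_of_real (cos (t * norm \<xi>)))"

end

theory Submission
  imports Defs "HOL-Probability.Probability" "HOL-Real_Asymp.Real_Asymp"
begin

text \<open>Write \<open>f = (1 - \<Delta>)\<^bsup>-2\<^esup> h\<close> with \<open>h = (1 - \<Delta>)\<^sup>2 f\<close>, which is square integrable and supported in the ball.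
  Then both propagators are convolutions of \<open>h\<close> with radial kernels whose symbols are integrable, and in
  spherical coordinates such a kernel becomes a one-dimensional oscillatory integral. Integration by parts
  bounds it at distance \<open>r\<close> from the origin by a multiple of \<open>1 / ((1 + r) (1 + (t - r)\<^sup>2))\<close>, so it concentrates near the
  light cone. A sphere meets a ball of radius \<open>R\<close> in a cap of area \<open>O(R\<^sup>2)\<close> uniformly in the centre and radius of
  the sphere, hence the \<open>L\<^sup>2\<close> norm of the kernel over such a ball is \<open>O(min 1 (R / (1 + t)))\<close>. The Cauchy-Schwarz
  inequality concludes; neither Kirchhoff's formula nor Plancherel's theorem is needed.\<close>

section \<open>Spherical coordinates\<close>

text \<open>Four derivatives are spent because the cosine symbol does not decay: \<rho>^2 times one
  factor (1 + \<rho>^2)^-1 is not integrable, with two factors it is. The radial integrands extend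
  evenly to the whole line, so two integrations by parts leave no boundary term at the origin; this
  yields the square in 1 + (t - r)^2. Both entries of the minimum come from the same kernel bound:
  its L2 norm over all of space is bounded uniformly in t, and near the light cone 1 / (1 + r) is
  comparable to 1 / (1 + t), while the caps supply R. The function h is never formed. Its expansion
  has coefficients of total size 1 + 2 * 3 + 9 = 16, and every weak derivative in it is estimated
  separately by the full norm. The remaining work is forced by the definition of that norm:
  \<open>weak_deriv\<close> is a choice of representative on the open ball, whereas the Fourier
  transform needs derivatives on the whole space. Linking the two takes uniqueness and locality of
  weak derivatives, hence the fundamental lemma of the calculus of variations, hence explicit test
  functions.\<close>

lemma distr_lborel_orthogonal:
  fixes U :: "real ^ 'n::{finite,wellorder} \<Rightarrow> real ^ 'n::{finite,wellorder}"
  assumes U: "orthogonal_transformation U"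
  shows "distr lborel borel U = lborel"
proof (rule lborel_eqI[symmetric])
  have lin: "linear U" using U by (rule orthogonal_transformation_linear)
  have [measurable]: "U \<in> borel_measurable borel"
    by (intro borel_measurable_continuous_onI linear_continuous_on linear_conv_bounded_linear[THEN iffD1] lin)
  fix l u :: "real ^ 'n::{finite,wellorder}" assume le: "\<And>b. b \<in> Basis \<Longrightarrow> l \<bullet> b \<le> u \<bullet> b"
  have bij: "bij U" using U by (rule orthogonal_transformation_bij)
  have inv: "orthogonal_transformation (inv U)" using U by (rule orthogonal_transformation_inv)
  have eq: "U -` box l u = inv U ` box l u" using bij by (rule bij_vimage_eq_inv_image)
  have "emeasure (distr lborel borel U) (box l u) = emeasure lborel (U -` box l u)"
    by (subst emeasure_distr) auto
  also have "\<dots> = emeasure lebesgue (inv U ` box l u)"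
  proof -
    have "U -` box l u \<in> sets lborel"
      using measurable_sets[of U borel borel "box l u"] by (simp only: space_borel Int_UNIV_right sets_lborel) simp
    then have "emeasure lebesgue (U -` box l u) = emeasure lborel (U -` box l u)" using nn_integral_completion[of lborel "indicator (U -` box l u)"]
      by (subst (asm) (1 2) nn_integral_indicator) (auto simp del: emeasure_completion intro: sets_completionI_sets)
    then show ?thesis by (simp only: eq)
  qed
  also have "\<dots> = emeasure lebesgue (box l u)"
    using emeasure_eq_measure2[OF measurable_orthogonal_image[OF inv, of "box l u"]]
      emeasure_eq_measure2[of "box l u" lebesgue] measure_orthogonal_image[OF inv, of "box l u"]
    by simp
  also have "\<dots> = (\<Prod>b\<in>Basis. (u - l) \<bullet> b)" using le by (simp add: emeasure_lborel_box_eq prod_ennreal)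
  finally show "emeasure (distr lborel borel U) (box l u) = ennreal (\<Prod>b\<in>Basis. (u - l) \<bullet> b)" .
qed simp

text \<open>The two coordinates across the axis are merged into one complex number, so that a planar
  slice of a ball is a \<open>cball\<close> of known area.\<close>

definition cyl :: "real \<times> complex \<Rightarrow> R3" where
  "cyl p = (\<chi> i. if i = 1 then fst p else if i = 2 then Re (snd p) else Im (snd p))"

lemma cyl_nth [simp]: "cyl p $ 1 = fst p" "cyl p $ 2 = Re (snd p)" "cyl p $ 3 = Im (snd p)"
  by (simp_all add: cyl_def)

lemma norm_cyl: "norm (cyl p) = sqrt ((fst p)\<^sup>2 + (norm (snd p))\<^sup>2)"
  by (simp add: norm_vec_def L2_set_def sum_3 cmod_def)

lemma cyl_measurable [measurable]: "cyl \<in> borel_measurable borel"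
proof -
  have "continuous_on UNIV (\<lambda>p. \<chi> i::3. if i = 1 then fst p else if i = 2 then Re (snd p) else Im (snd p))"
  proof (rule continuous_on_vec_lambda)
    fix i :: 3
    show "continuous_on UNIV (\<lambda>p. if i = 1 then fst p else if i = 2 then Re (snd p) else Im (snd p))"
      using exhaust_3[of i] by (auto intro!: continuous_intros)
  qed
  then have "continuous_on UNIV cyl" by (simp add: cyl_def[abs_def])
  then show ?thesis by (rule borel_measurable_continuous_onI)
qed

lemma distr_lborel_cyl: "distr lborel borel cyl = lborel"
proof (rule lborel_eqI[symmetric])
  fix l u :: R3 assume le0: "\<And>b. b \<in> Basis \<Longrightarrow> l \<bullet> b \<le> u \<bullet> b"
  then have le: "l $ i \<le> u $ i" for i
    using le0[of "axis i 1"] by (auto simp: inner_axis Basis_vec_def)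
  have B: "(\<Prod>b\<in>Basis. (u - l) \<bullet> b) = (\<Prod>i\<in>UNIV. u $ i - l $ i)"
  proof -
    have "Basis = (\<lambda>i::3. axis i (1::real)) ` UNIV" by (auto simp: Basis_vec_def)
    then have "(\<Prod>b\<in>Basis. (u - l) \<bullet> b) = (\<Prod>b\<in>(\<lambda>i::3. axis i (1::real)) ` UNIV. (u - l) \<bullet> b)" by metis
    also have "\<dots> = (\<Prod>i\<in>UNIV. u $ i - l $ i)"
      by (subst prod.reindex) (auto simp: inj_on_def axis_eq_axis inner_axis)
    finally show ?thesis .
  qed
  have eq: "cyl -` box l u = {l $ 1 <..< u $ 1} \<times> box (Complex (l $ 2) (l $ 3)) (Complex (u $ 2) (u $ 3))"
    by (auto simp: mem_box_cart forall_3 mem_box Basis_complex_def inner_complex_def)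
  have "emeasure (distr lborel borel cyl) (box l u) = emeasure (lborel \<Otimes>\<^sub>M lborel) (cyl -` box l u)"
    by (subst emeasure_distr) (auto simp: lborel_prod)
  also have "\<dots> = emeasure lborel {l $ 1 <..< u $ 1} * emeasure lborel (box (Complex (l $ 2) (l $ 3)) (Complex (u $ 2) (u $ 3)))"
    unfolding eq by (rule lborel.emeasure_pair_measure_Times) auto
  also have "\<dots> = ennreal (u $ 1 - l $ 1) * ennreal ((u $ 2 - l $ 2) * (u $ 3 - l $ 3))"
    using le by (simp add: emeasure_lborel_box_eq Basis_complex_def inner_complex_def complex_eq_iff)
  also have "\<dots> = ennreal (\<Prod>b\<in>Basis. (u - l) \<bullet> b)"
  proof -
    have "(\<Prod>i\<in>UNIV. u $ i - l $ i) = (u $ 1 - l $ 1) * ((u $ 2 - l $ 2) * (u $ 3 - l $ 3))"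
      unfolding UNIV_3 by simp
    then show ?thesis unfolding B using le[of 1] le[of 2] le[of 3] by (simp only: ennreal_mult'[symmetric] diff_ge_0_iff_ge)
  qed
  finally show "emeasure (distr lborel borel cyl) (box l u) = ennreal (\<Prod>b\<in>Basis. (u - l) \<bullet> b)" .
qed simp

text \<open>The distribution function at T is the area pi (T^2 - a^2) of a disc, whose derivative in
  T is 2 pi T whatever a is. This is Archimedes' theorem that slices of a sphere of equal height
  have equal area.\<close>

lemma distr_lborel_radius:
  "distr lborel borel (\<lambda>w::complex. sqrt (a\<^sup>2 + (norm w)\<^sup>2)) =
     density lborel (\<lambda>\<rho>. ennreal (2 * pi * \<rho>) * indicator {\<bar>a\<bar>..} \<rho>)" (is "?M = ?N")
proof (rule measure_eqI_generator_eq[where E="range (\<lambda>T. {..T})" and \<Omega>=UNIV and A="\<lambda>n. {..real n}"])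
  show "Int_stable (range (\<lambda>T::real. {..T}))"
    by (auto simp: Int_stable_def)
  have key: "emeasure ?M {..T} = (if \<bar>a\<bar> \<le> T then ennreal (pi * (T\<^sup>2 - a\<^sup>2)) else 0)" for T
  proof -
    have "emeasure ?M {..T} = emeasure lborel {w::complex. sqrt (a\<^sup>2 + (norm w)\<^sup>2) \<le> T}"
      by (subst emeasure_distr) (auto simp: vimage_def)
    also have "\<dots> = (if \<bar>a\<bar> \<le> T then ennreal (pi * (T\<^sup>2 - a\<^sup>2)) else 0)"
    proof (cases "\<bar>a\<bar> \<le> T")
      case True
      then have sq: "a\<^sup>2 \<le> T\<^sup>2" by (metis abs_ge_zero abs_of_nonneg order_trans abs_le_square_iff)
      have "sqrt (a\<^sup>2 + (norm w)\<^sup>2) \<le> T \<longleftrightarrow> norm w \<le> sqrt (T\<^sup>2 - a\<^sup>2)" for w :: complex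
      proof -
        have "sqrt (a\<^sup>2 + (norm w)\<^sup>2) \<le> T \<longleftrightarrow> a\<^sup>2 + (norm w)\<^sup>2 \<le> T\<^sup>2"
          using True by (metis abs_ge_zero order_trans real_sqrt_le_iff real_sqrt_unique)
        also have "\<dots> \<longleftrightarrow> (norm w)\<^sup>2 \<le> T\<^sup>2 - a\<^sup>2" by auto
        also have "\<dots> \<longleftrightarrow> norm w \<le> sqrt (T\<^sup>2 - a\<^sup>2)"
          by (metis norm_ge_zero real_le_rsqrt real_sqrt_le_iff real_sqrt_unique)
        finally show ?thesis .
      qed
      then have "{w::complex. sqrt (a\<^sup>2 + (norm w)\<^sup>2) \<le> T} = cball 0 (sqrt (T\<^sup>2 - a\<^sup>2))"
        by (intro set_eqI) (simp only: mem_Collect_eq mem_cball_0)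
      then show ?thesis using True sq by (simp add: emeasure_cball unit_ball_vol_2)
    next
      case False
      have "\<not> sqrt (a\<^sup>2 + (norm w)\<^sup>2) \<le> T" for w :: complex
        using False real_sqrt_ge_abs1[of a "norm w"] by linarith
      then show ?thesis using False by simp
    qed
    finally show ?thesis .
  qed
  fix X assume "X \<in> range (\<lambda>T::real. {..T})"
  then obtain T where X: "X = {..T}" by auto
  have "emeasure ?N X = (\<integral>\<^sup>+\<rho>. ennreal (2 * pi * \<rho>) * indicator {\<bar>a\<bar>..T} \<rho> \<partial>lborel)"
    unfolding X by (subst emeasure_density) (auto intro!: nn_integral_cong simp: indicator_def)
  also have "\<dots> = (if \<bar>a\<bar> \<le> T then ennreal (pi * (T\<^sup>2 - a\<^sup>2)) else 0)"
  proof (cases "\<bar>a\<bar> \<le> T")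
    case True
    have "(\<integral>\<^sup>+\<rho>. ennreal (2 * pi * \<rho>) * indicator {\<bar>a\<bar>..T} \<rho> \<partial>lborel) = ennreal (pi * T\<^sup>2 - pi * \<bar>a\<bar>\<^sup>2)"
      by (rule nn_integral_FTC_Icc) (auto intro!: derivative_eq_intros True)
    then show ?thesis using True by (simp add: algebra_simps)
  qed simp
  finally show "emeasure ?M X = emeasure ?N X" using key[of T] by (simp add: X)
next
  show "emeasure ?M {..real n} \<noteq> \<infinity>" for n
  proof -
    have "{w::complex. sqrt (a\<^sup>2 + (norm w)\<^sup>2) \<le> n} \<subseteq> cball 0 n"
    proof (intro subsetI)
      fix w :: complex assume "w \<in> {w. sqrt (a\<^sup>2 + (norm w)\<^sup>2) \<le> n}"
      then show "w \<in> cball 0 n" using real_sqrt_sum_squares_ge2[where x=a and y="norm w"] by (simp del: real_sqrt_sum_squares_ge2)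
    qed
    then have "emeasure lborel {w::complex. sqrt (a\<^sup>2 + (norm w)\<^sup>2) \<le> n} \<le> emeasure lborel (cball (0::complex) n)"
      by (rule emeasure_mono) auto
    then show ?thesis
      by (subst emeasure_distr) (auto simp: vimage_def emeasure_cball top_unique)
  qed
  show "sets ?M = sigma_sets UNIV (range (\<lambda>T. {..T}))" "sets ?N = sigma_sets UNIV (range (\<lambda>T. {..T}))"
    by (simp_all add: borel_eq_atMost)
  show "(\<Union>i. {..real i}) = UNIV" by (auto simp: real_arch_simple)
qed auto

text \<open>Here \<sigma> is the cosine of the angle with the axis e, and the azimuth is already
  integrated out. At fixed height a the planar variable is pushed forward to the radius \<rho>;
  after exchanging the integrals, a = \<rho> \<sigma> contributes the second factor \<rho>.\<close>

lemma nn_integral_polar: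
  fixes e :: R3 and \<phi> :: "real \<times> real \<Rightarrow> ennreal"
  assumes e: "norm e = 1" and [measurable]: "\<phi> \<in> borel_measurable (borel \<Otimes>\<^sub>M borel)"
  shows "(\<integral>\<^sup>+z. \<phi> (e \<bullet> z / norm z, norm z) \<partial>lborel) =
    (\<integral>\<^sup>+\<rho>. ennreal (2 * pi * \<rho>\<^sup>2) * indicator {0<..} \<rho> * (\<integral>\<^sup>+\<sigma>. indicator {-1..1} \<sigma> * \<phi> (\<sigma>, \<rho>) \<partial>lborel) \<partial>lborel)"
proof -
  obtain U :: "R3 \<Rightarrow> R3" where U: "orthogonal_transformation U" and Ue: "U (axis 1 1) = e"
    using orthogonal_transformation_exists[of "axis 1 1 :: R3" e] e by auto
  have lin: "linear U" using U by (rule orthogonal_transformation_linear)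
  have [measurable]: "U \<in> borel_measurable borel"
    by (intro borel_measurable_continuous_onI linear_continuous_on linear_conv_bounded_linear[THEN iffD1] lin)
  define N where "N a w = sqrt (a\<^sup>2 + (norm w)\<^sup>2)" for a and w :: complex
  have [measurable]: "case_prod N \<in> borel_measurable (borel \<Otimes>\<^sub>M borel)"
    unfolding N_def by measurable
  have [measurable]: "cyl \<in> borel_measurable (borel \<Otimes>\<^sub>M borel)"
    using cyl_measurable by (simp add: borel_prod)
  \<comment> \<open>Since U carries the first axis to e, the first cylindrical coordinate becomes
    the component along e.\<close>
  have L: "lborel = distr (lborel \<Otimes>\<^sub>M lborel) borel (\<lambda>p. U (cyl p))"
    by (subst distr_lborel_orthogonal[OF U, symmetric], subst distr_lborel_cyl[symmetric])
       (simp add: distr_distr comp_def lborel_prod)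
  have eU: "e \<bullet> U (cyl p) = fst p" for p
    using U unfolding Ue[symmetric] by (simp add: orthogonal_transformation_def inner_axis')
  have nU: "norm (U (cyl p)) = N (fst p) (snd p)" for p
    using U by (simp add: orthogonal_transformation_norm norm_cyl N_def)
  have "(\<integral>\<^sup>+z. \<phi> (e \<bullet> z / norm z, norm z) \<partial>lborel) =
     (\<integral>\<^sup>+p. \<phi> (fst p / N (fst p) (snd p), N (fst p) (snd p)) \<partial>(lborel \<Otimes>\<^sub>M lborel))"
    by (subst L, subst nn_integral_distr) (simp_all add: eU nU)
  also have "\<dots> = (\<integral>\<^sup>+a. \<integral>\<^sup>+w. \<phi> (a / N a w, N a w) \<partial>lborel \<partial>lborel)"
    by (subst lborel.nn_integral_fst[symmetric]) simp_all
  also have "\<dots> = (\<integral>\<^sup>+a. \<integral>\<^sup>+\<rho>. ennreal (2 * pi * \<rho>) * indicator {\<bar>a\<bar>..} \<rho> * \<phi> (a / \<rho>, \<rho>) \<partial>lborel \<partial>lborel)"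
  proof (intro nn_integral_cong)
    fix a :: real
    have "(\<integral>\<^sup>+w. \<phi> (a / N a w, N a w) \<partial>lborel) = (\<integral>\<^sup>+\<rho>. \<phi> (a / \<rho>, \<rho>) \<partial>distr lborel borel (N a))"
      by (subst nn_integral_distr) (simp_all add: N_def)
    also have "\<dots> = (\<integral>\<^sup>+\<rho>. ennreal (2 * pi * \<rho>) * indicator {\<bar>a\<bar>..} \<rho> * \<phi> (a / \<rho>, \<rho>) \<partial>lborel)"
      unfolding N_def[abs_def] distr_lborel_radius by (subst nn_integral_density) simp_all
    finally show "(\<integral>\<^sup>+w. \<phi> (a / N a w, N a w) \<partial>lborel) = \<dots>" .
  qed
  also have "\<dots> = (\<integral>\<^sup>+\<rho>. \<integral>\<^sup>+a. ennreal (2 * pi * \<rho>) * (if \<bar>a\<bar> \<le> \<rho> then 1 else 0) * \<phi> (a / \<rho>, \<rho>) \<partial>lborel \<partial>lborel)"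
    by (subst lborel_pair.Fubini') (auto intro!: nn_integral_cong simp: indicator_def)
  also have "\<dots> = (\<integral>\<^sup>+\<rho>. ennreal (2 * pi * \<rho>\<^sup>2) * indicator {0<..} \<rho> * (\<integral>\<^sup>+\<sigma>. indicator {-1..1} \<sigma> * \<phi> (\<sigma>, \<rho>) \<partial>lborel) \<partial>lborel)"
  proof (intro nn_integral_cong)
    fix \<rho> :: real
    show "(\<integral>\<^sup>+a. ennreal (2 * pi * \<rho>) * (if \<bar>a\<bar> \<le> \<rho> then 1 else 0) * \<phi> (a / \<rho>, \<rho>) \<partial>lborel) =
       ennreal (2 * pi * \<rho>\<^sup>2) * indicator {0<..} \<rho> * (\<integral>\<^sup>+\<sigma>. indicator {-1..1} \<sigma> * \<phi> (\<sigma>, \<rho>) \<partial>lborel)"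
    proof (cases "\<rho> > 0")
      case True
      have "(\<integral>\<^sup>+a. ennreal (2 * pi * \<rho>) * (if \<bar>a\<bar> \<le> \<rho> then 1 else 0) * \<phi> (a / \<rho>, \<rho>) \<partial>lborel)
         = ennreal \<bar>\<rho>\<bar> * (\<integral>\<^sup>+\<sigma>. ennreal (2 * pi * \<rho>) * (if \<bar>0 + \<rho> * \<sigma>\<bar> \<le> \<rho> then 1 else 0) * \<phi> ((0 + \<rho> * \<sigma>) / \<rho>, \<rho>) \<partial>lborel)"
        using True by (intro nn_integral_real_affine) auto
      also have "\<dots> = ennreal \<rho> * (\<integral>\<^sup>+\<sigma>. ennreal (2 * pi * \<rho>) * (indicator {-1..1} \<sigma> * \<phi> (\<sigma>, \<rho>)) \<partial>lborel)"
      proof -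
        have "\<bar>0 + \<rho> * \<sigma>\<bar> \<le> \<rho> \<longleftrightarrow> \<sigma> \<in> {-1..1}" for \<sigma>
        proof -
          have "\<bar>0 + \<rho> * \<sigma>\<bar> \<le> \<rho> \<longleftrightarrow> \<rho> * \<bar>\<sigma>\<bar> \<le> \<rho> * 1" using True by (simp add: abs_mult)
          also have "\<dots> \<longleftrightarrow> \<sigma> \<in> {-1..1}" using True by (subst mult_le_cancel_left_pos) (auto simp: abs_le_iff)
          finally show ?thesis .
        qed
        then have ind: "(if \<bar>0 + \<rho> * \<sigma>\<bar> \<le> \<rho> then 1 else 0) = (indicator {-1..1} \<sigma> :: ennreal)" for \<sigma>
          by (simp only: indicator_def of_bool_def)
        have "ennreal \<bar>\<rho>\<bar> = ennreal \<rho>" "\<And>\<sigma>. (0 + \<rho> * \<sigma>) / \<rho> = \<sigma>" using True by simp_all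
        then show ?thesis by (simp only: ind mult.assoc)
      qed
      also have "\<dots> = ennreal \<rho> * (ennreal (2 * pi * \<rho>) * (\<integral>\<^sup>+\<sigma>. indicator {-1..1} \<sigma> * \<phi> (\<sigma>, \<rho>) \<partial>lborel))"
        by (subst nn_integral_cmult) simp_all
      also have "\<dots> = (ennreal \<rho> * ennreal (2 * pi * \<rho>)) * (\<integral>\<^sup>+\<sigma>. indicator {-1..1} \<sigma> * \<phi> (\<sigma>, \<rho>) \<partial>lborel)"
        by (simp add: mult_ac)
      also have "ennreal \<rho> * ennreal (2 * pi * \<rho>) = ennreal (2 * pi * \<rho>\<^sup>2)"
        using True by (simp add: ennreal_mult[symmetric] power2_eq_square mult_ac)
      finally show ?thesis using True by simp
    next
      case False
      \<comment> \<open>\<open>ennreal\<close> truncates negative reals to 0, so both sides vanish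
        for \<rho> \<le> 0.\<close>
      then have "ennreal (2 * pi * \<rho>) = 0" by (simp add: ennreal_eq_0_iff mult_nonneg_nonpos)
      with False show ?thesis by simp
    qed
  qed
  finally show ?thesis .
qed

section \<open>One-dimensional oscillatory integrals\<close>

lemma integrable_dominated:
  fixes f :: "'a \<Rightarrow> 'b::{banach, second_countable_topology}" and g :: "'a \<Rightarrow> real"
  assumes "integrable M g" "f \<in> borel_measurable M" "\<And>x. norm (f x) \<le> g x"
  shows "integrable M f"
  by (rule Bochner_Integration.integrable_bound[OF assms(1,2)])
    (use assms(3) in \<open>auto intro!: AE_I2 intro: order_trans[OF _ abs_ge_self]\<close>)

lemma integrable_inverse_1_plus_sq: "integrable lborel (\<lambda>x::real. inverse (1 + x\<^sup>2))"
  and integral_inverse_1_plus_sq: "(LINT x|lborel. inverse (1 + x\<^sup>2)) = pi"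
proof -
  have UN: "einterval (-\<infinity>) \<infinity> = UNIV" by (auto simp: einterval_def)
  show "integrable lborel (\<lambda>x::real. inverse (1 + x\<^sup>2))"
    using integrable_inverse_1_plus_square by (simp add: UN set_integrable_def)
  show "(LINT x|lborel. inverse (1 + x\<^sup>2)) = pi"
    using LBINT_inverse_1_plus_square by (simp add: UN interval_lebesgue_integral_def set_lebesgue_integral_def)
qed

text \<open>The trivial bound M pi applies to the integral J of F and, since a^2 J = - J2, also to
  a^2 J. Adding the two gives the factor 1 + a^2 without separating small and large a.\<close>

lemma oscillatory_integral_bound:
  fixes F F' F'' :: "real \<Rightarrow> real"
  assumes F: "\<And>x. (F has_real_derivative F' x) (at x)" "\<And>x. (F' has_real_derivative F'' x) (at x)"
    and cont: "continuous_on UNIV F''"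
    and bound: "\<And>x. \<bar>F x\<bar> \<le> M * inverse (1 + x\<^sup>2)" "\<And>x. \<bar>F' x\<bar> \<le> M * inverse (1 + x\<^sup>2)"
      "\<And>x. \<bar>F'' x\<bar> \<le> M * inverse (1 + x\<^sup>2)"
  shows "integrable lborel F"
    and "norm (LINT x|lborel. cis (a * x) * complex_of_real (F x)) \<le> 2 * pi * M / (1 + a\<^sup>2)"
proof -
  have contF: "continuous_on UNIV F" "continuous_on UNIV F'"
    using F by (auto intro!: continuous_at_imp_continuous_on DERIV_isCont)
  have [measurable]: "F \<in> borel_measurable borel" "F'' \<in> borel_measurable borel"
    using contF cont by (auto intro: borel_measurable_continuous_onI)
  have M: "M \<ge> 0" using bound(1)[of 0] by simp
  have B: "integrable lborel (\<lambda>x::real. M * inverse (1 + x\<^sup>2))"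
    by (intro integrable_mult_right integrable_inverse_1_plus_sq)
  show "integrable lborel F"
    by (rule integrable_dominated[OF B]) (use bound(1) in auto)
  have int: "integrable lborel (\<lambda>x. cis (a * x) * complex_of_real (f x))"
    and le: "norm (LINT x|lborel. cis (a * x) * complex_of_real (f x)) \<le> M * pi"
    if [measurable]: "f \<in> borel_measurable borel" and f: "\<And>x. \<bar>f x\<bar> \<le> M * inverse (1 + x\<^sup>2)" for f
  proof -
    have [measurable]: "(\<lambda>x::real. cis (a * x)) \<in> borel_measurable borel"
      by (intro borel_measurable_continuous_onI continuous_intros)
    show i: "integrable lborel (\<lambda>x. cis (a * x) * complex_of_real (f x))"
      by (rule integrable_dominated[OF B]) (use f in \<open>auto simp: norm_mult\<close>)
    have "norm (LINT x|lborel. cis (a * x) * complex_of_real (f x)) \<le> (LINT x|lborel. M * inverse (1 + x\<^sup>2))"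
      by (rule Bochner_Integration.integral_norm_bound_integral[OF i B]) (use f in \<open>simp add: norm_mult\<close>)
    then show "norm (LINT x|lborel. cis (a * x) * complex_of_real (f x)) \<le> M * pi"
      by (simp add: integral_inverse_1_plus_sq)
  qed
  define J J2 where "J = (LINT x|lborel. cis (a * x) * complex_of_real (F x))"
    and "J2 = (LINT x|lborel. cis (a * x) * complex_of_real (F'' x))"
  \<comment> \<open>Both integrations by parts at once: \<open>?H\<close> below is a primitive of \<open>cis (a x) (F'' + a\<^sup>2 F)\<close> vanishing at infinity.\<close>
  have "J2 + a\<^sup>2 * J = 0"
  proof -
    let ?H = "\<lambda>x. cis (a * x) * (complex_of_real (F' x) - \<i> * a * complex_of_real (F x))"
    let ?h = "\<lambda>x. cis (a * x) * complex_of_real (F'' x) + a\<^sup>2 * (cis (a * x) * complex_of_real (F x))"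
    have UN: "einterval (-\<infinity>) \<infinity> = UNIV" by (auto simp: einterval_def)
    have ih: "integrable lborel ?h"
      by (intro Bochner_Integration.integrable_add integrable_mult_right int bound) auto
    have nH: "norm (?H x) \<le> (M + \<bar>a\<bar> * M) * inverse (1 + x\<^sup>2)" for x
    proof -
      have "norm (?H x) \<le> \<bar>F' x\<bar> + \<bar>a\<bar> * \<bar>F x\<bar>"
        using norm_triangle_ineq4[of "complex_of_real (F' x)" "\<i> * a * complex_of_real (F x)"]
        by (simp add: norm_mult)
      also have "\<dots> \<le> M * inverse (1 + x\<^sup>2) + \<bar>a\<bar> * (M * inverse (1 + x\<^sup>2))"
        using bound by (intro add_mono mult_left_mono) auto
      finally show ?thesis by (simp add: algebra_simps)
    qed
    have lim: "((\<lambda>x::real. (M + \<bar>a\<bar> * M) * inverse (1 + x\<^sup>2)) \<longlongrightarrow> 0) at_top"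
      "((\<lambda>x::real. (M + \<bar>a\<bar> * M) * inverse (1 + x\<^sup>2)) \<longlongrightarrow> 0) at_bot"
      by real_asymp+
    have "(LBINT x=-\<infinity>..\<infinity>. ?h x) = 0 - 0"
    proof (rule interval_integral_FTC_integrable)
      fix x :: real
      have dF: "((\<lambda>x. complex_of_real (F x)) has_vector_derivative complex_of_real (F' x)) (at x)"
        "((\<lambda>x. complex_of_real (F' x)) has_vector_derivative complex_of_real (F'' x)) (at x)"
        using F[of x] by (auto intro!: has_vector_derivative_of_real simp: has_real_derivative_iff_has_vector_derivative)
      have dc: "((\<lambda>x. cis (a * x)) has_vector_derivative \<i> * a * cis (a * x)) (at x)"
      proof -
        have "((\<lambda>z. exp (\<i> * (a * z))) has_field_derivative \<i> * a * exp (\<i> * (a * x))) (at (complex_of_real x))"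
          by (auto intro!: derivative_eq_intros)
        then show ?thesis unfolding cis_conv_exp of_real_mult by (rule has_vector_derivative_real_field)
      qed
      show "(?H has_vector_derivative ?h x) (at x)"
        by (rule has_vector_derivative_eq_rhs[OF has_vector_derivative_mult[OF dc
             has_vector_derivative_diff[OF dF(2) has_vector_derivative_mult_right[OF dF(1)]]]])
           (simp add: ring_distribs power2_eq_square mult_ac)
      show "isCont ?h x"
      proof -
        have "isCont F x" "isCont F'' x" using cont contF by (auto simp: continuous_on_eq_continuous_at)
        then show ?thesis by (intro continuous_intros has_vector_derivative_continuous[OF dc])
      qed
    next
      show "set_integrable lborel (einterval (-\<infinity>) \<infinity>) ?h"
        using ih by (simp add: UN set_integrable_def)
      show "((?H \<circ> real_of_ereal) \<longlongrightarrow> 0) (at_right (-\<infinity>))"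
        unfolding ereal_tendsto_simps by (rule Lim_null_comparison[OF _ lim(2)]) (use nH in auto)
      show "((?H \<circ> real_of_ereal) \<longlongrightarrow> 0) (at_left \<infinity>)"
        unfolding ereal_tendsto_simps by (rule Lim_null_comparison[OF _ lim(1)]) (use nH in auto)
    qed auto
    then have "(LINT x|lborel. ?h x) = 0"
      by (simp add: UN interval_lebesgue_integral_def set_lebesgue_integral_def)
    then show ?thesis unfolding J_def J2_def
      by (subst (asm) Bochner_Integration.integral_add) (auto intro!: int bound integrable_mult_right)
  qed
  then have "complex_of_real (a\<^sup>2) * J = - J2" by (simp add: add_eq_0_iff)
  then have "a\<^sup>2 * norm J = norm J2" by (metis norm_minus_cancel norm_mult norm_of_real abs_power2)
  moreover have "norm J \<le> M * pi" "norm J2 \<le> M * pi" unfolding J_def J2_def by (auto intro!: le bound)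
  ultimately have "(1 + a\<^sup>2) * norm J \<le> 2 * pi * M" by (simp add: algebra_simps)
  then show "norm J \<le> 2 * pi * M / (1 + a\<^sup>2)"
    by (simp add: pos_le_divide_eq add_pos_nonneg mult.commute)
qed

text \<open>As a function of \<open>norm \<xi>\<close>, this is the symbol of \<open>(1 - \<Delta>)\<^bsup>-2\<^esup>\<close>.\<close>

abbreviation bessel_weight :: "real \<Rightarrow> real" where
  "bessel_weight x \<equiv> (inverse (1 + x\<^sup>2))\<^sup>2"

text \<open>Replacing |x| by max 1 |x| makes powers monotone in the exponent, so every j reduces to
  2 k, and (max 1 |x|)^2 \<le> 1 + x^2.\<close>

lemma power_mult_inverse_le:
  fixes x :: real assumes "j \<le> 2 * k"
  shows "\<bar>x ^ j * inverse (1 + x\<^sup>2) ^ Suc k\<bar> \<le> inverse (1 + x\<^sup>2)"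
proof -
  have "\<bar>x\<bar> ^ j \<le> (max 1 \<bar>x\<bar>) ^ j" by (intro power_mono) auto
  also have "\<dots> \<le> (max 1 \<bar>x\<bar>) ^ (2 * k)" by (intro power_increasing assms) auto
  also have "\<dots> = ((max 1 \<bar>x\<bar>)\<^sup>2) ^ k" by (simp add: power_mult)
  also have "\<dots> \<le> (1 + x\<^sup>2) ^ k" by (intro power_mono) (auto simp: max_def)
  finally have "\<bar>x\<bar> ^ j * inverse (1 + x\<^sup>2) ^ k \<le> (1 + x\<^sup>2) ^ k * inverse (1 + x\<^sup>2) ^ k"
    by (intro mult_right_mono) auto
  also have "\<dots> = 1" using add_pos_nonneg[of 1 "x\<^sup>2"] by (simp add: power_mult_distrib[symmetric])
  finally have "\<bar>x\<bar> ^ j * inverse (1 + x\<^sup>2) ^ k * inverse (1 + x\<^sup>2) \<le> 1 * inverse (1 + x\<^sup>2)"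
    by (intro mult_right_mono) auto
  then show ?thesis by (simp add: abs_mult power_abs mult_ac)
qed

text \<open>The powers 0, 1, 2 are those that remain when the factors \<rho>^2 and \<rho> from polar
  coordinates meet the two propagator symbols. Differentiation costs no decay: every term of F' and
  F'' is again covered by \<open>power_mult_inverse_le\<close>.\<close>

lemma bessel_weight_oscillatory:
  assumes "j \<le> 2"
  shows "integrable lborel (\<lambda>x. x ^ j * bessel_weight x)"
    and "norm (LINT x|lborel. cis (a * x) * complex_of_real (x ^ j * bessel_weight x)) \<le> 200 * pi / (1 + a\<^sup>2)"
proof -
  let ?s = "\<lambda>x::real. inverse (1 + x\<^sup>2)"
  \<comment> \<open>Natural subtraction truncates j - 1 and j - 2 only where the coefficient in
    front is 0.\<close>
  define F' where "F' x = real j * x ^ (j - 1) * ?s x ^ 2 - 4 * (x ^ (j + 1) * ?s x ^ 3)" for x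
  define F'' where "F'' x = real j * real (j - 1) * x ^ (j - 2) * ?s x ^ 2 - 4 * real (2 * j + 1) * (x ^ j * ?s x ^ 3)
     + 24 * (x ^ (j + 2) * ?s x ^ 4)" for x
  have nz: "1 + x\<^sup>2 \<noteq> 0" for x :: real using add_pos_nonneg[of 1 "x\<^sup>2"] by auto
  have nz2: "1 + x * x \<noteq> 0" for x :: real using nz[of x] by (simp add: power2_eq_square)
  have s: "(?s has_real_derivative - 2 * x * ?s x ^ 2) (at x)" for x
    by (rule derivative_eq_intros refl nz)+ (simp add: power2_eq_square)
  have j: "j = 0 \<or> j = 1 \<or> j = 2" using assms by auto
  have 1: "((\<lambda>x. x ^ j * bessel_weight x) has_real_derivative F' x) (at x)" for x
    unfolding F'_def using j
    by (elim disjE; simp; auto intro!: derivative_eq_intros s simp: nz2 algebra_simps power2_eq_square power3_eq_cube)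
  have 2: "(F' has_real_derivative F'' x) (at x)" for x
    unfolding F'_def[abs_def] F''_def using j
    by (elim disjE; simp; auto intro!: derivative_eq_intros s simp: nz2 algebra_simps power2_eq_square power3_eq_cube eval_nat_numeral)
  have 3: "continuous_on UNIV F''"
    unfolding F''_def[abs_def] by (intro continuous_intros) (use nz in auto)
  note p = power_mult_inverse_le
  \<comment> \<open>100 is a round number above the coefficient sums of the three functions, which
    are at most 1, 6 and 46.\<close>
  have b1: "\<bar>x ^ j * bessel_weight x\<bar> \<le> 100 * ?s x" for x
    using p[of j 1 x] assms by (simp add: power2_eq_square)
  have c: "\<bar>c * y\<bar> \<le> n * \<bar>?s x\<bar>" if "\<bar>y\<bar> \<le> ?s x" "0 \<le> c" "c \<le> n" for c n x y :: real
    unfolding abs_mult using that by (intro mult_mono) auto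
  have b2: "\<bar>F' x\<bar> \<le> 100 * ?s x" for x
  proof -
    have "\<bar>real j * (x ^ (j - 1) * ?s x ^ Suc 1)\<bar> \<le> 2 * \<bar>?s x\<bar>" "\<bar>4 * (x ^ (j + 1) * ?s x ^ Suc 2)\<bar> \<le> 4 * \<bar>?s x\<bar>"
      by (rule c[OF p]; use assms in simp)+
    moreover have "?s x \<ge> 0" by simp
    moreover have "Suc 1 = 2" "Suc 2 = 3" by simp_all
    ultimately show ?thesis unfolding F'_def by (simp only: mult.assoc abs_of_nonneg)
  qed
  have b3: "\<bar>F'' x\<bar> \<le> 100 * ?s x" for x
  proof -
    have "real j * real (j - 1) \<le> 2 * 1" using assms by (intro mult_mono) auto
    then have jj: "real j * real (j - 1) \<le> 2" by simp
    have "\<bar>real j * real (j - 1) * (x ^ (j - 2) * ?s x ^ Suc 1)\<bar> \<le> 2 * \<bar>?s x\<bar>"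
      "\<bar>(4 * real (2 * j + 1)) * (x ^ j * ?s x ^ Suc 2)\<bar> \<le> 20 * \<bar>?s x\<bar>"
      "\<bar>24 * (x ^ (j + 2) * ?s x ^ Suc 3)\<bar> \<le> 24 * \<bar>?s x\<bar>"
      by (rule c[OF p]; use assms jj in simp)+
    moreover have "?s x \<ge> 0" by simp
    moreover have "Suc 1 = 2" "Suc 2 = 3" "Suc 3 = 4" by simp_all
    ultimately show ?thesis unfolding F''_def by (simp only: mult.assoc abs_of_nonneg) linarith
  qed
  show "integrable lborel (\<lambda>x. x ^ j * bessel_weight x)"
    by (rule oscillatory_integral_bound(1)[OF 1 2 3 b1 b2 b3])
  show "norm (LINT x|lborel. cis (a * x) * complex_of_real (x ^ j * bessel_weight x)) \<le> 200 * pi / (1 + a\<^sup>2)"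
    using oscillatory_integral_bound(2)[OF 1 2 3 b1 b2 b3, of a] by (simp add: mult_ac)
qed

lemma bessel_weight_cos_sin:
  assumes j: "j \<le> 2"
  shows "integrable lborel (\<lambda>x. x ^ j * bessel_weight x * cos (a * x))"
    and "integrable lborel (\<lambda>x. x ^ j * bessel_weight x * sin (a * x))"
    and "\<bar>LINT x|lborel. x ^ j * bessel_weight x * cos (a * x)\<bar> \<le> 200 * pi / (1 + a\<^sup>2)"
    and "\<bar>LINT x|lborel. x ^ j * bessel_weight x * sin (a * x)\<bar> \<le> 200 * pi / (1 + a\<^sup>2)"
proof -
  note i = bessel_weight_oscillatory(1)[OF j]
  show ic: "integrable lborel (\<lambda>x. x ^ j * bessel_weight x * cos (a * x))"
    "integrable lborel (\<lambda>x. x ^ j * bessel_weight x * sin (a * x))"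
    by (auto intro!: Bochner_Integration.integrable_bound[OF i] simp: abs_mult mult_left_le)
  let ?f = "\<lambda>x. cis (a * x) * complex_of_real (x ^ j * bessel_weight x)"
  have [measurable]: "(\<lambda>x::real. cis (a * x)) \<in> borel_measurable borel"
    by (intro borel_measurable_continuous_onI continuous_intros)
  have ifc: "integrable lborel ?f"
    by (rule Bochner_Integration.integrable_bound[OF i]) (auto simp: norm_mult simp del: of_real_mult of_real_power)
  have "Re (integral\<^sup>L lborel ?f) = (LINT x|lborel. x ^ j * bessel_weight x * cos (a * x))"
    "Im (integral\<^sup>L lborel ?f) = (LINT x|lborel. x ^ j * bessel_weight x * sin (a * x))"
    unfolding integral_Re[OF ifc, symmetric] integral_Im[OF ifc, symmetric]
    by (intro Bochner_Integration.integral_cong refl;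
      simp only: times_complex.sel cis.sel Re_complex_of_real Im_complex_of_real; simp add: mult_ac)+
  then show "\<bar>LINT x|lborel. x ^ j * bessel_weight x * cos (a * x)\<bar> \<le> 200 * pi / (1 + a\<^sup>2)"
    "\<bar>LINT x|lborel. x ^ j * bessel_weight x * sin (a * x)\<bar> \<le> 200 * pi / (1 + a\<^sup>2)"
    using bessel_weight_oscillatory(2)[OF j, of a] abs_Re_le_cmod[of "integral\<^sup>L lborel ?f"]
      abs_Im_le_cmod[of "integral\<^sup>L lborel ?f"] by linarith+
qed

section \<open>Fourier transforms of radial functions\<close>

text \<open>Polar coordinates as an identity of measures, obtained by testing
  \<open>nn_integral_polar\<close> on indicators; in this form complex integrands can be transported
  too.\<close>

lemma distr_polar:
  fixes e :: R3
  assumes e: "norm e = 1"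
  shows "distr lborel (borel \<Otimes>\<^sub>M borel) (\<lambda>z. (e \<bullet> z / norm z, norm z)) =
    density (lborel \<Otimes>\<^sub>M lborel) (\<lambda>(\<sigma>, \<rho>). ennreal (2 * pi * \<rho>\<^sup>2 * indicator {0<..} \<rho> * indicator {-1..1} \<sigma>))"
    (is "?M = density ?L ?D")
proof (rule measure_eqI)
  show "sets ?M = sets (density ?L ?D)" by (simp add: sets_pair_measure_cong[OF sets_lborel sets_lborel])
  fix A assume "A \<in> sets ?M"
  then have A: "A \<in> sets (borel \<Otimes>\<^sub>M borel)" by simp
  have T[measurable]: "(\<lambda>z. (e \<bullet> z / norm z, norm z)) \<in> borel \<rightarrow>\<^sub>M borel \<Otimes>\<^sub>M borel" by measurable
  have A'[measurable]: "A \<in> sets (lborel \<Otimes>\<^sub>M lborel)" using A by (simp add: sets_pair_measure_cong[OF sets_lborel sets_lborel])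
  have "emeasure ?M A = (\<integral>\<^sup>+z. indicator A (e \<bullet> z / norm z, norm z) \<partial>lborel)"
  proof -
    have "(\<integral>\<^sup>+z. indicator A (e \<bullet> z / norm z, norm z) \<partial>lborel) = (\<integral>\<^sup>+p. indicator A p \<partial>?M)"
    proof (rule nn_integral_distr[symmetric])
      show "indicator A \<in> borel_measurable ?M" by (rule borel_measurable_indicator) (simp only: sets_distr A)
    qed measurable
    also have "\<dots> = emeasure ?M A" by (rule nn_integral_indicator) (simp only: sets_distr A)
    finally show ?thesis by simp
  qed
  also have "\<dots> = (\<integral>\<^sup>+\<rho>. ennreal (2 * pi * \<rho>\<^sup>2) * indicator {0<..} \<rho> * (\<integral>\<^sup>+\<sigma>. indicator {-1..1} \<sigma> * indicator A (\<sigma>, \<rho>) \<partial>lborel) \<partial>lborel)"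
    by (rule nn_integral_polar[OF e borel_measurable_indicator[OF A]])
  also have "\<dots> = (\<integral>\<^sup>+\<rho>. \<integral>\<^sup>+\<sigma>. ?D (\<sigma>, \<rho>) * indicator A (\<sigma>, \<rho>) \<partial>lborel \<partial>lborel)"
    by (subst nn_integral_cmult[symmetric]; (intro nn_integral_cong)?) (auto simp: indicator_def)
  also have "\<dots> = (\<integral>\<^sup>+p. ?D p * indicator A p \<partial>?L)"
    by (subst lborel_pair.nn_integral_snd[symmetric]) (auto simp: split_beta)
  also have "\<dots> = emeasure (density ?L ?D) A"
    by (rule emeasure_density[symmetric, OF _ A']) measurable
  finally show "emeasure ?M A = emeasure (density ?L ?D) A" .
qed

lemma nn_integral_radial:
  fixes f :: "real \<Rightarrow> ennreal"
  assumes [measurable]: "f \<in> borel_measurable borel"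
  shows "(\<integral>\<^sup>+z. f (norm (z::R3)) \<partial>lborel) = (\<integral>\<^sup>+\<rho>. ennreal (4 * pi * \<rho>\<^sup>2) * indicator {0<..} \<rho> * f \<rho> \<partial>lborel)"
proof -
  have "norm (axis 1 1 :: R3) = 1" by simp
  from nn_integral_polar[OF this, of "\<lambda>p. f (snd p)"]
  have "(\<integral>\<^sup>+z. f (norm (z::R3)) \<partial>lborel) =
    (\<integral>\<^sup>+\<rho>. ennreal (2 * pi * \<rho>\<^sup>2) * indicator {0<..} \<rho> * (\<integral>\<^sup>+\<sigma>. f \<rho> * indicator {-1..1::real} \<sigma> \<partial>lborel) \<partial>lborel)"
    by (simp add: mult.commute)
  also have "\<dots> = (\<integral>\<^sup>+\<rho>. ennreal (4 * pi * \<rho>\<^sup>2) * indicator {0<..} \<rho> * f \<rho> \<partial>lborel)"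
  proof (intro nn_integral_cong)
    fix \<rho> :: real
    have "ennreal (2 * pi * \<rho>\<^sup>2) * 2 = ennreal (4 * pi * \<rho>\<^sup>2)"
      using ennreal_mult[of "2 * pi * \<rho>\<^sup>2" 2] by (simp add: mult_ac)
    moreover have "(\<integral>\<^sup>+\<sigma>. f \<rho> * indicator {-1..1::real} \<sigma> \<partial>lborel) = f \<rho> * 2"
      by (simp add: nn_integral_cmult_indicator)
    ultimately show "ennreal (2 * pi * \<rho>\<^sup>2) * indicator {0<..} \<rho> * (\<integral>\<^sup>+\<sigma>. f \<rho> * indicator {-1..1::real} \<sigma> \<partial>lborel)
      = ennreal (4 * pi * \<rho>\<^sup>2) * indicator {0<..} \<rho> * f \<rho>"
      by (simp add: mult.assoc mult.left_commute mult.commute)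
  qed
  finally show ?thesis .
qed

lemma integrable_radial:
  fixes g :: "real \<Rightarrow> real"
  assumes [measurable]: "g \<in> borel_measurable borel" and g: "integrable lborel (\<lambda>\<rho>. \<rho>\<^sup>2 * g \<rho>)"
  shows "integrable lborel (\<lambda>\<xi>::R3. g (norm \<xi>))"
proof (rule integrableI_bounded)
  have "(\<integral>\<^sup>+\<xi>. ennreal (norm (g (norm (\<xi>::R3)))) \<partial>lborel) =
    (\<integral>\<^sup>+\<rho>. ennreal (4 * pi * \<rho>\<^sup>2) * indicator {0<..} \<rho> * ennreal \<bar>g \<rho>\<bar> \<partial>lborel)"
    by (subst nn_integral_radial[of "\<lambda>\<rho>. ennreal \<bar>g \<rho>\<bar>", symmetric]) simp_all
  also have "\<dots> \<le> (\<integral>\<^sup>+\<rho>. ennreal (norm (4 * pi * (\<rho>\<^sup>2 * g \<rho>))) \<partial>lborel)"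
    by (intro nn_integral_mono) (auto simp: indicator_def ennreal_mult[symmetric] abs_mult mult_ac)
  also have "\<dots> < \<infinity>"
    using integrable_mult_right[OF g, of "4 * pi"] unfolding integrable_iff_bounded by blast
  finally show "(\<integral>\<^sup>+\<xi>. ennreal (norm (g (norm (\<xi>::R3)))) \<partial>lborel) < \<infinity>" .
qed simp

lemma integral_uminus_real:
  fixes f :: "real \<Rightarrow> 'a::{banach, second_countable_topology}"
  shows "(LINT x|lborel. f (- x)) = (LINT x|lborel. f x)"
  using lborel_integral_real_affine[of "-1" f 0] by simp

text \<open>Moves radial integrals to the whole line, where integration by parts produces no term at
  the origin.\<close>

lemma integral_even_half_line:
  fixes k :: "real \<Rightarrow> real"
  assumes k: "integrable lborel k" and even: "\<And>x. k (- x) = k x"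
  shows "(LINT x|lborel. indicator {0<..} x * k x) = (LINT x|lborel. k x) / 2"
proof -
  have i: "integrable lborel (\<lambda>x. indicator {0<..} x * k x)" "integrable lborel (\<lambda>x. indicator {..<0} x * k x)"
    using integrable_real_mult_indicator[OF _ k] by (simp_all add: mult.commute)
  have "(LINT x|lborel. indicator {..<0} x * k x) = (LINT x|lborel. indicator {0<..} x * k x)"
    by (subst integral_uminus_real[symmetric]) (auto simp: even indicator_def intro!: Bochner_Integration.integral_cong)
  moreover have "(LINT x|lborel. k x) = (LINT x|lborel. indicator {0<..} x * k x + indicator {..<0} x * k x)"
  proof (rule integral_cong_AE)
    show "AE x in lborel. k x = indicator {0<..} x * k x + indicator {..<0} x * k x"
      using AE_lborel_singleton[of "0::real"] by eventually_elim (auto simp: indicator_def)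
  qed (use k i in auto)
  ultimately show ?thesis using i by simp
qed

lemma integral_cis_symmetric:
  "(LINT \<sigma>|lborel. indicator {-1..1} \<sigma> *\<^sub>R cis (b * \<sigma>)) = complex_of_real (LINT \<sigma>|lborel. indicator {-1..1} \<sigma> * cos (b * \<sigma>))"
proof -
  have [measurable]: "(\<lambda>x::real. cis (b * x)) \<in> borel_measurable borel"
    by (intro borel_measurable_continuous_onI continuous_intros)
  have i1: "integrable lborel (indicator {-1..1::real} :: real \<Rightarrow> real)" by simp
  have i: "integrable lborel (\<lambda>\<sigma>. indicator {-1..1} \<sigma> *\<^sub>R cis (b * \<sigma>))"
    by (rule Bochner_Integration.integrable_bound[OF i1]) auto
  have "(LINT \<sigma>|lborel. indicator {-1..1} \<sigma> * sin (b * \<sigma>)) = - (LINT \<sigma>|lborel. indicator {-1..1} \<sigma> * sin (b * \<sigma>))"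
    by (subst (2) integral_uminus_real[symmetric], subst integral_minus[symmetric])
      (auto simp: indicator_def intro!: Bochner_Integration.integral_cong)
  then have "(LINT \<sigma>|lborel. indicator {-1..1} \<sigma> * sin (b * \<sigma>)) = 0" by simp
  then show ?thesis
    by (intro complex_eqI) (simp_all add: integral_Re[OF i, symmetric] integral_Im[OF i, symmetric])
qed

lemma integral_cos_symmetric:
  fixes b :: real
  assumes "b \<noteq> 0"
  shows "(LINT \<sigma>|lborel. indicator {-1..1} \<sigma> * cos (b * \<sigma>)) = 2 * sin b / b"
proof -
  have "(LINT \<sigma>|lborel. cos (b * \<sigma>) * indicator {-1..1} \<sigma>) = sin (b * 1) / b - sin (b * (-1)) / b"
    by (rule integral_FTC_Icc_real[where F="\<lambda>x::real. sin (b * x) / b"]) (use assms in \<open>auto intro!: derivative_eq_intros continuous_intros\<close>)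
  then show ?thesis by (simp add: mult.commute)
qed

lemma radial_integrable_pair:
  fixes h :: "real \<Rightarrow> real" and c :: "real \<Rightarrow> real \<Rightarrow> real"
  assumes h: "integrable lborel h" and [measurable]: "case_prod c \<in> borel_measurable (borel \<Otimes>\<^sub>M borel)"
    and c: "\<And>\<sigma> \<rho>. \<bar>c \<sigma> \<rho>\<bar> \<le> 1"
  shows "integrable (lborel \<Otimes>\<^sub>M lborel) (\<lambda>(\<sigma>, \<rho>). h \<rho> * (indicator {-1..1} \<sigma> * c \<sigma> \<rho>))"
proof -
  have [measurable]: "h \<in> borel_measurable borel" using h by simp
  have "integrable (lborel \<Otimes>\<^sub>M lborel) (\<lambda>(\<sigma>, \<rho>). indicator {-1..1::real} \<sigma> * \<bar>h \<rho>\<bar>)"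
    using h by (intro lborel_pair.Fubini_integrable) (auto intro!: AE_I2)
  then show ?thesis
    by (rule Bochner_Integration.integrable_bound)
      (use c in \<open>auto simp: abs_mult split_beta indicator_def mult_left_le intro!: AE_I2\<close>)
qed

text \<open>With e as polar axis the phase is r \<rho> \<sigma>, and its odd part cancels over
  \<sigma>. The prefactor is pi instead of the azimuthal 2 pi because the radius runs over the whole
  line.\<close>

lemma radial_fourier:
  fixes e :: R3 and g :: "real \<Rightarrow> real"
  assumes e: "norm e = 1" and [measurable]: "g \<in> borel_measurable borel"
    and g: "integrable lborel (\<lambda>\<rho>. \<rho>\<^sup>2 * g \<rho>)" and even: "\<And>\<rho>. g (- \<rho>) = g \<rho>"
  shows "(LINT \<xi>|lborel. cis ((r *\<^sub>R e) \<bullet> \<xi>) * complex_of_real (g (norm \<xi>))) =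
    complex_of_real (pi * (LINT \<rho>|lborel. \<rho>\<^sup>2 * g \<rho> * (LINT \<sigma>|lborel. indicator {-1..1} \<sigma> * cos (r * \<rho> * \<sigma>))))"
proof -
  let ?T = "\<lambda>z. (e \<bullet> z / norm z, norm z)"
  let ?D = "\<lambda>(\<sigma>, \<rho>). 2 * pi * \<rho>\<^sup>2 * indicator {0<..} \<rho> * indicator {-1..1} \<sigma> :: real"
  let ?A = "\<lambda>\<rho>. LINT \<sigma>|lborel. indicator {-1..1} \<sigma> * cos (r * \<rho> * \<sigma>)"
  have cis[measurable]: "cis \<in> borel_measurable borel"
    by (intro borel_measurable_continuous_onI continuous_intros)
  define \<Phi> where "\<Phi> = (\<lambda>(\<sigma>::real, \<rho>). cis (r * \<rho> * \<sigma>) * complex_of_real (g \<rho>))"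
  have [measurable]: "\<Phi> \<in> borel_measurable (borel \<Otimes>\<^sub>M borel)" unfolding \<Phi>_def by measurable
  have T: "(\<lambda>z. ?T z) \<in> lborel \<rightarrow>\<^sub>M borel \<Otimes>\<^sub>M borel" by measurable
  \<comment> \<open>At \<xi> = 0 the cosine is 0 / 0 = 0, but it is multiplied by the norm, so the
    identity holds there as well.\<close>
  have \<Phi>: "cis ((r *\<^sub>R e) \<bullet> \<xi>) * complex_of_real (g (norm \<xi>)) = \<Phi> (?T \<xi>)" for \<xi>
    by (cases "\<xi> = 0") (simp_all add: \<Phi>_def)
  have "integrable lborel (\<lambda>\<xi>. \<Phi> (?T \<xi>))"
    by (rule Bochner_Integration.integrable_bound[OF integrable_radial[OF _ g]])
      (auto simp: \<Phi>_def norm_mult split_beta)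
  then have "integrable (distr lborel (borel \<Otimes>\<^sub>M borel) ?T) \<Phi>"
    by (subst integrable_distr_eq[OF T]) auto
  then have iD: "integrable (lborel \<Otimes>\<^sub>M lborel) (\<lambda>p. ?D p *\<^sub>R \<Phi> p)"
    unfolding distr_polar[OF e] by (subst (asm) case_prod_unfold, subst (asm) integrable_density) (auto simp: split_beta)
  have "(LINT \<xi>|lborel. cis ((r *\<^sub>R e) \<bullet> \<xi>) * complex_of_real (g (norm \<xi>))) = (LINT p|distr lborel (borel \<Otimes>\<^sub>M borel) ?T. \<Phi> p)"
    unfolding \<Phi> by (subst integral_distr[OF T]) auto
  also have "\<dots> = (LINT p|(lborel \<Otimes>\<^sub>M lborel). ?D p *\<^sub>R \<Phi> p)"
    unfolding distr_polar[OF e] by (subst case_prod_unfold, subst integral_density) (auto simp: split_beta)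
  also have "\<dots> = (LINT \<rho>|lborel. LINT \<sigma>|lborel. ?D (\<sigma>, \<rho>) *\<^sub>R \<Phi> (\<sigma>, \<rho>))"
    using lborel_pair.integral_snd[of "\<lambda>\<sigma> \<rho>. ?D (\<sigma>, \<rho>) *\<^sub>R \<Phi> (\<sigma>, \<rho>)"] iD by (simp add: case_prod_unfold)
  also have "\<dots> = (LINT \<rho>|lborel. complex_of_real (indicator {0<..} \<rho> * (2 * pi * (\<rho>\<^sup>2 * g \<rho> * ?A \<rho>))))"
  proof (intro Bochner_Integration.integral_cong refl)
    fix \<rho> :: real
    have "(LINT \<sigma>|lborel. ?D (\<sigma>, \<rho>) *\<^sub>R \<Phi> (\<sigma>, \<rho>)) =
      (LINT \<sigma>|lborel. complex_of_real (2 * pi * \<rho>\<^sup>2 * indicator {0<..} \<rho> * g \<rho>) * (indicator {-1..1} \<sigma> *\<^sub>R cis ((r * \<rho>) * \<sigma>)))"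
      by (intro Bochner_Integration.integral_cong refl) (simp add: \<Phi>_def scaleR_conv_of_real mult_ac)
    also have "\<dots> = complex_of_real (indicator {0<..} \<rho> * (2 * pi * (\<rho>\<^sup>2 * g \<rho> * ?A \<rho>)))"
      by (subst integral_mult_right_zero, subst integral_cis_symmetric) (simp add: mult_ac)
    finally show "(LINT \<sigma>|lborel. ?D (\<sigma>, \<rho>) *\<^sub>R \<Phi> (\<sigma>, \<rho>)) = \<dots>" .
  qed
  also have "\<dots> = complex_of_real (LINT \<rho>|lborel. indicator {0<..} \<rho> * (2 * pi * (\<rho>\<^sup>2 * g \<rho> * ?A \<rho>)))"
    by (rule integral_complex_of_real)
  also have "(LINT \<rho>|lborel. indicator {0<..} \<rho> * (2 * pi * (\<rho>\<^sup>2 * g \<rho> * ?A \<rho>))) = (LINT \<rho>|lborel. 2 * pi * (\<rho>\<^sup>2 * g \<rho> * ?A \<rho>)) / 2"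
  proof (rule integral_even_half_line)
    have "integrable lborel (\<lambda>\<rho>. LINT \<sigma>|lborel. (\<rho>\<^sup>2 * g \<rho>) * (indicator {-1..1} \<sigma> * cos (r * \<rho> * \<sigma>)))"
      using lborel_pair.integrable_snd[OF radial_integrable_pair[OF g, of "\<lambda>\<sigma> \<rho>. cos (r * \<rho> * \<sigma>)"]] by simp
    then show "integrable lborel (\<lambda>\<rho>. 2 * pi * (\<rho>\<^sup>2 * g \<rho> * ?A \<rho>))" by simp
  qed (simp add: even)
  finally show ?thesis by simp
qed

text \<open>Integrating over the radius first gives a bound that stays finite as \<open>r\<close> tends to 0; integrating over the
  angle first gains the factor \<open>1 / r\<close>.\<close>

lemma radial_fourier_bound_near:
  fixes e :: R3 and g :: "real \<Rightarrow> real"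
  assumes e: "norm e = 1" and [measurable]: "g \<in> borel_measurable borel"
    and g: "integrable lborel (\<lambda>\<rho>. \<rho>\<^sup>2 * g \<rho>)" and even: "\<And>\<rho>. g (- \<rho>) = g \<rho>"
    and B: "\<And>\<sigma>. \<bar>\<sigma>\<bar> \<le> 1 \<Longrightarrow> \<bar>LINT \<rho>|lborel. \<rho>\<^sup>2 * g \<rho> * cos (r * \<sigma> * \<rho>)\<bar> \<le> B"
  shows "norm (LINT \<xi>|lborel. cis ((r *\<^sub>R e) \<bullet> \<xi>) * complex_of_real (g (norm \<xi>))) \<le> 2 * pi * B"
proof -
  have pr: "integrable (lborel \<Otimes>\<^sub>M lborel) (\<lambda>(\<sigma>, \<rho>). (\<rho>\<^sup>2 * g \<rho>) * (indicator {-1..1} \<sigma> * cos (r * \<rho> * \<sigma>)))"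
    by (rule radial_integrable_pair[OF g]) auto
  have "(LINT \<rho>|lborel. \<rho>\<^sup>2 * g \<rho> * (LINT \<sigma>|lborel. indicator {-1..1} \<sigma> * cos (r * \<rho> * \<sigma>)))
      = (LINT \<rho>|lborel. LINT \<sigma>|lborel. (\<rho>\<^sup>2 * g \<rho>) * (indicator {-1..1} \<sigma> * cos (r * \<rho> * \<sigma>)))" by simp
  also have "\<dots> = (LINT \<sigma>|lborel. LINT \<rho>|lborel. (\<rho>\<^sup>2 * g \<rho>) * (indicator {-1..1} \<sigma> * cos (r * \<rho> * \<sigma>)))"
    using lborel_pair.Fubini_integral[OF pr] by simp
  also have "\<bar>\<dots>\<bar> \<le> (LINT \<sigma>|lborel. indicator {-1..1::real} \<sigma> * B)"
  proof -
    have "norm (LINT \<sigma>|lborel. LINT \<rho>|lborel. (\<rho>\<^sup>2 * g \<rho>) * (indicator {-1..1} \<sigma> * cos (r * \<rho> * \<sigma>)))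
      \<le> (LINT \<sigma>|lborel. indicator {-1..1::real} \<sigma> * B)"
    proof (rule Bochner_Integration.integral_norm_bound_integral)
      show "integrable lborel (\<lambda>\<sigma>. LINT \<rho>|lborel. (\<rho>\<^sup>2 * g \<rho>) * (indicator {-1..1} \<sigma> * cos (r * \<rho> * \<sigma>)))"
        using lborel_pair.integrable_fst[OF pr] by simp
      fix \<sigma> :: real
      have "(LINT \<rho>|lborel. (\<rho>\<^sup>2 * g \<rho>) * (indicator {-1..1} \<sigma> * cos (r * \<rho> * \<sigma>))) =
         indicator {-1..1} \<sigma> * (LINT \<rho>|lborel. \<rho>\<^sup>2 * g \<rho> * cos (r * \<sigma> * \<rho>))"
        by (subst integral_mult_right_zero[symmetric]) (simp add: mult_ac)
      then show "norm (LINT \<rho>|lborel. (\<rho>\<^sup>2 * g \<rho>) * (indicator {-1..1} \<sigma> * cos (r * \<rho> * \<sigma>))) \<le> indicator {-1..1} \<sigma> * B"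
        using B[of \<sigma>] by (auto simp: indicator_def abs_le_iff)
    qed simp
    then show ?thesis by simp
  qed
  also have "\<dots> = 2 * B" by simp
  finally show ?thesis unfolding radial_fourier[OF assms(1-4)] norm_of_real abs_mult by simp
qed

lemma radial_fourier_bound_far:
  fixes e :: R3 and g :: "real \<Rightarrow> real"
  assumes e: "norm e = 1" and [measurable]: "g \<in> borel_measurable borel"
    and g: "integrable lborel (\<lambda>\<rho>. \<rho>\<^sup>2 * g \<rho>)" and even: "\<And>\<rho>. g (- \<rho>) = g \<rho>" and r: "r > 0"
    and B: "\<bar>LINT \<rho>|lborel. \<rho> * g \<rho> * sin (r * \<rho>)\<bar> \<le> B"
  shows "norm (LINT \<xi>|lborel. cis ((r *\<^sub>R e) \<bullet> \<xi>) * complex_of_real (g (norm \<xi>))) \<le> 2 * pi * B / r"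
proof -
  have "(LINT \<rho>|lborel. \<rho>\<^sup>2 * g \<rho> * (LINT \<sigma>|lborel. indicator {-1..1} \<sigma> * cos (r * \<rho> * \<sigma>)))
      = (LINT \<rho>|lborel. 2 / r * (\<rho> * g \<rho> * sin (r * \<rho>)))"
  proof (intro Bochner_Integration.integral_cong refl)
    fix \<rho> :: real
    show "\<rho>\<^sup>2 * g \<rho> * (LINT \<sigma>|lborel. indicator {-1..1} \<sigma> * cos (r * \<rho> * \<sigma>)) = 2 / r * (\<rho> * g \<rho> * sin (r * \<rho>))"
      using r integral_cos_symmetric[of "r * \<rho>"] by (cases "\<rho> = 0") (simp_all add: field_simps power2_eq_square)
  qed
  also have "\<dots> = 2 / r * (LINT \<rho>|lborel. \<rho> * g \<rho> * sin (r * \<rho>))" by simp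
  finally show ?thesis unfolding radial_fourier[OF assms(1-4)] norm_of_real abs_mult
    using r B by (simp add: field_simps abs_mult)
qed

section \<open>Pointwise bounds for the kernels\<close>

text \<open>Product-to-sum formulas leave the frequencies t + a and t - a, each with a factor 1/2
  that turns 200 pi into 100 pi. The second one produces the light cone.\<close>

lemma bessel_weight_trig_products:
  assumes j: "j \<le> 2"
  defines "B a t \<equiv> 100 * pi * (1 / (1 + (t + a)\<^sup>2) + 1 / (1 + (t - a)\<^sup>2))"
  shows "\<bar>LINT x|lborel. x ^ j * bessel_weight x * (sin (t * x) * cos (a * x))\<bar> \<le> B a t"
    and "\<bar>LINT x|lborel. x ^ j * bessel_weight x * (cos (t * x) * cos (a * x))\<bar> \<le> B a t"
    and "\<bar>LINT x|lborel. x ^ j * bessel_weight x * (sin (t * x) * sin (a * x))\<bar> \<le> B a t"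
    and "\<bar>LINT x|lborel. x ^ j * bessel_weight x * (cos (t * x) * sin (a * x))\<bar> \<le> B a t"
proof -
  note b = bessel_weight_cos_sin[OF j]
  let ?f = "\<lambda>x::real. x ^ j * bessel_weight x"
  let ?s = "\<lambda>c. LINT x|lborel. ?f x * sin (c * x)" and ?c = "\<lambda>c. LINT x|lborel. ?f x * cos (c * x)"
  have B: "\<bar>u / 2\<bar> \<le> B a t" if "u = p + q \<or> u = p - q \<or> u = q - p" "\<bar>p\<bar> \<le> 200 * pi / (1 + (t + a)\<^sup>2)" "\<bar>q\<bar> \<le> 200 * pi / (1 + (t - a)\<^sup>2)" for u p q
  proof -
    have "\<bar>u\<bar> \<le> 200 * pi / (1 + (t + a)\<^sup>2) + 200 * pi / (1 + (t - a)\<^sup>2)" using that by linarith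
    then show ?thesis by (simp add: B_def algebra_simps)
  qed
  have "(LINT x|lborel. ?f x * (sin (t * x) * cos (a * x))) = (LINT x|lborel. (?f x * sin ((t + a) * x) + ?f x * sin ((t - a) * x)) / 2)"
    by (intro Bochner_Integration.integral_cong refl) (simp add: sin_times_cos ring_distribs)
  also have "\<dots> = (?s (t + a) + ?s (t - a)) / 2" by (simp add: b)
  finally show "\<bar>LINT x|lborel. ?f x * (sin (t * x) * cos (a * x))\<bar> \<le> B a t"
    by (simp only:) (rule B[OF disjI1[OF refl] b(4) b(4)])
  have "(LINT x|lborel. ?f x * (cos (t * x) * cos (a * x))) = (LINT x|lborel. (?f x * cos ((t + a) * x) + ?f x * cos ((t - a) * x)) / 2)"
    by (intro Bochner_Integration.integral_cong refl) (simp add: cos_times_cos ring_distribs)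
  also have "\<dots> = (?c (t + a) + ?c (t - a)) / 2" by (simp add: b)
  finally show "\<bar>LINT x|lborel. ?f x * (cos (t * x) * cos (a * x))\<bar> \<le> B a t"
    by (simp only:) (rule B[OF disjI1[OF refl] b(3) b(3)])
  have "(LINT x|lborel. ?f x * (sin (t * x) * sin (a * x))) = (LINT x|lborel. (?f x * cos ((t - a) * x) - ?f x * cos ((t + a) * x)) / 2)"
    by (intro Bochner_Integration.integral_cong refl) (simp add: sin_times_sin ring_distribs)
  also have "\<dots> = (?c (t - a) - ?c (t + a)) / 2" by (simp add: b)
  finally show "\<bar>LINT x|lborel. ?f x * (sin (t * x) * sin (a * x))\<bar> \<le> B a t"
    by (simp only:) (rule B[OF disjI2[OF disjI2[OF refl]] b(3) b(3)])
  have "(LINT x|lborel. ?f x * (cos (t * x) * sin (a * x))) = (LINT x|lborel. (?f x * sin ((t + a) * x) - ?f x * sin ((t - a) * x)) / 2)"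
    by (intro Bochner_Integration.integral_cong refl) (simp add: cos_times_sin ring_distribs)
  also have "\<dots> = (?s (t + a) - ?s (t - a)) / 2" by (simp add: b)
  finally show "\<bar>LINT x|lborel. ?f x * (cos (t * x) * sin (a * x))\<bar> \<le> B a t"
    by (simp only:) (rule B[OF disjI2[OF disjI1[OF refl]] b(4) b(4)])
qed

definition cone_weight :: "real \<Rightarrow> real \<Rightarrow> real" where
  "cone_weight t r = inverse ((1 + r) * (1 + (t - r)\<^sup>2))"

text \<open>For r > 1 the gain 1 / r is comparable to 1 / (1 + r). For r \<le> 1 it would blow up,
  so the bound that integrates over the radius first is used: its frequencies r \<sigma> lie in
  [-1, 1], where replacing them by r costs only a constant.\<close>

lemma radial_kernel_bound:
  fixes g :: "real \<Rightarrow> real" and z :: R3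
  assumes gm: "g \<in> borel_measurable borel" and g: "integrable lborel (\<lambda>\<rho>. \<rho>\<^sup>2 * g \<rho>)"
    and even: "\<And>\<rho>. g (- \<rho>) = g \<rho>" and t: "t \<ge> 0"
    and near: "\<And>a. \<bar>LINT \<rho>|lborel. \<rho>\<^sup>2 * g \<rho> * cos (a * \<rho>)\<bar> \<le> B * (1 / (1 + (t + a)\<^sup>2) + 1 / (1 + (t - a)\<^sup>2))"
    and far: "\<And>a. \<bar>LINT \<rho>|lborel. \<rho> * g \<rho> * sin (a * \<rho>)\<bar> \<le> B * (1 / (1 + (t + a)\<^sup>2) + 1 / (1 + (t - a)\<^sup>2))"
  shows "norm (LINT \<xi>|lborel. cis (z \<bullet> \<xi>) * complex_of_real (g (norm \<xi>))) \<le> 72 * pi * B * cone_weight t (norm z)"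
proof -
  \<comment> \<open>At z = 0 any unit vector serves as direction, because r = 0.\<close>
  define e :: R3 where "e = (if z = 0 then axis 1 1 else z /\<^sub>R norm z)"
  define r where "r = norm z"
  have e: "norm e = 1" by (simp add: e_def)
  have z: "z = r *\<^sub>R e" by (simp add: e_def r_def)
  have r: "r \<ge> 0" by (simp add: r_def)
  have "0 \<le> B * (1 / (1 + (t + 0)\<^sup>2) + 1 / (1 + (t - 0)\<^sup>2))" using near[of 0] by linarith
  moreover have "1 / (1 + (t + 0)\<^sup>2) + 1 / (1 + (t - 0)\<^sup>2) > 0" by (simp add: add_pos_nonneg)
  ultimately have B: "B \<ge> 0" unfolding zero_le_mult_iff by linarith
  have pos: "1 + (t - r)\<^sup>2 > 0" "1 + r > 0" using r by (auto intro: add_pos_nonneg)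
  show ?thesis
  proof (cases "r \<le> 1")
    case True
    \<comment> \<open>t + a and t - r differ by at most 2 in absolute value, so (t - r)^2 \<le> 2 (t
      + a)^2 + 8; hence the factor 9.\<close>
    have q: "1 / (1 + (t + a)\<^sup>2) \<le> 9 / (1 + (t - r)\<^sup>2)" if "\<bar>a\<bar> \<le> 1" for a
    proof -
      define u where "u = t + a"
      define v where "v = - a - r"
      have v: "\<bar>v\<bar> \<le> 2" using that True r by (auto simp: v_def)
      then have v2: "v\<^sup>2 \<le> 4" using abs_le_square_iff[of v 2] by simp
      have "(t - r)\<^sup>2 = (u + v)\<^sup>2" by (simp add: u_def v_def algebra_simps)
      also have "\<dots> \<le> 2 * u\<^sup>2 + 2 * v\<^sup>2" using zero_le_power2[of "u - v"] by (simp add: power2_eq_square algebra_simps)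
      finally have le: "(t - r)\<^sup>2 \<le> 2 * u\<^sup>2 + 2 * v\<^sup>2" .
      have "1 + p \<le> 9 * (1 + q)" if "p \<le> 2 * q + 2 * s" "s \<le> 4" "0 \<le> q" for p q s :: real
        using that by simp
      from this[OF le v2] have "1 + (t - r)\<^sup>2 \<le> 9 * (1 + u\<^sup>2)" by simp
      then show ?thesis unfolding u_def[symmetric]
        using pos add_pos_nonneg[of 1 "u\<^sup>2"] by (simp add: pos_divide_le_eq pos_le_divide_eq)
    qed
    have "norm (LINT \<xi>|lborel. cis ((r *\<^sub>R e) \<bullet> \<xi>) * complex_of_real (g (norm \<xi>))) \<le> 2 * pi * (18 * B / (1 + (t - r)\<^sup>2))"
    proof (rule radial_fourier_bound_near[OF e gm g even])
      fix \<sigma> :: real assume "\<bar>\<sigma>\<bar> \<le> 1"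
      then have "\<bar>r * \<sigma>\<bar> \<le> 1" using True r by (simp add: abs_mult mult_le_one)
      then have "B * (1 / (1 + (t + r * \<sigma>)\<^sup>2) + 1 / (1 + (t - r * \<sigma>)\<^sup>2)) \<le> B * (9 / (1 + (t - r)\<^sup>2) + 9 / (1 + (t - r)\<^sup>2))"
        using q[of "r * \<sigma>"] q[of "- (r * \<sigma>)"] B by (intro mult_left_mono add_mono) auto
      from order_trans[OF near this]
      show "\<bar>LINT \<rho>|lborel. \<rho>\<^sup>2 * g \<rho> * cos (r * \<sigma> * \<rho>)\<bar> \<le> 18 * B / (1 + (t - r)\<^sup>2)"
        by (simp add: mult.commute)
    qed
    also have "\<dots> = 2 * pi * (18 * B / (1 + (t - r)\<^sup>2)) * 1" by simp
    also have "\<dots> \<le> 2 * pi * (18 * B / (1 + (t - r)\<^sup>2)) * (2 / (1 + r))"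
      using True pos B by (intro mult_left_mono mult_nonneg_nonneg divide_nonneg_pos) (auto simp: pos_le_divide_eq)
    also have "\<dots> = 72 * pi * B * cone_weight t r"
      by (simp add: cone_weight_def divide_inverse mult_ac)
    finally show ?thesis unfolding z[symmetric] r_def[symmetric] .
  next
    case False
    then have r1: "r > 0" by simp
    have "norm (LINT \<xi>|lborel. cis ((r *\<^sub>R e) \<bullet> \<xi>) * complex_of_real (g (norm \<xi>))) \<le> 2 * pi * (2 * B / (1 + (t - r)\<^sup>2)) / r"
    proof (rule radial_fourier_bound_far[OF e gm g even r1])
      have "(t - r)\<^sup>2 \<le> (t + r)\<^sup>2" using t r by (simp add: abs_le_square_iff[symmetric])
      then have "1 / (1 + (t + r)\<^sup>2) \<le> 1 / (1 + (t - r)\<^sup>2)" using pos by (intro divide_left_mono) (auto intro: add_pos_nonneg)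
      then have "B * (1 / (1 + (t + r)\<^sup>2) + 1 / (1 + (t - r)\<^sup>2)) \<le> B * (1 / (1 + (t - r)\<^sup>2) + 1 / (1 + (t - r)\<^sup>2))"
        using B by (intro mult_left_mono add_mono) auto
      from order_trans[OF far this]
      show "\<bar>LINT \<rho>|lborel. \<rho> * g \<rho> * sin (r * \<rho>)\<bar> \<le> 2 * B / (1 + (t - r)\<^sup>2)"
        by (simp add: mult.commute)
    qed
    also have "\<dots> = 2 * pi * (2 * B / (1 + (t - r)\<^sup>2)) * (1 / r)" by simp
    \<comment> \<open>For r > 1 the factor 2 would already do; 18 matches the constant 72 pi B of
      the case r \<le> 1.\<close>
    also have "\<dots> \<le> 2 * pi * (2 * B / (1 + (t - r)\<^sup>2)) * (18 * (1 / (1 + r)))"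
      using False pos B by (intro mult_left_mono mult_nonneg_nonneg divide_nonneg_pos) (auto simp: field_simps)
    also have "\<dots> = 72 * pi * B * cone_weight t r"
      by (simp add: cone_weight_def divide_inverse mult_ac)
    finally show ?thesis unfolding z[symmetric] r_def[symmetric] .
  qed
qed

text \<open>The 1 / \<rho> of the symbol removes one power, leaving j = 1 and j = 0. The constant is
  72 pi times the 100 pi of \<open>bessel_weight_trig_products\<close>.\<close>

lemma radial_symbol_sin:
  fixes z :: R3
  assumes t: "t > 0"
  shows "integrable lborel (\<lambda>\<rho>. \<rho>\<^sup>2 * (sin (t * \<rho>) / \<rho> * bessel_weight \<rho>))"
    and "norm (LINT \<xi>|lborel. cis (z \<bullet> \<xi>) * complex_of_real (sin (t * norm \<xi>) / norm \<xi> * bessel_weight (norm \<xi>)))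
      \<le> 7200 * pi\<^sup>2 * cone_weight t (norm z)"
proof -
  have eq: "\<rho>\<^sup>2 * (sin (t * \<rho>) / \<rho> * bessel_weight \<rho>) = \<rho> ^ 1 * bessel_weight \<rho> * sin (t * \<rho>)"
    "\<rho> * (sin (t * \<rho>) / \<rho> * bessel_weight \<rho>) = \<rho> ^ 0 * bessel_weight \<rho> * sin (t * \<rho>)" for \<rho> :: real
    by (cases "\<rho> = 0"; simp add: power2_eq_square)+
  show i: "integrable lborel (\<lambda>\<rho>. \<rho>\<^sup>2 * (sin (t * \<rho>) / \<rho> * bessel_weight \<rho>))"
    unfolding eq by (rule bessel_weight_cos_sin) simp
  have "norm (LINT \<xi>|lborel. cis (z \<bullet> \<xi>) * complex_of_real (sin (t * norm \<xi>) / norm \<xi> * bessel_weight (norm \<xi>)))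
      \<le> 72 * pi * (100 * pi) * cone_weight t (norm z)"
  proof (rule radial_kernel_bound[where g="\<lambda>\<rho>. sin (t * \<rho>) / \<rho> * bessel_weight \<rho>", OF _ i])
    show "(\<lambda>\<rho>::real. sin (t * \<rho>) / \<rho> * bessel_weight \<rho>) \<in> borel_measurable borel" by measurable
  next
    show "0 \<le> t" using t by simp
  next
    fix a show "\<bar>LINT \<rho>|lborel. \<rho>\<^sup>2 * (sin (t * \<rho>) / \<rho> * bessel_weight \<rho>) * cos (a * \<rho>)\<bar> \<le> 100 * pi * (1 / (1 + (t + a)\<^sup>2) + 1 / (1 + (t - a)\<^sup>2))"
      unfolding eq mult.assoc[of _ "_ (t * _)"] by (rule bessel_weight_trig_products(1)) simp
    show "\<bar>LINT \<rho>|lborel. \<rho> * (sin (t * \<rho>) / \<rho> * bessel_weight \<rho>) * sin (a * \<rho>)\<bar> \<le> 100 * pi * (1 / (1 + (t + a)\<^sup>2) + 1 / (1 + (t - a)\<^sup>2))"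
      unfolding eq mult.assoc[of _ "_ (t * _)"] by (rule bessel_weight_trig_products(3)) simp
  qed simp
  then show "norm (LINT \<xi>|lborel. cis (z \<bullet> \<xi>) * complex_of_real (sin (t * norm \<xi>) / norm \<xi> * bessel_weight (norm \<xi>)))
      \<le> 7200 * pi\<^sup>2 * cone_weight t (norm z)" by (simp add: power2_eq_square)
qed

text \<open>Here j = 2 and j = 1. The case j = 2 is the critical one: the integrand is only
  O(\<rho>^-2), and with a single power of (1 - \<Delta>)^-1 it would not be integrable.\<close>

lemma radial_symbol_cos:
  fixes z :: R3
  assumes t: "t > 0"
  shows "integrable lborel (\<lambda>\<rho>. \<rho>\<^sup>2 * (cos (t * \<rho>) * bessel_weight \<rho>))"
    and "norm (LINT \<xi>|lborel. cis (z \<bullet> \<xi>) * complex_of_real (cos (t * norm \<xi>) * bessel_weight (norm \<xi>)))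
      \<le> 7200 * pi\<^sup>2 * cone_weight t (norm z)"
proof -
  have eq: "\<rho>\<^sup>2 * (cos (t * \<rho>) * bessel_weight \<rho>) = \<rho> ^ 2 * bessel_weight \<rho> * cos (t * \<rho>)"
    "\<rho> * (cos (t * \<rho>) * bessel_weight \<rho>) = \<rho> ^ 1 * bessel_weight \<rho> * cos (t * \<rho>)" for \<rho> :: real
    by simp_all
  show i: "integrable lborel (\<lambda>\<rho>. \<rho>\<^sup>2 * (cos (t * \<rho>) * bessel_weight \<rho>))"
    unfolding eq by (rule bessel_weight_cos_sin) simp
  have "norm (LINT \<xi>|lborel. cis (z \<bullet> \<xi>) * complex_of_real (cos (t * norm \<xi>) * bessel_weight (norm \<xi>)))
      \<le> 72 * pi * (100 * pi) * cone_weight t (norm z)"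
  proof (rule radial_kernel_bound[where g="\<lambda>\<rho>. cos (t * \<rho>) * bessel_weight \<rho>", OF _ i])
    show "(\<lambda>\<rho>::real. cos (t * \<rho>) * bessel_weight \<rho>) \<in> borel_measurable borel" by measurable
  next
    show "0 \<le> t" using t by simp
  next
    fix a show "\<bar>LINT \<rho>|lborel. \<rho>\<^sup>2 * (cos (t * \<rho>) * bessel_weight \<rho>) * cos (a * \<rho>)\<bar> \<le> 100 * pi * (1 / (1 + (t + a)\<^sup>2) + 1 / (1 + (t - a)\<^sup>2))"
      unfolding eq mult.assoc[of _ "_ (t * _)"] by (rule bessel_weight_trig_products(2)) simp
    show "\<bar>LINT \<rho>|lborel. \<rho> * (cos (t * \<rho>) * bessel_weight \<rho>) * sin (a * \<rho>)\<bar> \<le> 100 * pi * (1 / (1 + (t + a)\<^sup>2) + 1 / (1 + (t - a)\<^sup>2))"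
      unfolding eq mult.assoc[of _ "_ (t * _)"] by (rule bessel_weight_trig_products(4)) simp
  qed simp
  then show "norm (LINT \<xi>|lborel. cis (z \<bullet> \<xi>) * complex_of_real (cos (t * norm \<xi>) * bessel_weight (norm \<xi>)))
      \<le> 7200 * pi\<^sup>2 * cone_weight t (norm z)" by (simp add: power2_eq_square)
qed

section \<open>Square integrals of the kernels over balls\<close>

text \<open>For a centre at distance \<open>d\<close> from the origin, the set below consists of the cosines of the polar angles at which
  the sphere of radius \<open>\<rho>\<close> lies in the ball of radius \<open>R\<close>. Its length is at most \<open>R\<^sup>2 / (2 d \<rho>)\<close>.\<close>

lemma cap_measure_le:
  fixes R d \<rho> :: real
  assumes R: "R > 0" and d: "d \<ge> 0" and \<rho>: "\<rho> > 0"
  shows "ennreal (2 * pi * \<rho>\<^sup>2) * emeasure lborel {\<sigma>\<in>{-1..1}. \<rho>\<^sup>2 - 2 * d * \<sigma> * \<rho> + d\<^sup>2 \<le> R\<^sup>2} \<le> ennreal (16 * pi * R\<^sup>2)"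
    (is "_ * emeasure lborel ?S \<le> _")
proof (cases "\<bar>\<rho> - d\<bar> \<le> R")
  case False
  then have "R\<^sup>2 < (\<rho> - d)\<^sup>2" using R by (metis abs_le_square_iff abs_of_pos not_le)
  have "?S = {}"
  proof (intro equals0I, clarsimp)
    fix \<sigma> :: real assume "-1 \<le> \<sigma>" "\<sigma> \<le> 1" and le: "\<rho>\<^sup>2 - 2 * d * \<sigma> * \<rho> + d\<^sup>2 \<le> R\<^sup>2"
    have "2 * d * \<rho> * \<sigma> \<le> 2 * d * \<rho> * 1" using d \<rho> \<open>\<sigma> \<le> 1\<close> by (intro mult_left_mono) auto
    then have "(\<rho> - d)\<^sup>2 \<le> \<rho>\<^sup>2 - 2 * d * \<sigma> * \<rho> + d\<^sup>2" by (simp add: power2_eq_square algebra_simps)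
    then show False using le \<open>R\<^sup>2 < (\<rho> - d)\<^sup>2\<close> by linarith
  qed
  then show ?thesis by (simp only: emeasure_empty mult_zero_right zero_le)
next
  case True
  show ?thesis
  proof (cases "d < R")
    \<comment> \<open>The ball contains the origin, so \<rho> \<le> d + R < 2 R and even the full
      sphere has area 4 pi \<rho>^2 below 16 pi R^2, the constant of the lemma.\<close>
    case True
    then have "\<rho>\<^sup>2 \<le> (2 * R)\<^sup>2" using \<open>\<bar>\<rho> - d\<bar> \<le> R\<close> \<rho> by (intro power_mono) auto
    then have le: "2 * pi * \<rho>\<^sup>2 * 2 \<le> 16 * pi * R\<^sup>2" by (simp add: power_mult_distrib)
    have "emeasure lborel ?S \<le> emeasure lborel {-1..1::real}" by (rule emeasure_mono) auto
    then have "ennreal (2 * pi * \<rho>\<^sup>2) * emeasure lborel ?S \<le> ennreal (2 * pi * \<rho>\<^sup>2) * ennreal 2"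
      by (intro mult_left_mono) auto
    also have "\<dots> = ennreal (2 * pi * \<rho>\<^sup>2 * 2)" by (rule ennreal_mult[symmetric]) auto
    also have "\<dots> \<le> ennreal (16 * pi * R\<^sup>2)" using le by (rule ennreal_leI)
    finally show ?thesis .
  next
    case False
    then have d0: "d > 0" and dR: "R \<le> d" using R by auto
    define s where "s = (\<rho>\<^sup>2 + d\<^sup>2 - R\<^sup>2) / (2 * d * \<rho>)"
    have sub: "?S \<subseteq> {s..1}"
    proof (intro subsetI)
      fix \<sigma> assume "\<sigma> \<in> ?S"
      then have "\<sigma> \<le> 1" "\<rho>\<^sup>2 + d\<^sup>2 - R\<^sup>2 \<le> \<sigma> * (2 * d * \<rho>)" by (auto simp: mult_ac)
      then show "\<sigma> \<in> {s..1}" unfolding s_def using d0 \<rho> by (simp add: pos_divide_le_eq)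
    qed
    have s: "1 - s = (R\<^sup>2 - (\<rho> - d)\<^sup>2) / (2 * d * \<rho>)"
      unfolding s_def using d0 \<rho> by (simp add: field_simps power2_eq_square)
    have s0: "0 \<le> 1 - s" unfolding s using d0 \<rho> R \<open>\<bar>\<rho> - d\<bar> \<le> R\<close>
      by (intro divide_nonneg_pos) (auto simp: abs_le_square_iff[symmetric])
    have "2 * pi * \<rho>\<^sup>2 * (1 - s) \<le> 2 * pi * \<rho>\<^sup>2 * (R\<^sup>2 / (2 * d * \<rho>))"
      unfolding s using d0 \<rho> by (intro mult_left_mono divide_right_mono) auto
    also have "\<dots> = pi * R\<^sup>2 * (\<rho> / d)" using d0 \<rho> by (simp add: field_simps power2_eq_square)
    \<comment> \<open>Because \<rho> \<le> d + R \<le> 2 d.\<close>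
    also have "\<dots> \<le> pi * R\<^sup>2 * 2" using d0 \<open>\<bar>\<rho> - d\<bar> \<le> R\<close> dR
      by (intro mult_left_mono) (auto simp: pos_divide_le_eq)
    also have "\<dots> \<le> 16 * pi * R\<^sup>2" by simp
    finally have le: "2 * pi * \<rho>\<^sup>2 * (1 - s) \<le> 16 * pi * R\<^sup>2" .
    have "emeasure lborel ?S \<le> emeasure lborel {s..1}" by (rule emeasure_mono[OF sub]) simp
    also have "\<dots> = ennreal (1 - s)" using s0 by simp
    finally have "ennreal (2 * pi * \<rho>\<^sup>2) * emeasure lborel ?S \<le> ennreal (2 * pi * \<rho>\<^sup>2) * ennreal (1 - s)"
      by (intro mult_left_mono) auto
    also have "\<dots> = ennreal (2 * pi * \<rho>\<^sup>2 * (1 - s))" using s0 by (intro ennreal_mult[symmetric]) auto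
    also have "\<dots> \<le> ennreal (16 * pi * R\<^sup>2)" using le by (rule ennreal_leI)
    finally show ?thesis .
  qed
qed

text \<open>In polar coordinates about the axis through x, the ball condition at fixed radius is a
  cap condition on \<sigma>. The cap bound does not depend on the radius, so it leaves the radial
  integral; the Jacobian is absorbed in it.\<close>

lemma nn_integral_radial_cball_le:
  fixes x :: R3 and k :: "real \<Rightarrow> ennreal"
  assumes R: "R > 0" and [measurable]: "k \<in> borel_measurable borel"
  shows "(\<integral>\<^sup>+z. indicator (cball x R) z * k (norm z) \<partial>lborel) \<le> ennreal (16 * pi * R\<^sup>2) * (\<integral>\<^sup>+\<rho>. k \<rho> \<partial>lborel)"
proof -
  define e :: R3 where "e = (if x = 0 then axis 1 1 else x /\<^sub>R norm x)"
  define d where "d = norm x"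
  have e: "norm e = 1" by (simp add: e_def)
  have x: "x = d *\<^sub>R e" by (simp add: e_def d_def)
  have d: "d \<ge> 0" by (simp add: d_def)
  define P where "P = (\<lambda>\<sigma> \<rho>. \<rho>\<^sup>2 - 2 * d * \<sigma> * \<rho> + d\<^sup>2 \<le> R\<^sup>2)"
  have [measurable]: "Measurable.pred (borel \<Otimes>\<^sub>M borel) (\<lambda>p. P (fst p) (snd p))" unfolding P_def by measurable
  have ball: "z \<in> cball x R \<longleftrightarrow> P (e \<bullet> z / norm z) (norm z)" for z
  proof -
    have "z \<in> cball x R \<longleftrightarrow> (norm (x - z))\<^sup>2 \<le> R\<^sup>2"
      using R by (simp add: dist_norm abs_le_square_iff[symmetric])
    also have "(norm (x - z))\<^sup>2 = (norm z)\<^sup>2 - 2 * d * (e \<bullet> z / norm z) * norm z + d\<^sup>2"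
    proof -
      have "(norm (x - z))\<^sup>2 = d\<^sup>2 * (e \<bullet> e) - 2 * d * (e \<bullet> z) + (norm z)\<^sup>2"
        unfolding x power2_norm_eq_inner by (simp add: inner_diff inner_commute power2_eq_square algebra_simps)
      then show ?thesis using e by (cases "z = 0") (simp_all add: norm_eq_1)
    qed
    finally show ?thesis by (simp add: P_def)
  qed
  have "(\<integral>\<^sup>+z. indicator (cball x R) z * k (norm z) \<partial>lborel) =
     (\<integral>\<^sup>+z. (\<lambda>p. (if P (fst p) (snd p) then 1 else 0) * k (snd p)) (e \<bullet> z / norm z, norm z) \<partial>lborel)"
    by (intro nn_integral_cong) (simp add: indicator_def ball[unfolded mem_cball])
  also have "\<dots> = (\<integral>\<^sup>+\<rho>. ennreal (2 * pi * \<rho>\<^sup>2) * indicator {0<..} \<rho> *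
       (\<integral>\<^sup>+\<sigma>. indicator {-1..1} \<sigma> * ((if P \<sigma> \<rho> then 1 else 0) * k \<rho>) \<partial>lborel) \<partial>lborel)"
    by (subst nn_integral_polar[OF e]) auto
  also have "\<dots> \<le> (\<integral>\<^sup>+\<rho>. ennreal (16 * pi * R\<^sup>2) * k \<rho> \<partial>lborel)"
  proof (intro nn_integral_mono)
    fix \<rho> :: real
    have S: "{\<sigma>\<in>{-1..1}. P \<sigma> \<rho>} \<in> sets lborel" unfolding P_def by measurable
    have "(\<integral>\<^sup>+\<sigma>. indicator {-1..1} \<sigma> * ((if P \<sigma> \<rho> then 1 else 0) * k \<rho>) \<partial>lborel)
      = (\<integral>\<^sup>+\<sigma>. k \<rho> * indicator {\<sigma>\<in>{-1..1}. P \<sigma> \<rho>} \<sigma> \<partial>lborel)"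
      by (intro nn_integral_cong) (simp add: indicator_def)
    also have "\<dots> = k \<rho> * emeasure lborel {\<sigma>\<in>{-1..1}. P \<sigma> \<rho>}"
      by (rule nn_integral_cmult_indicator[OF S])
    finally have eq: "(\<integral>\<^sup>+\<sigma>. indicator {-1..1} \<sigma> * ((if P \<sigma> \<rho> then 1 else 0) * k \<rho>) \<partial>lborel)
      = k \<rho> * emeasure lborel {\<sigma>\<in>{-1..1}. P \<sigma> \<rho>}" .
    show "ennreal (2 * pi * \<rho>\<^sup>2) * indicator {0<..} \<rho> * (\<integral>\<^sup>+\<sigma>. indicator {-1..1} \<sigma> * ((if P \<sigma> \<rho> then 1 else 0) * k \<rho>) \<partial>lborel)
      \<le> ennreal (16 * pi * R\<^sup>2) * k \<rho>"
    proof (cases "\<rho> > 0")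
      case True
      have "(ennreal (2 * pi * \<rho>\<^sup>2) * emeasure lborel {\<sigma>\<in>{-1..1}. P \<sigma> \<rho>}) * k \<rho> \<le> ennreal (16 * pi * R\<^sup>2) * k \<rho>"
        unfolding P_def by (intro mult_right_mono cap_measure_le R d True) auto
      then show ?thesis unfolding eq using True by (simp add: mult_ac)
    qed simp
  qed
  also have "\<dots> = ennreal (16 * pi * R\<^sup>2) * (\<integral>\<^sup>+\<rho>. k \<rho> \<partial>lborel)"
    by (rule nn_integral_cmult) simp
  finally show ?thesis .
qed

section \<open>The square integral of the cone weight over a ball\<close>

lemma nn_integral_lborel_reflect:
  fixes x :: "'a::euclidean_space" and f :: "'a \<Rightarrow> ennreal"
  assumes [measurable]: "f \<in> borel_measurable borel"
  shows "(\<integral>\<^sup>+y. f (x - y) \<partial>lborel) = (\<integral>\<^sup>+y. f y \<partial>lborel)"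
proof -
  have "(\<integral>\<^sup>+y. f y \<partial>lborel) = (\<integral>\<^sup>+y. f y \<partial>density (distr lborel borel (\<lambda>y. x + (-1) *\<^sub>R y)) (\<lambda>_. 1))"
    by (subst lborel_affine[of "-1" x]) simp_all
  also have "\<dots> = (\<integral>\<^sup>+y. f (x - y) \<partial>lborel)"
    by (subst nn_integral_density, simp, simp, subst nn_integral_distr) simp_all
  finally show ?thesis by simp
qed

lemma nn_integral_cauchy_kernel: "(\<integral>\<^sup>+\<rho>. ennreal (inverse (1 + (t - \<rho>)\<^sup>2)) \<partial>lborel) = ennreal pi"
proof -
  have "(\<integral>\<^sup>+\<rho>. ennreal (inverse (1 + (t - \<rho>)\<^sup>2)) \<partial>lborel) = (\<integral>\<^sup>+\<rho>. ennreal (inverse (1 + \<rho>\<^sup>2)) \<partial>lborel)"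
    by (rule nn_integral_lborel_reflect[of "\<lambda>\<rho>. ennreal (inverse (1 + \<rho>\<^sup>2))"]) simp
  also have "\<dots> = ennreal (LINT \<rho>|lborel. inverse (1 + \<rho>\<^sup>2))"
    by (rule nn_integral_eq_integral[OF integrable_inverse_1_plus_sq]) simp
  finally show ?thesis by (simp add: integral_inverse_1_plus_sq)
qed

text \<open>The first bound absorbs the polar Jacobian and serves integration over all of space. The
  second is a Peetre-type inequality, 1 + t \<le> (1 + r) (1 + |t - r|): one of the two Cauchy
  factors is spent on turning decay in r into decay in t, the other stays for integrability in
  r.\<close>

lemma cone_weight_square_le:
  fixes t r :: real
  assumes r: "r \<ge> 0" and t: "t \<ge> 0"
  shows "r\<^sup>2 * (cone_weight t r)\<^sup>2 \<le> inverse (1 + (t - r)\<^sup>2)"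
    and "(cone_weight t r)\<^sup>2 \<le> 2 * (inverse (1 + t))\<^sup>2 * inverse (1 + (t - r)\<^sup>2)"
proof -
  define u where "u = 1 + (t - r)\<^sup>2"
  have u: "u \<ge> 1" by (simp add: u_def)
  have iu: "inverse u \<le> 1" using u by (simp add: inverse_le_1_iff)
  have cw: "(cone_weight t r)\<^sup>2 = (inverse (1 + r))\<^sup>2 * (inverse u)\<^sup>2"
    by (simp add: cone_weight_def u_def power_mult_distrib)
  have iu2: "(inverse u)\<^sup>2 \<le> inverse u" using iu u by (simp add: power2_eq_square mult_left_le)
  have "(r * inverse (1 + r))\<^sup>2 \<le> 1\<^sup>2" using r by (intro power_mono) (auto simp: field_simps)
  then have "(r * inverse (1 + r))\<^sup>2 * (inverse u)\<^sup>2 \<le> 1 * inverse u"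
    using iu2 u by (intro mult_mono) auto
  then show "r\<^sup>2 * (cone_weight t r)\<^sup>2 \<le> inverse (1 + (t - r)\<^sup>2)"
    unfolding cw u_def[symmetric] by (simp add: power_mult_distrib mult_ac)
  have "(1 + t)\<^sup>2 \<le> ((1 + r) * (1 + \<bar>t - r\<bar>))\<^sup>2"
  proof (rule power_mono)
    have "0 \<le> r * \<bar>t - r\<bar>" using r by simp
    then show "1 + t \<le> (1 + r) * (1 + \<bar>t - r\<bar>)" by (simp add: algebra_simps)
  qed (use t in simp)
  also have "\<dots> \<le> (1 + r)\<^sup>2 * (2 * u)"
  proof -
    have "(1 + \<bar>t - r\<bar>)\<^sup>2 \<le> 2 * u"
      using zero_le_power2[of "1 - \<bar>t - r\<bar>"] unfolding u_def by (simp add: power2_eq_square algebra_simps)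
    then show ?thesis unfolding power_mult_distrib by (rule mult_left_mono) simp
  qed
  finally have le: "(1 + t)\<^sup>2 \<le> (1 + r)\<^sup>2 * (2 * u)" .
  have pos: "(1 + t)\<^sup>2 > 0" "(1 + r)\<^sup>2 > 0" "u > 0" using r t u by auto
  have "inverse ((1 + r)\<^sup>2) * inverse u \<le> 2 * inverse ((1 + t)\<^sup>2)"
    using le pos by (simp add: field_simps)
  then have "inverse ((1 + r)\<^sup>2) * inverse u * inverse u \<le> 2 * inverse ((1 + t)\<^sup>2) * inverse u"
    using pos by (intro mult_right_mono) auto
  then show "(cone_weight t r)\<^sup>2 \<le> 2 * (inverse (1 + t))\<^sup>2 * inverse (1 + (t - r)\<^sup>2)"
    unfolding cw u_def[symmetric] by (simp add: power_inverse power2_eq_square mult_ac)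
qed

lemma cone_weight_measurable [measurable]: "cone_weight t \<in> borel_measurable borel"
  unfolding cone_weight_def[abs_def] by measurable

text \<open>The entry 1 of the minimum comes from enlarging the ball to all of space, the other
  entry from the cap estimate. The latter gives 16 pi * 2 * pi = 32 pi^2, and the former, only 4
  pi^2, is rounded up to it.\<close>

lemma nn_integral_cone_weight:
  fixes x :: R3
  assumes R: "R > 0" and t: "t \<ge> 0"
  shows "(\<integral>\<^sup>+y. ennreal ((cone_weight t (norm (x - y)))\<^sup>2) * indicator (cball 0 R) y \<partial>lborel)
    \<le> ennreal (32 * pi\<^sup>2 * (min 1 (inverse (1 + t) * R))\<^sup>2)"
proof -
  have [measurable]: "cball x R \<in> sets borel" by simp
  let ?I = "\<integral>\<^sup>+y. ennreal ((cone_weight t (norm (x - y)))\<^sup>2) * indicator (cball 0 R) y \<partial>lborel"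
  have "?I \<le> (\<integral>\<^sup>+y. ennreal ((cone_weight t (norm (x - y)))\<^sup>2) \<partial>lborel)"
    by (intro nn_integral_mono) (auto simp: indicator_def)
  also have "\<dots> = (\<integral>\<^sup>+z. ennreal ((cone_weight t (norm (z::R3)))\<^sup>2) \<partial>lborel)"
    by (rule nn_integral_lborel_reflect[of "\<lambda>z. ennreal ((cone_weight t (norm z))\<^sup>2)"]) measurable
  also have "\<dots> = (\<integral>\<^sup>+\<rho>. ennreal (4 * pi * \<rho>\<^sup>2) * indicator {0<..} \<rho> * ennreal ((cone_weight t \<rho>)\<^sup>2) \<partial>lborel)"
    by (rule nn_integral_radial[of "\<lambda>\<rho>. ennreal ((cone_weight t \<rho>)\<^sup>2)"]) measurable
  also have "\<dots> \<le> (\<integral>\<^sup>+\<rho>. ennreal (4 * pi) * ennreal (inverse (1 + (t - \<rho>)\<^sup>2)) \<partial>lborel)"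
  proof (intro nn_integral_mono)
    fix \<rho> :: real
    show "ennreal (4 * pi * \<rho>\<^sup>2) * indicator {0<..} \<rho> * ennreal ((cone_weight t \<rho>)\<^sup>2) \<le> ennreal (4 * pi) * ennreal (inverse (1 + (t - \<rho>)\<^sup>2))"
    proof (cases "\<rho> > 0")
      case True
      then have "4 * pi * (\<rho>\<^sup>2 * (cone_weight t \<rho>)\<^sup>2) \<le> 4 * pi * inverse (1 + (t - \<rho>)\<^sup>2)"
        using t by (intro mult_left_mono cone_weight_square_le) auto
      then show ?thesis using True by (simp add: ennreal_mult[symmetric] mult.assoc ennreal_leI)
    qed simp
  qed
  also have "\<dots> = ennreal (4 * pi) * ennreal pi"
    by (subst nn_integral_cmult) (simp_all add: nn_integral_cauchy_kernel)
  also have "\<dots> = ennreal (4 * pi\<^sup>2)" by (simp add: ennreal_mult[symmetric] power2_eq_square)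
  also have "\<dots> \<le> ennreal (32 * pi\<^sup>2)" by (intro ennreal_leI) simp
  finally have 1: "?I \<le> ennreal (32 * pi\<^sup>2)" .
  \<comment> \<open>Reflecting y to x - y centres the kernel at the origin and moves the ball to x,
    the configuration of the cap estimate.\<close>
  have "?I = (\<integral>\<^sup>+y. ennreal ((cone_weight t (norm (x - y)))\<^sup>2) * indicator (cball x R) (x - y) \<partial>lborel)"
    by (intro nn_integral_cong) (simp add: indicator_def dist_norm)
  also have "\<dots> = (\<integral>\<^sup>+z. ennreal ((cone_weight t (norm z))\<^sup>2) * indicator (cball x R) z \<partial>lborel)"
    by (rule nn_integral_lborel_reflect[of "\<lambda>z. ennreal ((cone_weight t (norm z))\<^sup>2) * indicator (cball x R) z"]) measurable
  also have "\<dots> \<le> (\<integral>\<^sup>+z. indicator (cball x R) z * ennreal (2 * (inverse (1 + t))\<^sup>2 * inverse (1 + (t - norm z)\<^sup>2)) \<partial>lborel)"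
    using t by (intro nn_integral_mono) (auto simp: indicator_def intro!: ennreal_leI cone_weight_square_le)
  also have "\<dots> \<le> ennreal (16 * pi * R\<^sup>2) * (\<integral>\<^sup>+\<rho>. ennreal (2 * (inverse (1 + t))\<^sup>2 * inverse (1 + (t - \<rho>)\<^sup>2)) \<partial>lborel)"
    by (rule nn_integral_radial_cball_le[OF R, of "\<lambda>\<rho>. ennreal (2 * (inverse (1 + t))\<^sup>2 * inverse (1 + (t - \<rho>)\<^sup>2))"]) measurable
  also have "(\<integral>\<^sup>+\<rho>. ennreal (2 * (inverse (1 + t))\<^sup>2 * inverse (1 + (t - \<rho>)\<^sup>2)) \<partial>lborel)
     = (\<integral>\<^sup>+\<rho>. ennreal (2 * (inverse (1 + t))\<^sup>2) * ennreal (inverse (1 + (t - \<rho>)\<^sup>2)) \<partial>lborel)"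
    by (intro nn_integral_cong ennreal_mult) auto
  also have "\<dots> = ennreal (2 * (inverse (1 + t))\<^sup>2) * ennreal pi"
    by (subst nn_integral_cmult) (simp_all add: nn_integral_cauchy_kernel)
  also have "ennreal (16 * pi * R\<^sup>2) * (ennreal (2 * (inverse (1 + t))\<^sup>2) * ennreal pi) = ennreal (32 * pi\<^sup>2 * (inverse (1 + t) * R)\<^sup>2)"
    by (subst ennreal_mult[symmetric], simp, simp)+ (simp add: power2_eq_square mult_ac)
  finally have 2: "?I \<le> ennreal (32 * pi\<^sup>2 * (inverse (1 + t) * R)\<^sup>2)" .
  show ?thesis using 1 2 by (simp add: min_def)
qed

lemma ennreal_le_of_square_le:
  assumes "A\<^sup>2 \<le> ennreal (c\<^sup>2)" and c: "c \<ge> 0"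
  shows "A \<le> ennreal c"
proof (cases A)
  case (real a)
  then show ?thesis using assms by (simp add: ennreal_power abs_le_square_iff[symmetric] ennreal_leI)
next
  case top
  then show ?thesis using assms by (simp add: power2_eq_square ennreal_top_mult top_unique)
qed

text \<open>Cauchy-Schwarz, with the indicator of the ball attached to the kernel because g vanishes
  outside.\<close>

lemma nn_integral_convolution_cone_weight:
  fixes x :: R3 and g :: "R3 \<Rightarrow> real"
  assumes R: "R > 0" and t: "t \<ge> 0" and N: "N \<ge> 0" and [measurable]: "g \<in> borel_measurable borel"
    and g0: "\<And>y. y \<notin> cball 0 R \<Longrightarrow> g y = 0" and gnn: "\<And>y. g y \<ge> 0"
    and L2: "(\<integral>\<^sup>+y. ennreal ((g y)\<^sup>2) \<partial>lborel) \<le> ennreal (N\<^sup>2)"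
  shows "(\<integral>\<^sup>+y. ennreal (g y * cone_weight t (norm (x - y))) \<partial>lborel)
    \<le> ennreal (6 * pi * min 1 (inverse (1 + t) * R) * N)"
proof (rule ennreal_le_of_square_le)
  let ?c = "\<lambda>y. cone_weight t (norm (x - y))" and ?m = "min 1 (inverse (1 + t) * R)"
  have [measurable]: "cball (0::R3) R \<in> sets borel" by simp
  have c0: "?c y \<ge> 0" for y by (simp add: cone_weight_def)
  have m: "?m \<ge> 0" using R t by simp
  have "(\<integral>\<^sup>+y. ennreal (g y * ?c y) \<partial>lborel) = (\<integral>\<^sup>+y. ennreal (g y) * (ennreal (?c y) * indicator (cball 0 R) y) \<partial>lborel)"
    by (intro nn_integral_cong) (auto simp: indicator_def g0 ennreal_mult gnn c0)
  then have "(\<integral>\<^sup>+y. ennreal (g y * ?c y) \<partial>lborel)\<^sup>2 \<le>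
     (\<integral>\<^sup>+y. ennreal (g y) ^ 2 \<partial>lborel) * (\<integral>\<^sup>+y. (ennreal (?c y) * indicator (cball 0 R) y) ^ 2 \<partial>lborel)"
    by (simp only:) (rule Cauchy_Schwarz_nn_integral; measurable)
  also have "\<dots> = (\<integral>\<^sup>+y. ennreal ((g y)\<^sup>2) \<partial>lborel) * (\<integral>\<^sup>+y. ennreal ((?c y)\<^sup>2) * indicator (cball 0 R) y \<partial>lborel)"
    by (intro arg_cong2[of _ _ _ _ "(*)"] nn_integral_cong) (auto simp: ennreal_power gnn c0 indicator_def)
  also have "\<dots> \<le> ennreal (N\<^sup>2) * ennreal (32 * pi\<^sup>2 * ?m\<^sup>2)"
    by (intro mult_mono L2 nn_integral_cone_weight R t) auto
  \<comment> \<open>32 \<le> 6^2, so the square root has an integer constant.\<close>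
  also have "\<dots> \<le> ennreal ((6 * pi * ?m * N)\<^sup>2)"
    by (subst ennreal_mult[symmetric]) (auto intro!: ennreal_leI simp: power_mult_distrib mult_ac)
  finally show "(\<integral>\<^sup>+y. ennreal (g y * ?c y) \<partial>lborel)\<^sup>2 \<le> ennreal ((6 * pi * ?m * N)\<^sup>2)" .
  show "0 \<le> 6 * pi * ?m * N" using m N by simp
qed

section \<open>Smooth cutoffs\<close>

text \<open>n = 0 is the classical flat function. The powers of 1 / s make the family, up to linear
  combinations, closed under differentiation.\<close>

definition bump :: "nat \<Rightarrow> real \<Rightarrow> real" where
  "bump n s = (if s \<le> 0 then 0 else exp (- 1 / s) / s ^ n)"

lemma bump_nonneg [simp]: "bump n s \<ge> 0" and bump_pos: "s > 0 \<Longrightarrow> bump n s > 0"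
  and bump_nonpos [simp]: "s \<le> 0 \<Longrightarrow> bump n s = 0"
  by (simp_all add: bump_def)

text \<open>Only s = 0 needs an argument: with y = 1 / h the right difference quotient is y^(n + 1)
  / exp y, which tends to 0 at infinity.\<close>

lemma bump_has_derivative:
  "(bump n has_real_derivative (bump (n + 2) s - real n * bump (n + 1) s)) (at s)"
proof -
  consider "s < 0" | "s > 0" | "s = 0" by linarith
  then show ?thesis
  proof cases
    case 1
    have "((\<lambda>s. 0) has_real_derivative 0) (at s)" by simp
    then have "(bump n has_real_derivative 0) (at s)"
      by (rule DERIV_cong_ev[THEN iffD1, rotated 3])
        (use 1 eventually_nhds_in_open[of "{..<0}" s] in \<open>auto elim!: eventually_mono\<close>)
    then show ?thesis using 1 by simp
  next
    case 2
    have "((\<lambda>s. exp (- 1 / s) / s ^ n) has_real_derivative (bump (n + 2) s - real n * bump (n + 1) s)) (at s)"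
    proof -
      have pw: "real n * s ^ (n - Suc 0) * s = real n * s ^ n" by (cases n) simp_all
      have "((\<lambda>s. exp (- 1 / s) / s ^ n) has_real_derivative
          (exp (- 1 / s) * (1 / s\<^sup>2) * s ^ n - exp (- 1 / s) * (real n * s ^ (n - Suc 0))) / (s ^ n * s ^ n)) (at s)"
        using 2 by (auto intro!: derivative_eq_intros simp: power2_eq_square)
      also have "(exp (- 1 / s) * (1 / s\<^sup>2) * s ^ n - exp (- 1 / s) * (real n * s ^ (n - Suc 0))) / (s ^ n * s ^ n)
          = (exp (- 1 / s) * (1 / s\<^sup>2) * s ^ n * s - exp (- 1 / s) * (real n * s ^ (n - Suc 0) * s)) / (s ^ n * s ^ n * s)"
        using 2 by (simp add: field_simps)
      also have "\<dots> = bump (n + 2) s - real n * bump (n + 1) s"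
        unfolding pw using 2 by (simp add: bump_def field_simps power2_eq_square)
      finally show ?thesis .
    qed
    then show ?thesis
      by (rule DERIV_cong_ev[THEN iffD1, rotated 3])
        (use 2 eventually_nhds_in_open[of "{0<..}" s] in \<open>auto elim!: eventually_mono simp: bump_def\<close>)
  next
    case 3
    have "((\<lambda>h. bump n h / h) \<longlongrightarrow> 0) (at_right 0)"
    proof -
      have "((\<lambda>y::real. y ^ (n + 1) / exp y) \<longlongrightarrow> 0) at_top" by (rule tendsto_power_div_exp_0)
      then have "((\<lambda>h. inverse h ^ (n + 1) / exp (inverse h)) \<longlongrightarrow> 0) (at_right (0::real))"
        by (rule filterlim_compose[OF _ filterlim_inverse_at_top_right])
      then show ?thesis
        by (rule Lim_transform_eventually)
          (auto simp: eventually_at_right_less bump_def exp_minus divide_simps intro!: eventually_mono[OF eventually_at_right_less])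
    qed
    moreover have "((\<lambda>h. bump n h / h) \<longlongrightarrow> 0) (at_left 0)"
      by (rule Lim_transform_eventually[OF tendsto_const])
        (auto simp: eventually_at_left_field intro!: exI[of _ "-1"])
    ultimately have "((\<lambda>h. bump n h / h) \<longlongrightarrow> 0) (at 0)" by (rule filterlim_at_split[THEN iffD2, OF conjI, rotated])
    then show ?thesis using 3 by (simp add: has_field_derivative_iff)
  qed
qed

lemma partial_eq:
  assumes "\<And>x. (\<phi> has_derivative D x) (at x)"
  shows "\<phi> differentiable (at x)" and "partial i \<phi> = (\<lambda>x. D x (axis i 1))"
  using assms frechet_derivative_at[OF assms]
  by (auto simp: differentiable_def partial_def fun_eq_iff)

text \<open>A class of functions closed under partial derivatives, so that each member is smooth, and large
  enough to contain cutoffs, their products with plane waves, and quotients.\<close>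

inductive elementary_smooth :: "(R3 \<Rightarrow> complex) \<Rightarrow> bool" where
  const: "elementary_smooth (\<lambda>x. c)"
| bump: "elementary_smooth (\<lambda>x. complex_of_real (bump n (c * x $ i + d)))"
| wave: "elementary_smooth (\<lambda>x. cis (x \<bullet> \<xi>))"
| add: "elementary_smooth \<phi> \<Longrightarrow> elementary_smooth \<psi> \<Longrightarrow> elementary_smooth (\<lambda>x. \<phi> x + \<psi> x)"
| mult: "elementary_smooth \<phi> \<Longrightarrow> elementary_smooth \<psi> \<Longrightarrow> elementary_smooth (\<lambda>x. \<phi> x * \<psi> x)"
| inverse: "elementary_smooth \<phi> \<Longrightarrow> (\<And>x. \<phi> x \<noteq> 0) \<Longrightarrow> elementary_smooth (\<lambda>x. inverse (\<phi> x))"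

lemma has_derivative_cis_inner:
  "((\<lambda>x. cis (x \<bullet> \<xi>)) has_derivative (\<lambda>h. \<i> * complex_of_real (h \<bullet> \<xi>) * cis (x \<bullet> \<xi>))) (at x)"
proof -
  have "((\<lambda>x. \<i> * complex_of_real (x \<bullet> \<xi>)) has_derivative (\<lambda>h. \<i> * complex_of_real (h \<bullet> \<xi>))) (at x)"
    by (auto intro!: derivative_eq_intros)
  from has_derivative_compose[OF this DERIV_exp[unfolded has_field_derivative_def]]
  show ?thesis unfolding cis_conv_exp by (simp add: mult_ac)
qed

text \<open>Differentiability and closure are proved in one induction because the sum, product and
  quotient rules need differentiable parts. Each rule expresses the partial derivative through
  members of the class.\<close>

lemma elementary_smooth_partial:
  assumes "elementary_smooth \<phi>"
  shows "(\<forall>x. \<phi> differentiable (at x)) \<and> (\<forall>i. elementary_smooth (partial i \<phi>))"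
  using assms
proof induction
  case (const c)
  have D: "((\<lambda>x. c) has_derivative (\<lambda>h. 0)) (at x)" for x :: R3 by simp
  from partial_eq[OF this] show ?case by (auto intro: elementary_smooth.const)
next
  case (bump n c i d)
  have D: "((\<lambda>x. complex_of_real (bump n (c * x $ i + d))) has_derivative
      (\<lambda>h. complex_of_real ((bump (n + 2) (c * x $ i + d) - real n * bump (n + 1) (c * x $ i + d)) * (c * h $ i)))) (at x)" for x :: R3
  proof -
    have "((\<lambda>x::R3. c * x $ i + d) has_derivative (\<lambda>h. c * h $ i)) (at x)"
      by (auto intro!: derivative_eq_intros bounded_linear.has_derivative[OF bounded_linear_vec_nth])
    from has_derivative_compose[OF this bump_has_derivative[of n, unfolded has_field_derivative_def]]
    have "((\<lambda>x. bump n (c * x $ i + d)) has_derivative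
        (\<lambda>h. (bump (n + 2) (c * x $ i + d) - real n * bump (n + 1) (c * x $ i + d)) * (c * h $ i))) (at x)" .
    then show ?thesis by (rule has_derivative_of_real)
  qed
  have "elementary_smooth (\<lambda>x. (complex_of_real (bump (n + 2) (c * x $ i + d)) + (- of_nat n) * complex_of_real (bump (n + 1) (c * x $ i + d)))
      * complex_of_real (c * (axis j 1 :: R3) $ i))" for j
    by (intro elementary_smooth.intros)
  moreover have "partial j (\<lambda>x. complex_of_real (bump n (c * x $ i + d))) =
     (\<lambda>x. (complex_of_real (bump (n + 2) (c * x $ i + d)) + (- of_nat n) * complex_of_real (bump (n + 1) (c * x $ i + d)))
      * complex_of_real (c * (axis j 1 :: R3) $ i))" for j
    by (subst partial_eq(2)[OF D]) simp
  ultimately show ?case using partial_eq(1)[OF D] by simp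
next
  case (wave \<xi>)
  have "elementary_smooth (\<lambda>x. \<i> * complex_of_real ((axis j 1 :: R3) \<bullet> \<xi>) * cis (x \<bullet> \<xi>))" for j
    by (intro elementary_smooth.intros)
  then show ?case
    using partial_eq(1)[OF has_derivative_cis_inner] by (simp add: partial_eq(2)[OF has_derivative_cis_inner])
next
  case (add \<phi> \<psi>)
  then have D: "((\<lambda>x. \<phi> x + \<psi> x) has_derivative (\<lambda>h. frechet_derivative \<phi> (at x) h + frechet_derivative \<psi> (at x) h)) (at x)" for x
    by (intro has_derivative_add) (auto simp: frechet_derivative_works)
  have "elementary_smooth (\<lambda>x. partial j \<phi> x + partial j \<psi> x)" for j
    using add by (intro elementary_smooth.intros) auto
  moreover have "partial j (\<lambda>x. \<phi> x + \<psi> x) = (\<lambda>x. partial j \<phi> x + partial j \<psi> x)" for j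
    by (simp only: partial_eq(2)[OF D]) (simp add: partial_def)
  ultimately show ?case using partial_eq(1)[OF D] by simp
next
  case (mult \<phi> \<psi>)
  then have D: "((\<lambda>x. \<phi> x * \<psi> x) has_derivative (\<lambda>h. \<phi> x * frechet_derivative \<psi> (at x) h + frechet_derivative \<phi> (at x) h * \<psi> x)) (at x)" for x
    by (intro has_derivative_mult) (auto simp: frechet_derivative_works)
  have "elementary_smooth (\<lambda>x. \<phi> x * partial j \<psi> x + partial j \<phi> x * \<psi> x)" for j
    using mult by (intro elementary_smooth.intros) auto
  moreover have "partial j (\<lambda>x. \<phi> x * \<psi> x) = (\<lambda>x. \<phi> x * partial j \<psi> x + partial j \<phi> x * \<psi> x)" for j
    by (simp only: partial_eq(2)[OF D]) (simp add: partial_def)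
  ultimately show ?case using partial_eq(1)[OF D] by simp
next
  case (inverse \<phi>)
  then have D: "((\<lambda>x. inverse (\<phi> x)) has_derivative (\<lambda>h. - (inverse (\<phi> x) * frechet_derivative \<phi> (at x) h * inverse (\<phi> x)))) (at x)" for x
    by (intro Deriv.has_derivative_inverse) (auto simp: frechet_derivative_works)
  have "elementary_smooth (\<lambda>x. (- 1) * (inverse (\<phi> x) * partial j \<phi> x * inverse (\<phi> x)))" for j
    using inverse by (intro elementary_smooth.intros) auto
  moreover have "partial j (\<lambda>x. inverse (\<phi> x)) = (\<lambda>x. (- 1) * (inverse (\<phi> x) * partial j \<phi> x * inverse (\<phi> x)))" for j
    by (simp only: partial_eq(2)[OF D]) (simp add: partial_def)
  ultimately show ?case using partial_eq(1)[OF D] by simp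
qed

lemma elementary_smooth_smooth:
  assumes "elementary_smooth \<phi>"
  shows "smooth \<phi>"
proof -
  have "elementary_smooth (foldr partial is \<phi>)" for "is"
    by (induction "is") (use assms elementary_smooth_partial in auto)
  then show ?thesis unfolding smooth_def using elementary_smooth_partial by blast
qed

lemma elementary_smooth_prod:
  "finite A \<Longrightarrow> (\<And>i. i \<in> A \<Longrightarrow> elementary_smooth (\<phi> i)) \<Longrightarrow> elementary_smooth (\<lambda>x. \<Prod>i\<in>A. \<phi> i x)"
  by (induction A rule: finite_induct) (auto intro: elementary_smooth.intros)

text \<open>The usual smooth transition from 0 to 1 across the unit interval; at every s at least
  one bump in the denominator is positive.\<close>

definition smooth_step :: "real \<Rightarrow> real" where
  "smooth_step s = bump 0 s * inverse (bump 0 s + bump 0 (1 - s))"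

lemma bump_sum_pos: "bump 0 s + bump 0 (1 - s) > 0"
  by (cases "s > 0") (auto intro: add_pos_nonneg add_nonneg_pos bump_pos)

lemma smooth_step_props:
  "0 \<le> smooth_step s" "smooth_step s \<le> 1" "s \<le> 0 \<Longrightarrow> smooth_step s = 0" "s \<ge> 1 \<Longrightarrow> smooth_step s = 1"
  using bump_sum_pos[of s] bump_pos[of s 0] by (simp_all add: smooth_step_def field_simps less_imp_le)

lemma elementary_smooth_step: "elementary_smooth (\<lambda>x. complex_of_real (smooth_step (c * x $ i + d)))"
proof -
  \<comment> \<open>The argument 1 - (c x_i + d) is rewritten as an affine function of slope - c,
    the shape that the constructor \<open>bump\<close> accepts.\<close>
  have "elementary_smooth (\<lambda>x. complex_of_real (bump 0 (c * x $ i + d)) *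
     inverse (complex_of_real (bump 0 (c * x $ i + d)) + complex_of_real (bump 0 ((- c) * x $ i + (1 - d)))))"
  proof (intro elementary_smooth.intros)
    fix x :: R3
    show "complex_of_real (bump 0 (c * x $ i + d)) + complex_of_real (bump 0 ((- c) * x $ i + (1 - d))) \<noteq> 0"
      using bump_sum_pos[of "c * x $ i + d"] by (simp add: algebra_simps of_real_add[symmetric] del: of_real_add)
  qed
  then show ?thesis by (simp add: smooth_step_def algebra_simps)
qed

text \<open>m is the steepness: along each face the transition has width 1 / m and lies inside the
  box. Boxes are convenient because each step involves one coordinate and because open boxes
  generate the Borel sets.\<close>

definition box_cutoff :: "real \<Rightarrow> R3 \<Rightarrow> R3 \<Rightarrow> R3 \<Rightarrow> real" where
  "box_cutoff m a b x = (\<Prod>i\<in>UNIV. smooth_step (m * (x $ i - a $ i)) * smooth_step (m * (b $ i - x $ i)))"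

lemma elementary_smooth_box_cutoff: "elementary_smooth (\<lambda>x. complex_of_real (box_cutoff m a b x))"
proof -
  have "elementary_smooth (\<lambda>x. \<Prod>i\<in>UNIV. complex_of_real (smooth_step (m * x $ i + (- m * a $ i))) *
      complex_of_real (smooth_step ((- m) * x $ i + m * b $ i)))"
    by (intro elementary_smooth_prod elementary_smooth.mult elementary_smooth_step) simp
  then show ?thesis by (simp add: box_cutoff_def algebra_simps)
qed

lemma box_cutoff_bounds: "0 \<le> box_cutoff m a b x" "box_cutoff m a b x \<le> 1"
  unfolding box_cutoff_def
  by (auto intro!: prod_nonneg prod_le_1 mult_le_one smooth_step_props mult_nonneg_nonneg)

lemma box_cutoff_support: "m > 0 \<Longrightarrow> box_cutoff m a b x \<noteq> 0 \<Longrightarrow> x \<in> box a b"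
proof -
  assume m: "m > 0" and nz: "box_cutoff m a b x \<noteq> 0"
  have "a $ i < x $ i \<and> x $ i < b $ i" for i
  proof -
    have "smooth_step (m * (x $ i - a $ i)) \<noteq> 0" "smooth_step (m * (b $ i - x $ i)) \<noteq> 0"
      using nz unfolding box_cutoff_def by auto
    then have "m * (x $ i - a $ i) > 0" "m * (b $ i - x $ i) > 0"
      using smooth_step_props(3) not_le by blast+
    then show ?thesis using m by (simp add: zero_less_mult_iff)
  qed
  then show ?thesis by (simp add: mem_box_cart)
qed

lemma box_cutoff_eq_1:
  "(\<And>i. m * (x $ i - a $ i) \<ge> 1) \<Longrightarrow> (\<And>i. m * (b $ i - x $ i) \<ge> 1) \<Longrightarrow> box_cutoff m a b x = 1"
  unfolding box_cutoff_def by (simp add: smooth_step_props)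

lemma box_cutoff_tendsto: "(\<lambda>n. box_cutoff (real (Suc n)) a b x) \<longlonglongrightarrow> indicator (box a b) x"
proof (cases "x \<in> box a b")
  case True
  have "eventually (\<lambda>n. real (Suc n) * c \<ge> 1) sequentially" if "c > 0" for c :: real
    using that by real_asymp
  then have "eventually (\<lambda>n. \<forall>i. real (Suc n) * (x $ i - a $ i) \<ge> 1 \<and> real (Suc n) * (b $ i - x $ i) \<ge> 1) sequentially"
    using True by (intro eventually_all_finite eventually_conj) (auto simp: mem_box_cart)
  then have "eventually (\<lambda>n. box_cutoff (real (Suc n)) a b x = indicator (box a b) x) sequentially"
    by eventually_elim (use True in \<open>auto intro!: box_cutoff_eq_1\<close>)
  then show ?thesis by (rule tendsto_eventually)
next
  case False
  then have "box_cutoff (real (Suc n)) a b x = indicator (box a b) x" for n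
    using box_cutoff_support[of "real (Suc n)" a b x] by auto
  then show ?thesis by simp
qed

text \<open>Used with a constant \<phi> for the fundamental lemma and with a plane wave for Fourier
  transforms of weak derivatives.\<close>

lemma test_function_box_cutoff_mult:
  assumes \<phi>: "elementary_smooth \<phi>" and m: "m > 0" and sub: "cbox a b \<subseteq> U"
  shows "test_function U (\<lambda>x. complex_of_real (box_cutoff m a b x) * \<phi> x)"
proof -
  let ?S = "{x. complex_of_real (box_cutoff m a b x) * \<phi> x \<noteq> 0}"
  have "?S \<subseteq> cbox a b"
    by (intro subsetI subsetD[OF box_subset_cbox] box_cutoff_support[OF m]) auto
  then have cl: "closure ?S \<subseteq> cbox a b" by (rule closure_minimal) (rule closed_cbox)
  have "compact (cbox a b \<inter> closure ?S)" by (rule compact_Int_closed[OF compact_cbox closed_closure])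
  then have "compact (closure ?S)" using cl by (simp add: Int_absorb1)
  moreover have "smooth (\<lambda>x. complex_of_real (box_cutoff m a b x) * \<phi> x)"
    by (intro elementary_smooth_smooth elementary_smooth.mult elementary_smooth_box_cutoff \<phi>)
  ultimately show ?thesis using order_trans[OF cl sub] unfolding test_function_def by (intro conjI)
qed

section \<open>The fundamental lemma of the calculus of variations\<close>

lemma integrable_cbox_if_locally_integrable:
  assumes "locally_integrable U g" "cbox a b \<subseteq> U"
  shows "integrable lebesgue (\<lambda>x. indicator (cbox a b) x *\<^sub>R g x)"
  using assms unfolding locally_integrable_def
  by (subst integrable_restrict_space[symmetric]) auto

text \<open>Cutoffs of growing steepness are admissible test functions and converge to the indicator
  of the open box. Dominated convergence applies because |g| is integrable on the closed
  box.\<close>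

lemma integral_box_eq_0:
  fixes g :: "R3 \<Rightarrow> complex"
  assumes U: "open U" and g: "locally_integrable U g"
    and 0: "\<And>\<phi>. test_function U \<phi> \<Longrightarrow> (LINT x|lebesgue_on U. g x * \<phi> x) = 0"
    and sub: "cbox a b \<subseteq> U"
  shows "(LINT x|lebesgue. indicator (box a b) x *\<^sub>R g x) = 0"
proof -
  let ?g = "\<lambda>x. indicator (cbox a b) x *\<^sub>R g x"
  have i: "integrable lebesgue ?g" by (rule integrable_cbox_if_locally_integrable[OF g sub])
  have cut[measurable]: "box_cutoff m a b \<in> borel_measurable lebesgue" for m
  proof -
    have "continuous_on UNIV (\<lambda>x. complex_of_real (box_cutoff m a b x))"
    proof (intro continuous_at_imp_continuous_on ballI)
      fix x :: R3
      have "(\<lambda>x. complex_of_real (box_cutoff m a b x)) differentiable (at x)"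
        using elementary_smooth_partial[OF elementary_smooth_box_cutoff] by blast
      then show "isCont (\<lambda>x. complex_of_real (box_cutoff m a b x)) x"
        by (rule differentiable_imp_continuous_within)
    qed
    from continuous_on_Re[OF this] have "box_cutoff m a b \<in> borel_measurable borel"
      by (intro borel_measurable_continuous_onI) simp
    then show ?thesis by (intro measurable_completion) simp
  qed
  have z: "(LINT x|lebesgue. box_cutoff (real (Suc n)) a b x *\<^sub>R ?g x) = 0" for n
  proof -
    have "test_function U (\<lambda>x. complex_of_real (box_cutoff (real (Suc n)) a b x) * 1)"
      by (rule test_function_box_cutoff_mult[OF elementary_smooth.const _ sub]) simp
    from 0[OF this] have "(LINT x|lebesgue_on U. g x * complex_of_real (box_cutoff (real (Suc n)) a b x)) = 0" by simp
    then have "(LINT x|lebesgue. indicator U x *\<^sub>R (g x * complex_of_real (box_cutoff (real (Suc n)) a b x))) = 0"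
      using U by (subst (asm) integral_restrict_space) auto
    moreover have "indicator U x *\<^sub>R (g x * complex_of_real (box_cutoff (real (Suc n)) a b x)) = box_cutoff (real (Suc n)) a b x *\<^sub>R ?g x" for x
    proof (cases "box_cutoff (real (Suc n)) a b x = 0")
      case False
      then have "x \<in> cbox a b" using box_cutoff_support[of "real (Suc n)" a b x] box_subset_cbox[of a b] by auto
      then show ?thesis using sub by (auto simp: scaleR_conv_of_real)
    qed simp
    ultimately show ?thesis by simp
  qed
  have "(\<lambda>n. LINT x|lebesgue. box_cutoff (real (Suc n)) a b x *\<^sub>R ?g x) \<longlonglongrightarrow> (LINT x|lebesgue. indicator (box a b) x *\<^sub>R ?g x)"
  proof (rule integral_dominated_convergence[where w="\<lambda>x. norm (?g x)"])
    show "integrable lebesgue (\<lambda>x. norm (?g x))" using i by (rule integrable_norm)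
    show "(\<lambda>x. indicator (box a b) x *\<^sub>R ?g x) \<in> borel_measurable lebesgue"
      by (rule borel_measurable_scaleR[OF _ borel_measurable_integrable[OF i]]) (intro borel_measurable_indicator; simp)
    show "(\<lambda>x. box_cutoff (real (Suc n)) a b x *\<^sub>R ?g x) \<in> borel_measurable lebesgue" for n
      by (rule borel_measurable_scaleR[OF cut borel_measurable_integrable[OF i]])
    show "AE x in lebesgue. (\<lambda>n. box_cutoff (real (Suc n)) a b x *\<^sub>R ?g x) \<longlonglongrightarrow> indicator (box a b) x *\<^sub>R ?g x"
      by (intro AE_I2 tendsto_intros box_cutoff_tendsto)
    show "AE x in lebesgue. norm (box_cutoff (real (Suc n)) a b x *\<^sub>R ?g x) \<le> norm (?g x)" for n
    proof (intro AE_I2)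
      fix x
      have "norm (c *\<^sub>R y) \<le> norm y" if "0 \<le> c" "c \<le> 1" for c and y :: complex
        using that by (simp add: mult_left_le_one_le)
      from this[OF box_cutoff_bounds] show "norm (box_cutoff (real (Suc n)) a b x *\<^sub>R ?g x) \<le> norm (?g x)"
        .
    qed
  qed
  then have "(LINT x|lebesgue. indicator (box a b) x *\<^sub>R ?g x) = 0"
    unfolding z using LIMSEQ_unique[OF _ tendsto_const] by metis
  moreover have "indicator (box a b) x *\<^sub>R ?g x = indicator (box a b) x *\<^sub>R g x" for x
    using box_subset_cbox[of a b] by (auto simp: indicator_def)
  ultimately show ?thesis by (simp only:)
qed

text \<open>Sobolev functions are only Lebesgue measurable, whereas product measures and parameter
  integrals are handled with Borel functions.\<close>

lemma completion_ex_borel_measurable_complex: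
  fixes g :: "'a \<Rightarrow> complex"
  assumes g: "g \<in> borel_measurable (completion M)"
  obtains g' where "g' \<in> borel_measurable M" "AE x in M. g x = g' x"
proof -
  have "(\<lambda>x. Re (g x)) \<in> borel_measurable (completion M)" "(\<lambda>x. Im (g x)) \<in> borel_measurable (completion M)"
    using g by measurable
  then obtain r i where ri: "r \<in> borel_measurable M" "AE x in M. Re (g x) = r x"
      "i \<in> borel_measurable M" "AE x in M. Im (g x) = i x"
    using completion_ex_borel_measurable_real by metis
  show thesis
  proof
    show "(\<lambda>x. complex_of_real (r x) + \<i> * complex_of_real (i x)) \<in> borel_measurable M"
      using ri(1,3) by measurable
    show "AE x in M. g x = complex_of_real (r x) + \<i> * complex_of_real (i x)"
      using ri(2,4) by eventually_elim (simp add: complex_eq_iff)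
  qed
qed

text \<open>Open boxes form an intersection-stable generator, so a Dynkin argument extends the
  vanishing to every Borel set; the vanishing total integral supplies the complement step.\<close>

lemma AE_eq_0_if_box_integrals_eq_0:
  fixes f :: "'a::euclidean_space \<Rightarrow> complex"
  assumes f: "integrable lebesgue f" and UNIV0: "integral\<^sup>L lebesgue f = 0"
    and box0: "\<And>a b. (LINT x|lebesgue. indicator (box a b) x *\<^sub>R f x) = 0"
  shows "AE x in lebesgue. f x = 0"
proof -
  have fm: "f \<in> borel_measurable lebesgue" using f by simp
  obtain f' where f'[measurable]: "f' \<in> borel_measurable lborel" and ff': "AE x in lborel. f x = f' x"
    using completion_ex_borel_measurable_complex[OF fm] by metis
  have ffl: "AE x in lebesgue. f x = f' x" using ff' by (rule AE_completion)
  have if': "integrable lborel f'"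
  proof -
    have "f' \<in> borel_measurable lebesgue" by (rule measurable_completion[OF f'])
    then have "integrable lebesgue f'" using integrable_cong_AE[of f lebesgue f'] f ffl by auto
    then show ?thesis by (simp add: integrable_completion)
  qed
  have eq: "(LINT x|lebesgue. indicator A x *\<^sub>R f x) = (LINT x|lborel. indicator A x *\<^sub>R f' x)" if A: "A \<in> sets borel" for A
  proof -
    have m: "(\<lambda>x. indicator A x *\<^sub>R f' x) \<in> borel_measurable lborel" using A by simp
    have "(LINT x|lebesgue. indicator A x *\<^sub>R f x) = (LINT x|lebesgue. indicator A x *\<^sub>R f' x)"
    proof (rule integral_cong_AE)
      have ind: "(indicator A :: 'a \<Rightarrow> real) \<in> borel_measurable lebesgue" using A by (intro borel_measurable_indicator) simp
      show "(\<lambda>x. indicator A x *\<^sub>R f x) \<in> borel_measurable lebesgue" by (rule borel_measurable_scaleR[OF ind fm])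
      show "(\<lambda>x. indicator A x *\<^sub>R f' x) \<in> borel_measurable lebesgue" by (rule measurable_completion[OF m])
    qed (use ffl in eventually_elim, simp)
    also have "\<dots> = (LINT x|lborel. indicator A x *\<^sub>R f' x)" by (rule integral_completion[OF m])
    finally show ?thesis .
  qed
  have sint: "integrable lborel (\<lambda>x. indicator A x *\<^sub>R f' x)" if "A \<in> sets borel" for A
    using that if' by (intro integrable_mult_indicator) auto
  have U0: "(LINT x|lborel. f' x) = 0" using eq[of UNIV] UNIV0 by simp
  have "set_lebesgue_integral lborel A f' = 0" if "A \<in> sets borel" for A
  proof -
    have "Int_stable (range (\<lambda>(a, b). box a b :: 'a set))" by (auto simp: Int_stable_def box_Int_box)
    moreover have "range (\<lambda>(a, b). box a b :: 'a set) \<subseteq> Pow UNIV" by auto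
    moreover have "A \<in> sigma_sets UNIV (range (\<lambda>(a, b). box a b))"
      using that unfolding borel_eq_box by simp
    ultimately show ?thesis
    proof (induction rule: sigma_sets_induct_disjoint)
      case (basic A)
      then obtain a b where "A = box a b" by auto
      then show ?case using eq[of "box a b"] box0 by (simp add: set_lebesgue_integral_def)
    next
      case empty then show ?case by (simp add: set_lebesgue_integral_def)
    next
      case (compl A)
      then have A: "A \<in> sets borel" by (simp add: borel_eq_box)
      have "(LINT x|lborel. indicator (UNIV - A) x *\<^sub>R f' x) = (LINT x|lborel. f' x - indicator A x *\<^sub>R f' x)"
        by (intro Bochner_Integration.integral_cong) (auto simp: indicator_def)
      also have "\<dots> = 0" using compl if' sint[OF A] U0 by (simp add: set_lebesgue_integral_def)
      finally show ?case by (simp add: set_lebesgue_integral_def)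
    next
      case (union A)
      then have A: "A i \<in> sets lborel" for i by (auto simp: borel_eq_box)
      have "set_lebesgue_integral lborel (\<Union>i. A i) f' = (\<Sum>i. set_lebesgue_integral lborel (A i) f')"
      proof (rule lebesgue_integral_countable_add[OF A])
        show "set_integrable lborel (\<Union>i. A i) f'"
          unfolding set_integrable_def using A by (intro sint) auto
      qed (use union in \<open>auto simp: disjoint_family_on_def\<close>)
      then show ?case using union by simp
    qed
  qed
  then have "AE x in lborel. f' x = 0" by (intro sigma_finite_measure.density_zero[OF sigma_finite_lborel if']) auto
  then have "AE x in lebesgue. f' x = 0" by (rule AE_completion)
  with ffl show ?thesis by eventually_elim simp
qed

text \<open>g is only locally integrable, so the argument runs on closed boxes inside U, where g is
  integrable, and countably many of them cover U.\<close>

lemma fundamental_lemma_variations: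
  fixes g :: "R3 \<Rightarrow> complex"
  assumes U: "open U" and g: "locally_integrable U g"
    and 0: "\<And>\<phi>. test_function U \<phi> \<Longrightarrow> (LINT x|lebesgue_on U. g x * \<phi> x) = 0"
  shows "AE x in lebesgue. x \<in> U \<longrightarrow> g x = 0"
proof -
  have local: "AE x in lebesgue. x \<in> cbox a b \<longrightarrow> g x = 0" if sub: "cbox a b \<subseteq> U" for a b
  proof -
    let ?f = "\<lambda>x. indicator (cbox a b) x *\<^sub>R g x"
    have i: "integrable lebesgue ?f" by (rule integrable_cbox_if_locally_integrable[OF g sub])
    have bdry: "AE x in lebesgue. x \<notin> cbox a b - box a b"
      using negligible_frontier_interval[of a b] by (intro AE_not_in) (simp add: negligible_iff_null_sets)
    have aeq: "(LINT x|lebesgue. indicator S x *\<^sub>R ?f x) = (LINT x|lebesgue. indicator (S \<inter> box a b) x *\<^sub>R g x)" if [measurable]: "S \<in> sets borel" for S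
    proof -
      have "(LINT x|lebesgue. indicator S x *\<^sub>R ?f x) = (LINT x|lebesgue. indicator (S \<inter> box a b) x *\<^sub>R ?f x)"
      proof (rule integral_cong_AE)
        show "(\<lambda>x. indicator S x *\<^sub>R ?f x) \<in> borel_measurable lebesgue" "(\<lambda>x. indicator (S \<inter> box a b) x *\<^sub>R ?f x) \<in> borel_measurable lebesgue"
          using that by (auto intro!: borel_measurable_scaleR[OF _ borel_measurable_integrable[OF i]] borel_measurable_indicator
              simp del: scaleR_scaleR)
        show "AE x in lebesgue. indicator S x *\<^sub>R ?f x = indicator (S \<inter> box a b) x *\<^sub>R ?f x"
          using bdry by eventually_elim (auto simp: indicator_def)
      qed
      also have "\<dots> = (LINT x|lebesgue. indicator (S \<inter> box a b) x *\<^sub>R g x)"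
        using box_subset_cbox[of a b] by (intro Bochner_Integration.integral_cong) (auto simp: indicator_def)
      finally show ?thesis .
    qed
    have "AE x in lebesgue. ?f x = 0"
    proof (rule AE_eq_0_if_box_integrals_eq_0[OF i])
      show "integral\<^sup>L lebesgue ?f = 0"
        using aeq[of UNIV] integral_box_eq_0[OF U g 0 sub] by simp
      fix c d
      obtain a' b' where ab': "box c d \<inter> box a b = box a' b'" unfolding box_Int_box by blast
      show "(LINT x|lebesgue. indicator (box c d) x *\<^sub>R ?f x) = 0"
      proof (cases "box a' b' = {}")
        case True
        then show ?thesis using aeq[of "box c d"] ab' by simp
      next
        \<comment> \<open>Only a nonempty open box has its closed box as closure, which is what
          keeps \<open>cbox a' b'\<close> inside \<open>cbox a b\<close> and hence inside U.\<close>
        case False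
        have "box a' b' \<subseteq> box a b" using ab' by auto
        moreover from this have "box a b \<noteq> {}" using False by auto
        ultimately have "cbox a' b' \<subseteq> cbox a b"
          using closure_mono[of "box a' b'" "box a b"] False by (simp add: closure_box)
        then show ?thesis
          using aeq[of "box c d"] ab' integral_box_eq_0[OF U g 0, of a' b'] sub by simp
      qed
    qed
    then show ?thesis by eventually_elim (auto simp: indicator_def)
  qed
  obtain \<D> where D: "countable \<D>" "\<D> \<subseteq> Pow U" "\<And>X. X \<in> \<D> \<Longrightarrow> \<exists>a b. X = cbox a b" "\<Union>\<D> = U"
    using open_countable_Union_open_cbox[OF U] by metis
  have "AE x in lebesgue. \<forall>X\<in>\<D>. x \<in> X \<longrightarrow> g x = 0"
  proof (subst AE_ball_countable[OF D(1)], intro ballI)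
    fix X assume X: "X \<in> \<D>"
    then obtain a b where "X = cbox a b" using D(3) by blast
    then show "AE x in lebesgue. x \<in> X \<longrightarrow> g x = 0" using local[of a b] D(2) X by auto
  qed
  then show ?thesis by eventually_elim (use D(4) in blast)
qed

section \<open>Weak derivatives\<close>

text \<open>Completeness of Lebesgue measure carries measurability across, and if neither side is
  measurable both integrals have the default value 0. Hence the statement covers arbitrary
  functions.\<close>

lemma integral_cong_AE_lebesgue:
  fixes f g :: "'a::euclidean_space \<Rightarrow> 'b::euclidean_space"
  assumes ae: "AE x in lebesgue. f x = g x"
  shows "integral\<^sup>L lebesgue f = integral\<^sup>L lebesgue g"
proof (cases "f \<in> borel_measurable lebesgue")
  case True
  then have "g \<in> borel_measurable lebesgue" using ae by (rule borel_measurable_AE)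
  with True show ?thesis using ae by (rule integral_cong_AE)
next
  case False
  have "AE x in lebesgue. g x = f x" using ae by eventually_elim simp
  then have "g \<notin> borel_measurable lebesgue" using False borel_measurable_AE[of g f] by blast
  then show ?thesis using False
    by (metis borel_measurable_integrable not_integrable_integral_eq)
qed

text \<open>Valid even where no derivative exists: both sides choose from the same set of
  derivatives.\<close>

lemma partial_cong_open:
  assumes "open S" "\<And>x. x \<in> S \<Longrightarrow> \<phi> x = \<psi> x" "x \<in> S"
  shows "partial i \<phi> x = partial i \<psi> x"
proof -
  have "(\<phi> has_derivative D) (at x) \<longleftrightarrow> (\<psi> has_derivative D) (at x)" for D
    using has_derivative_transform_within_open[of _ D x UNIV S] assms by metis
  then show ?thesis by (simp add: partial_def frechet_derivative_def)
qed

lemma partial_funpow_cong_open: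
  assumes "open S" "\<And>x. x \<in> S \<Longrightarrow> \<phi> x = \<psi> x"
  shows "x \<in> S \<Longrightarrow> (partial i ^^ n) \<phi> x = (partial i ^^ n) \<psi> x"
proof (induction n arbitrary: x)
  case (Suc n)
  then show ?case using partial_cong_open[OF assms(1), of "(partial i ^^ n) \<phi>" "(partial i ^^ n) \<psi>"] by simp
qed (simp add: assms)

lemma mi_deriv_cong_open:
  assumes S: "open S" and eq: "\<And>x. x \<in> S \<Longrightarrow> \<phi> x = \<psi> x" and x: "x \<in> S"
  shows "mi_deriv \<alpha> \<phi> x = mi_deriv \<alpha> \<psi> x"
  unfolding mi_deriv_def
  by (rule partial_funpow_cong_open[OF S _ x], rule partial_funpow_cong_open[OF S], rule partial_funpow_cong_open[OF S], rule eq)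

lemma mi_deriv_zero: "mi_deriv \<alpha> (\<lambda>x. 0) x = 0"
proof -
  have "partial i (\<lambda>x. 0) = (\<lambda>x. 0)" for i by (subst partial_eq(2)[of _ "\<lambda>x h. 0"]) auto
  then have "(partial i ^^ n) (\<lambda>x. 0) = (\<lambda>x. 0)" for i n by (induction n) auto
  then show ?thesis by (simp add: mi_deriv_def)
qed

lemma mi_deriv_eq_0_off_support:
  assumes "x \<notin> closure {x. \<phi> x \<noteq> 0}"
  shows "mi_deriv \<alpha> \<phi> x = 0"
proof -
  have "mi_deriv \<alpha> \<phi> x = mi_deriv \<alpha> (\<lambda>x. 0) x"
    by (rule mi_deriv_cong_open[of "- closure {x. \<phi> x \<noteq> 0}"]) (use assms closure_subset[of "{x. \<phi> x \<noteq> 0}"] in auto)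
  then show ?thesis by (simp add: mi_deriv_zero)
qed

lemma mi_deriv_wave:
  "mi_deriv \<alpha> (\<lambda>x. cis (x \<bullet> \<eta>)) x = (\<Prod>i\<in>UNIV. (\<i> * complex_of_real (\<eta> $ i)) ^ (\<alpha> $ i)) * cis (x \<bullet> \<eta>)"
proof -
  \<comment> \<open>The free constant c keeps the derivative in the same form, so the rule can be
    iterated.\<close>
  have 1: "partial i (\<lambda>x. c * cis (x \<bullet> \<eta>)) = (\<lambda>x. (\<i> * complex_of_real (\<eta> $ i) * c) * cis (x \<bullet> \<eta>))" for i c
  proof -
    have "((\<lambda>x. c * cis (x \<bullet> \<eta>)) has_derivative (\<lambda>h. c * (\<i> * complex_of_real (h \<bullet> \<eta>) * cis (x \<bullet> \<eta>)))) (at x)" for x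
      by (intro has_derivative_mult_right has_derivative_cis_inner)
    from partial_eq(2)[OF this] show ?thesis by (simp add: inner_axis' mult_ac)
  qed
  have n: "(partial i ^^ n) (\<lambda>x. c * cis (x \<bullet> \<eta>)) = (\<lambda>x. ((\<i> * complex_of_real (\<eta> $ i)) ^ n * c) * cis (x \<bullet> \<eta>))" for i n c
    by (induction n) (simp_all only: funpow.simps o_apply id_apply 1 power_0 power_Suc mult_1_left, simp_all only: mult.assoc)
  have p3: "(\<Prod>i\<in>UNIV. F i) = F 1 * F 2 * F 3" for F :: "3 \<Rightarrow> complex"
    unfolding UNIV_3 by (simp add: mult.assoc)
  have n1: "(partial i ^^ n) (\<lambda>x. cis (x \<bullet> \<eta>)) = (\<lambda>x. (\<i> * complex_of_real (\<eta> $ i)) ^ n * cis (x \<bullet> \<eta>))" for i n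
    using n[where c=1] by simp
  show ?thesis unfolding mi_deriv_def p3 by (simp only: n1 n) (simp only: mult.assoc)
qed

lemma mi_order_eq: "mi_order \<alpha> = \<alpha> $ 1 + \<alpha> $ 2 + \<alpha> $ 3"
  by (simp add: mi_order_def sum_3)

text \<open>Over an infinite index set the sum in \<open>sobolev_norm\<close> would take the default
  value 0.\<close>

lemma finite_mi_order: "finite {\<alpha>. mi_order \<alpha> \<le> k}"
proof -
  have "{\<alpha>. mi_order \<alpha> \<le> k} \<subseteq> (\<lambda>f. \<chi> i. f i) ` (Pi UNIV (\<lambda>_. {..k}))"
  proof
    fix \<alpha> assume "\<alpha> \<in> {\<alpha>. mi_order \<alpha> \<le> k}"
    then have "\<alpha> $ i \<le> k" for i using exhaust_3[of i] by (auto simp: mi_order_eq)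
    then show "\<alpha> \<in> (\<lambda>f. \<chi> i. f i) ` (Pi UNIV (\<lambda>_. {..k}))"
      by (intro image_eqI[of _ _ "\<lambda>i. \<alpha> $ i"]) auto
  qed
  moreover have "finite (Pi (UNIV::3 set) (\<lambda>_. {..k}))"
    using finite_PiE[of "UNIV::3 set" "\<lambda>_. {..k}"] by (simp add: PiE_UNIV_domain)
  ultimately show ?thesis by (metis finite_imageI finite_subset)
qed

text \<open>The open sets in \<open>ess_supp\<close> may be uncountably many; Lindelof's theorem
  leaves countably many exceptional null sets.\<close>

lemma ess_supp_AE_eq_0:
  assumes "ess_supp f \<subseteq> S"
  shows "AE x in lebesgue. x \<notin> S \<longrightarrow> f x = 0"
proof -
  let ?F = "{U. open U \<and> (AE x in lebesgue. x \<in> U \<longrightarrow> f x = 0)}"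
  obtain F' where F': "F' \<subseteq> ?F" "countable F'" "\<Union>F' = \<Union>?F"
    using Lindelof[of ?F] by (metis (no_types, lifting) mem_Collect_eq)
  have "AE x in lebesgue. \<forall>U\<in>F'. x \<in> U \<longrightarrow> f x = 0"
    by (subst AE_ball_countable[OF F'(2)]) (use F'(1) in auto)
  then show ?thesis
  proof eventually_elim
    case (elim x)
    show ?case
    proof
      assume "x \<notin> S"
      then have "x \<in> \<Union>?F" using assms unfolding ess_supp_def by blast
      then have "x \<in> \<Union>F'" using F'(3) by simp
      then show "f x = 0" using elim by blast
    qed
  qed
qed

lemma test_functionD:
  assumes "test_function U \<phi>"
  shows "continuous_on UNIV \<phi>" and "\<And>x. x \<notin> U \<Longrightarrow> \<phi> x = 0" and "\<And>x. x \<notin> U \<Longrightarrow> mi_deriv \<alpha> \<phi> x = 0"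
    and "U \<subseteq> V \<Longrightarrow> test_function V \<phi>"
proof -
  have "foldr partial [] \<phi> differentiable (at x)" for x
    using assms unfolding test_function_def smooth_def by blast
  then show "continuous_on UNIV \<phi>"
    by (intro continuous_at_imp_continuous_on ballI differentiable_imp_continuous_within) simp
  show "\<And>x. x \<notin> U \<Longrightarrow> \<phi> x = 0"
    using assms closure_subset[of "{x. \<phi> x \<noteq> 0}"] unfolding test_function_def by blast
  show "\<And>x. x \<notin> U \<Longrightarrow> mi_deriv \<alpha> \<phi> x = 0"
    using assms mi_deriv_eq_0_off_support unfolding test_function_def by blast
  show "U \<subseteq> V \<Longrightarrow> test_function V \<phi>"
    using assms unfolding test_function_def by blast
qed

lemma integrable_mult_test_function:
  assumes U: "open U" and g: "locally_integrable U g" and \<phi>: "test_function U \<phi>"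
  shows "integrable (lebesgue_on U) (\<lambda>x. g x * \<phi> x)"
proof -
  let ?K = "closure {x. \<phi> x \<noteq> 0}"
  have K: "compact ?K" "?K \<subseteq> U" using \<phi> by (auto simp: test_function_def)
  have cont: "continuous_on UNIV \<phi>" using \<phi> by (rule test_functionD)
  have "compact (\<phi> ` ?K)" using K(1) cont by (intro compact_continuous_image) (auto intro: continuous_on_subset)
  then obtain B where B: "\<And>x. x \<in> ?K \<Longrightarrow> norm (\<phi> x) \<le> B"
    by (metis bounded_iff compact_imp_bounded imageI)
  have "integrable (lebesgue_on ?K) g" using g K unfolding locally_integrable_def by blast
  then have i: "integrable lebesgue (\<lambda>x. indicator ?K x *\<^sub>R g x)" by (subst (asm) integrable_restrict_space) auto
  have \<phi>m: "\<phi> \<in> borel_measurable lebesgue"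
    using borel_measurable_continuous_onI[OF cont] by (intro measurable_completion) simp
  have "integrable lebesgue (\<lambda>x. (indicator ?K x *\<^sub>R g x) * \<phi> x)"
  proof (rule Bochner_Integration.integrable_bound)
    show "integrable lebesgue (\<lambda>x. B *\<^sub>R norm (indicator ?K x *\<^sub>R g x))" using i by (intro integrable_scaleR_right integrable_norm)
    show "(\<lambda>x. (indicator ?K x *\<^sub>R g x) * \<phi> x) \<in> borel_measurable lebesgue"
      by (intro borel_measurable_times borel_measurable_integrable[OF i] \<phi>m)
    show "AE x in lebesgue. norm ((indicator ?K x *\<^sub>R g x) * \<phi> x) \<le> norm (B *\<^sub>R norm (indicator ?K x *\<^sub>R g x))"
    proof (intro AE_I2)
      fix x
      show "norm ((indicator ?K x *\<^sub>R g x) * \<phi> x) \<le> norm (B *\<^sub>R norm (indicator ?K x *\<^sub>R g x))"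
      proof (cases "x \<in> ?K")
        case True
        then have "norm (\<phi> x) * norm (g x) \<le> \<bar>B\<bar> * norm (g x)" using B[OF True] by (intro mult_right_mono) auto
        then show ?thesis using True by (simp add: norm_mult abs_mult mult.commute)
      qed simp
    qed
  qed
  also have "(\<lambda>x. (indicator ?K x *\<^sub>R g x) * \<phi> x) = (\<lambda>x. indicator U x *\<^sub>R (g x * \<phi> x))"
  proof
    fix x show "(indicator ?K x *\<^sub>R g x) * \<phi> x = indicator U x *\<^sub>R (g x * \<phi> x)"
      using K(2) closure_subset[of "{x. \<phi> x \<noteq> 0}"] by (cases "\<phi> x = 0") (auto simp: indicator_def)
  qed
  finally show ?thesis using U by (subst integrable_restrict_space) auto
qed

lemma lebesgue_integral_on_eq:
  fixes h :: "R3 \<Rightarrow> complex"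
  assumes "open U" "\<And>x. x \<notin> U \<Longrightarrow> h x = 0"
  shows "(LINT x|lebesgue_on U. h x) = (LINT x|lebesgue. h x)"
proof -
  have "(\<lambda>x. indicator U x *\<^sub>R h x) = h" using assms(2) by (auto simp: indicator_def fun_eq_iff)
  then show ?thesis using assms(1) by (subst integral_restrict_space) auto
qed

lemma has_weak_deriv_UNIV_D:
  assumes "has_weak_deriv UNIV \<alpha> f g" "test_function UNIV \<phi>"
  shows "(LINT x|lebesgue. f x * mi_deriv \<alpha> \<phi> x) = (-1) ^ mi_order \<alpha> * (LINT x|lebesgue. g x * \<phi> x)"
  using assms unfolding has_weak_deriv_def lebesgue_on_UNIV_eq by blast

section \<open>Restriction, uniqueness, support and norms of weak derivatives\<close>

lemma has_weak_deriv_restrict: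
  assumes w: "has_weak_deriv UNIV \<alpha> f g" and U: "open U"
  shows "has_weak_deriv U \<alpha> f g"
  unfolding has_weak_deriv_def
proof (intro conjI allI impI)
  show "locally_integrable U f" "locally_integrable U g"
    using w unfolding has_weak_deriv_def locally_integrable_def by auto
  fix \<phi> assume \<phi>: "test_function U \<phi>"
  have "(LINT x|lebesgue. f x * mi_deriv \<alpha> \<phi> x) = (-1) ^ mi_order \<alpha> * (LINT x|lebesgue. g x * \<phi> x)"
    by (intro has_weak_deriv_UNIV_D[OF w] test_functionD(4)[OF \<phi>]) simp
  then show "(LINT x|lebesgue_on U. f x * mi_deriv \<alpha> \<phi> x) = (-1) ^ mi_order \<alpha> * (LINT x|lebesgue_on U. g x * \<phi> x)"
    using test_functionD(2,3)[OF \<phi>] by (simp add: lebesgue_integral_on_eq[OF U])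
qed

text \<open>This pins down, up to a null set, whichever function \<open>weak_deriv\<close> selects:
  the difference of two candidates integrates to 0 against every test function.\<close>

lemma has_weak_deriv_unique:
  assumes g: "has_weak_deriv U \<alpha> f g" and h: "has_weak_deriv U \<alpha> f h" and U: "open U"
  shows "AE x in lebesgue. x \<in> U \<longrightarrow> g x = h x"
proof -
  have lg: "locally_integrable U g" and lh: "locally_integrable U h"
    using g h by (auto simp: has_weak_deriv_def)
  have "AE x in lebesgue. x \<in> U \<longrightarrow> g x - h x = 0"
  proof (rule fundamental_lemma_variations[OF U])
    show "locally_integrable U (\<lambda>x. g x - h x)"
      using lg lh unfolding locally_integrable_def by auto
    fix \<phi> assume \<phi>: "test_function U \<phi>"
    have "(-1) ^ mi_order \<alpha> * (LINT x|lebesgue_on U. g x * \<phi> x) = (-1) ^ mi_order \<alpha> * (LINT x|lebesgue_on U. h x * \<phi> x)"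
      using g h \<phi> unfolding has_weak_deriv_def by (metis (no_types))
    then have eq: "(LINT x|lebesgue_on U. g x * \<phi> x) = (LINT x|lebesgue_on U. h x * \<phi> x)"
      by (subst (asm) mult_left_cancel) simp_all
    show "(LINT x|lebesgue_on U. (g x - h x) * \<phi> x) = 0"
      unfolding left_diff_distrib
      by (subst Bochner_Integration.integral_diff[OF integrable_mult_test_function[OF U lg \<phi>] integrable_mult_test_function[OF U lh \<phi>]])
        (simp only: eq diff_self)
  qed
  then show ?thesis by eventually_elim simp
qed

text \<open>A test function of the complement of S, and with it all its derivatives, vanishes on S,
  so its pairing with f is 0; then g is annihilated by all such test functions.\<close>

lemma weak_deriv_support:
  assumes g: "has_weak_deriv UNIV \<alpha> f g" and S: "closed S" and f: "AE x in lebesgue. x \<notin> S \<longrightarrow> f x = 0"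
  shows "AE x in lebesgue. x \<notin> S \<longrightarrow> g x = 0"
proof -
  have "open (- S)" using S by (rule open_Compl)
  have "AE x in lebesgue. x \<in> - S \<longrightarrow> g x = 0"
  proof (rule fundamental_lemma_variations[OF \<open>open (- S)\<close>])
    show "locally_integrable (- S) g" using g by (auto simp: has_weak_deriv_def locally_integrable_def)
    fix \<phi> assume \<phi>: "test_function (- S) \<phi>"
    have "(LINT x|lebesgue. f x * mi_deriv \<alpha> \<phi> x) = 0"
    proof (rule integral_eq_zero_AE)
      show "AE x in lebesgue. f x * mi_deriv \<alpha> \<phi> x = 0"
        using f by eventually_elim (use test_functionD(3)[OF \<phi>] in auto)
    qed
    then have "(LINT x|lebesgue. g x * \<phi> x) = 0"
      using has_weak_deriv_UNIV_D[OF g test_functionD(4)[OF \<phi>]] by simp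
    then show "(LINT x|lebesgue_on (- S). g x * \<phi> x) = 0"
      using test_functionD(2)[OF \<phi>] by (subst lebesgue_integral_on_eq[OF \<open>open (- S)\<close>]) auto
  qed
  then show ?thesis by simp
qed

text \<open>g lives on the whole space, the norm on the open ball. They match because g equals the
  chosen derivative a.e. in the open ball, vanishes a.e. outside the closed ball, and the sphere
  between is null.\<close>

lemma weak_deriv_L2_le_sobolev_norm:
  assumes g: "has_weak_deriv UNIV \<alpha> f g" and sq: "square_integrable UNIV g" and k: "mi_order \<alpha> \<le> k"
    and f: "AE x in lebesgue. x \<notin> cball 0 R \<longrightarrow> f x = 0"
  shows "(LINT x|lebesgue. (norm (g x))\<^sup>2) \<le> (sobolev_norm k (ball 0 R) f)\<^sup>2"
proof -
  let ?B = "ball (0::R3) R"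
  let ?W = "weak_deriv ?B \<alpha> f"
  have gB: "has_weak_deriv ?B \<alpha> f g" using g by (rule has_weak_deriv_restrict) simp
  then have W: "has_weak_deriv ?B \<alpha> f ?W" unfolding weak_deriv_def by (rule someI[where P="has_weak_deriv ?B \<alpha> f"])
  have ae: "AE x in lebesgue. x \<in> ?B \<longrightarrow> g x = ?W x" by (rule has_weak_deriv_unique[OF gB W]) simp
  have off: "AE x in lebesgue. x \<notin> cball 0 R \<longrightarrow> g x = 0" by (rule weak_deriv_support[OF g closed_cball f])
  have sph: "AE x in lebesgue. x \<notin> sphere (0::R3) R"
    using negligible_sphere[of "0::R3" R] by (intro AE_not_in) (simp add: negligible_iff_null_sets)
  have nn: "(\<integral>\<^sup>+x. ennreal ((norm (?W x))\<^sup>2) \<partial>lebesgue_on ?B) = (\<integral>\<^sup>+x. ennreal ((norm (g x))\<^sup>2) \<partial>lebesgue)"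
  proof -
    have "(\<integral>\<^sup>+x. ennreal ((norm (?W x))\<^sup>2) \<partial>lebesgue_on ?B) = (\<integral>\<^sup>+x. ennreal ((norm (?W x))\<^sup>2) * indicator ?B x \<partial>lebesgue)"
      by (rule nn_integral_restrict_space) simp
    also have "\<dots> = (\<integral>\<^sup>+x. ennreal ((norm (g x))\<^sup>2) \<partial>lebesgue)"
    proof (rule nn_integral_cong_AE)
      show "AE x in lebesgue. ennreal ((norm (?W x))\<^sup>2) * indicator ?B x = ennreal ((norm (g x))\<^sup>2)"
        using ae off sph by eventually_elim (auto simp: indicator_def dist_norm)
    qed
    finally show ?thesis .
  qed
  have gm: "g \<in> borel_measurable lebesgue" and gi: "integrable lebesgue (\<lambda>x. (norm (g x))\<^sup>2)"
    using sq by (auto simp: square_integrable_def lebesgue_on_UNIV_eq)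
  \<comment> \<open>The chosen derivative inherits measurability from g through a.e. equality on the
    ball.\<close>
  have Wm: "?W \<in> borel_measurable (lebesgue_on ?B)"
  proof -
    have "(\<lambda>x. indicator ?B x *\<^sub>R g x) \<in> borel_measurable lebesgue"
      by (rule borel_measurable_scaleR[OF _ gm], rule borel_measurable_indicator) simp
    then have "(\<lambda>x. indicator ?B x *\<^sub>R ?W x) \<in> borel_measurable lebesgue"
      by (rule borel_measurable_AE) (use ae in eventually_elim, auto simp: indicator_def)
    then show ?thesis by (subst borel_measurable_restrict_space_iff) auto
  qed
  have "(LINT x|lebesgue_on ?B. (norm (?W x))\<^sup>2) = (LINT x|lebesgue. (norm (g x))\<^sup>2)"
    using Wm gm by (subst (1 2) integral_eq_nn_integral) (auto simp: nn)
  moreover have "(LINT x|lebesgue_on ?B. (norm (?W x))\<^sup>2) \<le> (\<Sum>\<alpha> | mi_order \<alpha> \<le> k. LINT x|lebesgue_on ?B. (norm (weak_deriv ?B \<alpha> f x))\<^sup>2)"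
    by (rule member_le_sum[of \<alpha> _ "\<lambda>\<alpha>. LINT x|lebesgue_on ?B. (norm (weak_deriv ?B \<alpha> f x))\<^sup>2"])
      (use k in \<open>auto simp: finite_mi_order\<close>)
  ultimately show ?thesis unfolding sobolev_norm_def
    by (simp add: sum_nonneg)
qed

text \<open>The definition of the weak derivative is tested with a plane wave. Multiplying the wave
  by a cutoff equal to 1 near the ball makes it an admissible test function and changes neither
  side.\<close>

lemma fourier_weak_deriv:
  assumes g: "has_weak_deriv UNIV \<alpha> f g" and f: "AE x in lebesgue. x \<notin> cball 0 R \<longrightarrow> f x = 0"
  shows "fourier g \<xi> = (\<Prod>i\<in>UNIV. (\<i> * complex_of_real (\<xi> $ i)) ^ (\<alpha> $ i)) * fourier f \<xi>"
proof -
  \<comment> \<open>With steepness 1 the transition layer has width 1, so the half-side |R| + 2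
    leaves the value 1 on an open ball of radius |R| + 1. An open neighbourhood of the support is
    needed to compare derivatives.\<close>
  define b :: R3 where "b = (\<chi> i. \<bar>R\<bar> + 2)"
  define \<chi>' where "\<chi>' x = complex_of_real (box_cutoff 1 (- b) b x)" for x
  let ?E = "\<lambda>x. cis (x \<bullet> - \<xi>)"
  let ?\<phi> = "\<lambda>x. \<chi>' x * ?E x"
  have \<chi>1: "\<chi>' x = 1" if "x \<in> ball 0 (\<bar>R\<bar> + 1)" for x
  proof -
    have le: "\<bar>x $ i\<bar> \<le> \<bar>R\<bar> + 1" for i using that component_le_norm_cart[of x i] by (simp add: dist_norm)
    have "box_cutoff 1 (- b) b x = 1"
    proof (rule box_cutoff_eq_1)
      fix i
      show "1 \<le> 1 * (x $ i - (- b) $ i)" "1 \<le> 1 * (b $ i - x $ i)" using le[of i] by (simp_all add: b_def)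
    qed
    then show ?thesis by (simp add: \<chi>'_def)
  qed
  have \<phi>: "test_function UNIV ?\<phi>"
    unfolding \<chi>'_def by (intro test_function_box_cutoff_mult elementary_smooth.wave) auto
  have goff: "AE x in lebesgue. x \<notin> cball 0 R \<longrightarrow> g x = 0" by (rule weak_deriv_support[OF g closed_cball f])
  let ?P = "\<lambda>\<eta>. \<Prod>i\<in>UNIV. (\<i> * complex_of_real (\<eta> $ i)) ^ (\<alpha> $ i)"
  have sub: "x \<in> ball 0 (\<bar>R\<bar> + 1)" if "x \<in> cball (0::R3) R" for x using that by (simp add: dist_norm)
  have 1: "(LINT x|lebesgue. f x * mi_deriv \<alpha> ?\<phi> x) = (LINT x|lebesgue. f x * (?P (- \<xi>) * ?E x))"
  proof (rule integral_cong_AE_lebesgue)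
    show "AE x in lebesgue. f x * mi_deriv \<alpha> ?\<phi> x = f x * (?P (- \<xi>) * ?E x)"
      using f
    proof eventually_elim
      case (elim x)
      show ?case
      proof (cases "x \<in> cball 0 R")
        case True
        have "mi_deriv \<alpha> ?\<phi> x = mi_deriv \<alpha> ?E x"
          by (rule mi_deriv_cong_open[of "ball 0 (\<bar>R\<bar> + 1)"]) (use sub[OF True] \<chi>1 in auto)
        then show ?thesis by (simp only: mi_deriv_wave)
      qed (use elim in simp)
    qed
  qed
  have 2: "(LINT x|lebesgue. g x * ?\<phi> x) = (LINT x|lebesgue. g x * ?E x)"
  proof (rule integral_cong_AE_lebesgue)
    show "AE x in lebesgue. g x * ?\<phi> x = g x * ?E x"
      using goff by eventually_elim (use sub \<chi>1 in fastforce)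
  qed
  have F: "fourier h \<xi> = (LINT x|lebesgue. h x * ?E x)" for h
    by (simp add: fourier_def mult.commute)
  have "(LINT x|lebesgue. f x * mi_deriv \<alpha> ?\<phi> x) = (-1) ^ mi_order \<alpha> * (LINT x|lebesgue. g x * ?\<phi> x)"
    by (rule has_weak_deriv_UNIV_D[OF g \<phi>])
  then have "(LINT x|lebesgue. ?P (- \<xi>) * (f x * ?E x)) = (-1) ^ mi_order \<alpha> * fourier g \<xi>"
    unfolding 1 2 F by (simp add: mult_ac)
  then have "?P (- \<xi>) * fourier f \<xi> = (-1) ^ mi_order \<alpha> * fourier g \<xi>"
    unfolding F[of f] by (simp only: integral_mult_right_zero)
  \<comment> \<open>A second factor of the sign cancels it on the right and turns the symbol at -
    \<xi> into the symbol at \<xi> on the left.\<close>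
  then have "(-1) ^ mi_order \<alpha> * ?P (- \<xi>) * fourier f \<xi> = ((-1) ^ mi_order \<alpha> * (-1) ^ mi_order \<alpha>) * fourier g \<xi>"
    by (simp only: mult.assoc)
  also have "(-1) ^ mi_order \<alpha> * (-1) ^ mi_order \<alpha> = (1::complex)" by (simp add: power_mult_distrib[symmetric])
  also have "(-1) ^ mi_order \<alpha> * ?P (- \<xi>) = ?P \<xi>"
    unfolding mi_order_def by (simp add: power_sum prod.distrib[symmetric] power_mult_distrib[symmetric])
  finally show ?thesis by simp
qed

section \<open>The estimate\<close>

lemma integrable_pair_mult:
  fixes f :: "'a \<Rightarrow> real" and g :: "'b \<Rightarrow> real"
  assumes "sigma_finite_measure M1" "sigma_finite_measure M2"
    and f: "integrable M1 f" and g: "integrable M2 g"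
  shows "integrable (M1 \<Otimes>\<^sub>M M2) (\<lambda>(x, y). f x * g y)"
proof -
  interpret pair_sigma_finite M1 M2 using assms(1,2) by (simp add: pair_sigma_finite_def)
  have [measurable]: "f \<in> borel_measurable M1" "g \<in> borel_measurable M2" using f g by auto
  show ?thesis
    by (rule Fubini_integrable) (use f g in \<open>auto simp: abs_mult intro!: AE_I2\<close>)
qed

lemma cis_inner_measurable [measurable (raw)]:
  fixes f g :: "'a \<Rightarrow> 'b::euclidean_space"
  assumes [measurable]: "f \<in> borel_measurable M" "g \<in> borel_measurable M"
  shows "(\<lambda>x. cis (f x \<bullet> g x)) \<in> borel_measurable M"
proof -
  have [measurable]: "cis \<in> borel_measurable borel"
    by (intro borel_measurable_continuous_onI continuous_intros)
  show ?thesis by measurable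
qed

lemma fourier_borel_representative:
  assumes ae: "AE x in lebesgue. g x = g' x" and g': "g' \<in> borel_measurable borel"
  shows "fourier g \<xi> = (LINT y|lborel. cis (- (y \<bullet> \<xi>)) * g' y)"
proof -
  have "fourier g \<xi> = (LINT y|lebesgue. cis (- (y \<bullet> \<xi>)) * g' y)"
    unfolding fourier_def by (rule integral_cong_AE_lebesgue) (use ae in eventually_elim, simp)
  also have "\<dots> = (LINT y|lborel. cis (- (y \<bullet> \<xi>)) * g' y)"
  proof (rule integral_completion)
    have "(\<lambda>y. cis ((- y) \<bullet> \<xi>) * g' y) \<in> borel_measurable lborel" using g' by measurable
    then show "(\<lambda>y. cis (- (y \<bullet> \<xi>)) * g' y) \<in> borel_measurable lborel" by (simp only: inner_minus_left)
  qed
  finally show ?thesis .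
qed

text \<open>Measurability of an integral in its parameter requires joint measurability, which the
  Borel representative provides.\<close>

lemma fourier_measurable:
  assumes g: "g \<in> borel_measurable lebesgue"
  shows "fourier g \<in> borel_measurable borel"
proof -
  obtain g' where [measurable]: "g' \<in> borel_measurable lborel" and ae: "AE x in lborel. g x = g' x"
    using completion_ex_borel_measurable_complex[OF g] by metis
  have "fourier g = (\<lambda>\<xi>. LINT y|lborel. cis (y \<bullet> (- \<xi>)) * g' y)"
    using fourier_borel_representative[OF AE_completion[OF ae]] by (auto simp: fun_eq_iff)
  also have "\<dots> \<in> borel_measurable borel" by measurable
  finally show ?thesis .
qed

text \<open>g stands for one weak derivative of f and M for a propagator symbol times the Bessel
  weight. Both are integrable, so Fubini writes the multiplier as a convolution with the kernel of
  M, and Cauchy-Schwarz against the cone weight applies.\<close>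

lemma multiplier_convolution_bound:
  fixes g :: "R3 \<Rightarrow> complex" and M :: "real \<Rightarrow> real"
  assumes R: "R > 0" and t: "t > 0" and N: "N \<ge> 0" and K0: "K0 \<ge> 0"
    and gm: "g \<in> borel_measurable lebesgue" and gi: "integrable lebesgue (\<lambda>x. (norm (g x))\<^sup>2)"
    and L2: "(LINT x|lebesgue. (norm (g x))\<^sup>2) \<le> N\<^sup>2"
    and off: "AE x in lebesgue. x \<notin> cball 0 R \<longrightarrow> g x = 0"
    and [measurable]: "M \<in> borel_measurable borel" and Mi: "integrable lborel (\<lambda>\<xi>::R3. M (norm \<xi>))"
    and K: "\<And>z::R3. norm (LINT \<xi>|lborel. cis (z \<bullet> \<xi>) * complex_of_real (M (norm \<xi>))) \<le> K0 * cone_weight t (norm z)"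
  shows "integrable lborel (\<lambda>\<xi>. cis (x \<bullet> \<xi>) * (complex_of_real (M (norm \<xi>)) * fourier g \<xi>))"
    and "norm (LINT \<xi>|lborel. cis (x \<bullet> \<xi>) * (complex_of_real (M (norm \<xi>)) * fourier g \<xi>))
      \<le> K0 * (6 * pi * min 1 (inverse (1 + t) * R) * N)"
proof -
  obtain g' where g'[measurable]: "g' \<in> borel_measurable lborel" and ae: "AE x in lborel. g x = g' x"
    using completion_ex_borel_measurable_complex[OF gm] by metis
  \<comment> \<open>A Borel representative of g that vanishes everywhere off the ball, not merely
    almost everywhere.\<close>
  define h where "h y = indicator (cball 0 R) y *\<^sub>R g' y" for y
  have [measurable]: "cball (0::R3) R \<in> sets borel" by simp
  have h[measurable]: "h \<in> borel_measurable borel" unfolding h_def by measurable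
  have aeh: "AE x in lebesgue. g x = h x"
    using AE_completion[OF ae] off by eventually_elim (auto simp: h_def indicator_def)
  have nn: "(\<integral>\<^sup>+y. ennreal ((norm (h y))\<^sup>2) \<partial>lborel) \<le> ennreal (N\<^sup>2)"
  proof -
    have "(\<integral>\<^sup>+y. ennreal ((norm (h y))\<^sup>2) \<partial>lborel) = (\<integral>\<^sup>+y. ennreal ((norm (h y))\<^sup>2) \<partial>lebesgue)"
      by (rule nn_integral_completion[symmetric])
    also have "\<dots> = (\<integral>\<^sup>+y. ennreal ((norm (g y))\<^sup>2) \<partial>lebesgue)"
      by (rule nn_integral_cong_AE) (use aeh in eventually_elim, simp)
    also have "\<dots> = ennreal (LINT x|lebesgue. (norm (g x))\<^sup>2)"
      by (rule nn_integral_eq_integral[OF gi]) simp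
    also have "\<dots> \<le> ennreal (N\<^sup>2)" by (rule ennreal_leI[OF L2])
    finally show ?thesis .
  qed
  have h2: "integrable lborel (\<lambda>y. (norm (h y))\<^sup>2)"
    by (rule integrableI_bounded) (use nn in \<open>auto intro: le_less_trans\<close>)
  have hi: "integrable lborel (\<lambda>y. norm (h y))"
  proof (rule integrable_dominated)
    show "integrable lborel (\<lambda>y. indicator (cball 0 R) y + (norm (h y))\<^sup>2)"
      using emeasure_lborel_cball_finite[of "0::R3" R] h2 by (intro Bochner_Integration.integrable_add integrable_real_indicator) auto
    fix y
    show "norm (norm (h y)) \<le> indicator (cball 0 R) y + (norm (h y))\<^sup>2"
    proof (cases "y \<in> cball 0 R")
      case True
      \<comment> \<open>On a set of finite measure, square integrability gives integrability through
        |h| \<le> 1 + |h|^2.\<close>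
      have "norm (h y) \<le> 1 + (norm (h y))\<^sup>2"
        using zero_le_power2[of "norm (h y) - 1"] by (simp add: power2_eq_square algebra_simps) (smt (verit) norm_ge_zero mult_nonneg_nonneg)
      then show ?thesis using True by simp
    qed (simp add: h_def)
  qed measurable
  have F: "fourier g \<xi> = (LINT y|lborel. cis (- (y \<bullet> \<xi>)) * h y)" for \<xi>
    by (rule fourier_borel_representative[OF aeh h])
  \<comment> \<open>The phases of both transforms are merged, so that the integral over \<xi> is the
    kernel evaluated at x - y.\<close>
  define \<Psi> where "\<Psi> = (\<lambda>(\<xi>, y). cis ((x - y) \<bullet> \<xi>) * complex_of_real (M (norm \<xi>)) * h y)"
  have P: "integrable (lborel \<Otimes>\<^sub>M lborel) \<Psi>"
  proof (rule integrable_dominated)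
    show "integrable (lborel \<Otimes>\<^sub>M lborel) (\<lambda>(\<xi>::R3, y). norm (M (norm \<xi>)) * norm (h y))"
      by (rule integrable_pair_mult[OF sigma_finite_lborel sigma_finite_lborel integrable_norm[OF Mi] hi])
    show "\<Psi> \<in> borel_measurable (lborel \<Otimes>\<^sub>M lborel)" unfolding \<Psi>_def by measurable
  qed (auto simp: \<Psi>_def norm_mult)
  have eq: "cis (x \<bullet> \<xi>) * (complex_of_real (M (norm \<xi>)) * fourier g \<xi>) = (LINT y|lborel. \<Psi> (\<xi>, y))" for \<xi>
  proof -
    have "cis ((x - y) \<bullet> \<xi>) = cis (x \<bullet> \<xi>) * cis (- (y \<bullet> \<xi>))" for y
      by (simp add: cis_mult inner_diff_left)
    then show ?thesis unfolding F \<Psi>_def by (simp only: prod.case integral_mult_right_zero[symmetric] mult_ac)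
  qed
  show "integrable lborel (\<lambda>\<xi>. cis (x \<bullet> \<xi>) * (complex_of_real (M (norm \<xi>)) * fourier g \<xi>))"
    unfolding eq using lborel_pair.integrable_fst'[OF P] .
  have "(LINT \<xi>|lborel. cis (x \<bullet> \<xi>) * (complex_of_real (M (norm \<xi>)) * fourier g \<xi>)) = (LINT y|lborel. LINT \<xi>|lborel. \<Psi> (\<xi>, y))"
    unfolding eq using lborel_pair.Fubini_integral[of "\<lambda>\<xi> y. \<Psi> (\<xi>, y)"] P by simp
  also have "ennreal (norm \<dots>) \<le> (\<integral>\<^sup>+y. ennreal (norm (LINT \<xi>|lborel. \<Psi> (\<xi>, y))) \<partial>lborel)"
    using lborel_pair.integrable_snd[of "\<lambda>\<xi> y. \<Psi> (\<xi>, y)"] P by (intro integral_norm_bound_ennreal) simp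
  also have "\<dots> \<le> (\<integral>\<^sup>+y. ennreal K0 * ennreal (norm (h y) * cone_weight t (norm (x - y))) \<partial>lborel)"
  proof (intro nn_integral_mono)
    fix y
    have "(LINT \<xi>|lborel. \<Psi> (\<xi>, y)) = (LINT \<xi>|lborel. cis ((x - y) \<bullet> \<xi>) * complex_of_real (M (norm \<xi>))) * h y"
      by (simp add: \<Psi>_def)
    then have "norm (LINT \<xi>|lborel. \<Psi> (\<xi>, y)) \<le> K0 * cone_weight t (norm (x - y)) * norm (h y)"
      using K[of "x - y"] by (simp add: norm_mult mult_right_mono)
    also have "\<dots> = K0 * (norm (h y) * cone_weight t (norm (x - y)))" by (simp add: mult_ac)
    finally have "ennreal (norm (LINT \<xi>|lborel. \<Psi> (\<xi>, y))) \<le> ennreal (K0 * (norm (h y) * cone_weight t (norm (x - y))))"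
      by (rule ennreal_leI)
    also have "\<dots> = ennreal K0 * ennreal (norm (h y) * cone_weight t (norm (x - y)))"
      using K0 by (intro ennreal_mult) (auto simp: cone_weight_def)
    finally show "ennreal (norm (LINT \<xi>|lborel. \<Psi> (\<xi>, y))) \<le> \<dots>" .
  qed
  also have "\<dots> = ennreal K0 * (\<integral>\<^sup>+y. ennreal (norm (h y) * cone_weight t (norm (x - y))) \<partial>lborel)"
    by (rule nn_integral_cmult) measurable
  also have "\<dots> \<le> ennreal K0 * ennreal (6 * pi * min 1 (inverse (1 + t) * R) * N)"
    using t nn by (intro mult_left_mono nn_integral_convolution_cone_weight R N) (auto simp: h_def indicator_def)
  also have "\<dots> = ennreal (K0 * (6 * pi * min 1 (inverse (1 + t) * R) * N))"
    using K0 N R t by (intro ennreal_mult[symmetric]) auto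
  finally show "norm (LINT \<xi>|lborel. cis (x \<bullet> \<xi>) * (complex_of_real (M (norm \<xi>)) * fourier g \<xi>))
      \<le> K0 * (6 * pi * min 1 (inverse (1 + t) * R) * N)"
    using K0 N R t by (subst (asm) ennreal_le_iff) auto
qed

text \<open>The index of a pure second derivative; sums of two of them index the terms of
  \<Delta>^2, including i = j.\<close>

definition double_index :: "3 \<Rightarrow> multi_index" where
  "double_index i = (\<chi> k. if k = i then 2 else 0)"

lemma mi_order_double_index: "mi_order (double_index i) = 2" "mi_order (double_index i + double_index j) = 4" "mi_order 0 = 0"
  by (simp_all add: mi_order_def double_index_def sum.distrib)

lemma symbol_double_index:
  "(\<Prod>k\<in>UNIV. (\<i> * complex_of_real (\<xi> $ k)) ^ (double_index i $ k)) = - (complex_of_real (\<xi> $ i))\<^sup>2"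
proof -
  have "(\<Prod>k\<in>UNIV. (\<i> * complex_of_real (\<xi> $ k)) ^ (double_index i $ k)) = (\<Prod>k\<in>UNIV. if k = i then (\<i> * complex_of_real (\<xi> $ k))\<^sup>2 else 1)"
    by (intro prod.cong) (auto simp: double_index_def)
  then show ?thesis by (simp add: power_mult_distrib)
qed

lemma symbol_double_index_add:
  "(\<Prod>k\<in>UNIV. (\<i> * complex_of_real (\<xi> $ k)) ^ ((double_index i + double_index j) $ k)) =
    (complex_of_real (\<xi> $ i))\<^sup>2 * (complex_of_real (\<xi> $ j))\<^sup>2"
  by (simp add: power_add prod.distrib symbol_double_index)

text \<open>The expansion of \<open>(1 - \<Delta>)\<^sup>2\<close> into derivatives of orders 0, 2 and 4, on the Fourier side.\<close>

lemma bessel_symbol: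
  fixes \<xi> :: R3 and A :: complex
  defines "s i \<equiv> (complex_of_real (\<xi> $ i))\<^sup>2"
  shows "A = complex_of_real (bessel_weight (norm \<xi>)) *
     (A - 2 * (\<Sum>i\<in>UNIV. - s i * A) + (\<Sum>i\<in>UNIV. \<Sum>j\<in>UNIV. s i * s j * A))"
proof -
  let ?S = "\<Sum>i\<in>UNIV. s i"
  have "(norm \<xi>)\<^sup>2 = (\<Sum>i\<in>UNIV. (\<xi> $ i)\<^sup>2)"
    unfolding power2_norm_eq_inner inner_vec_def by (simp add: power2_eq_square)
  then have S: "complex_of_real ((norm \<xi>)\<^sup>2) = ?S"
    by (simp only: of_real_sum of_real_power s_def)
  have "A - 2 * (\<Sum>i\<in>UNIV. - s i * A) + (\<Sum>i\<in>UNIV. \<Sum>j\<in>UNIV. s i * s j * A) = (1 + ?S)\<^sup>2 * A"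
  proof -
    have "(\<Sum>i\<in>UNIV. - s i * A) = - (?S * A)" by (simp add: sum_negf sum_distrib_right)
    moreover have "(\<Sum>i\<in>UNIV. \<Sum>j\<in>UNIV. s i * s j * A) = ?S * ?S * A"
      unfolding sum_product by (simp only: sum_distrib_right)
    ultimately show ?thesis by (simp add: power2_eq_square ring_distribs)
  qed
  also have "1 + ?S = complex_of_real (1 + (norm \<xi>)\<^sup>2)" unfolding of_real_add S by simp
  finally have eq: "A - 2 * (\<Sum>i\<in>UNIV. - s i * A) + (\<Sum>i\<in>UNIV. \<Sum>j\<in>UNIV. s i * s j * A) = complex_of_real ((1 + (norm \<xi>)\<^sup>2)\<^sup>2) * A"
    by simp
  have "bessel_weight (norm \<xi>) * (1 + (norm \<xi>)\<^sup>2)\<^sup>2 = 1"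
    using add_pos_nonneg[of 1 "(norm \<xi>)\<^sup>2"] by (simp add: power_mult_distrib[symmetric])
  then show ?thesis unfolding eq by (simp only: mult.assoc[symmetric] of_real_mult[symmetric]) simp
qed

text \<open>Each of the 1 + 3 + 9 derivatives in (1 - \<Delta>)^2 f satisfies the convolution bound
  with the full norm N. Weighted by the coefficients 1, 2 and 1 they add up to the factor 16; (2
  pi)^3 is the normalisation of the inverse transform.\<close>

lemma radial_multiplier_Linf_bound:
  fixes f :: "R3 \<Rightarrow> complex" and \<mu> :: "real \<Rightarrow> real"
  assumes R: "R > 0" and t: "t > 0" and K0: "K0 \<ge> 0"
    and f: "f \<in> sobolev_space 4 UNIV" and supp: "ess_supp f \<subseteq> cball 0 R"
    and \<mu>[measurable]: "\<mu> \<in> borel_measurable borel"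
    and i: "integrable lborel (\<lambda>\<rho>. \<rho>\<^sup>2 * (\<mu> \<rho> * bessel_weight \<rho>))"
    and K: "\<And>z::R3. norm (LINT \<xi>|lborel. cis (z \<bullet> \<xi>) * complex_of_real (\<mu> (norm \<xi>) * bessel_weight (norm \<xi>))) \<le> K0 * cone_weight t (norm z)"
  shows "Linf_norm (fourier_multiplier (\<lambda>\<xi>. complex_of_real (\<mu> (norm \<xi>))) f)
    \<le> ereal (16 * K0 * 6 * pi / (2 * pi) ^ 3 * min 1 (inverse (1 + t) * R) * sobolev_norm 4 (ball 0 R) f)"
proof -
  define N where "N = sobolev_norm 4 (ball 0 R) f"
  define B where "B = K0 * (6 * pi * min 1 (inverse (1 + t) * R) * N)"
  have N: "N \<ge> 0" by (auto simp: N_def sobolev_norm_def intro!: real_sqrt_ge_zero sum_nonneg)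
  have f0: "AE x in lebesgue. x \<notin> cball 0 R \<longrightarrow> f x = 0" using supp by (rule ess_supp_AE_eq_0)
  obtain g where g: "\<And>\<alpha>. mi_order \<alpha> \<le> 4 \<Longrightarrow> has_weak_deriv UNIV \<alpha> f (g \<alpha>)"
      "\<And>\<alpha>. mi_order \<alpha> \<le> 4 \<Longrightarrow> square_integrable UNIV (g \<alpha>)"
    using f unfolding sobolev_space_def by (simp, metis)
  have fm: "f \<in> borel_measurable lebesgue"
    using f by (simp add: sobolev_space_def square_integrable_def lebesgue_on_UNIV_eq)
  let ?M = "\<lambda>\<rho>. \<mu> \<rho> * bessel_weight \<rho>"
  let ?U = "\<lambda>\<alpha> x \<xi>. cis (x \<bullet> \<xi>) * (complex_of_real (?M (norm \<xi>)) * fourier (g \<alpha>) \<xi>)"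
  have Mi: "integrable lborel (\<lambda>\<xi>::R3. ?M (norm \<xi>))" by (rule integrable_radial[OF _ i]) measurable
  have U: "integrable lborel (?U \<alpha> x)" "norm (LINT \<xi>|lborel. ?U \<alpha> x \<xi>) \<le> B" if \<alpha>: "mi_order \<alpha> \<le> 4" for \<alpha> x
  proof -
    have gm: "g \<alpha> \<in> borel_measurable lebesgue" and gi: "integrable lebesgue (\<lambda>x. (norm (g \<alpha> x))\<^sup>2)"
      using g(2)[OF \<alpha>] by (simp_all add: square_integrable_def lebesgue_on_UNIV_eq)
    have L2: "(LINT x|lebesgue. (norm (g \<alpha> x))\<^sup>2) \<le> N\<^sup>2"
      unfolding N_def by (rule weak_deriv_L2_le_sobolev_norm[OF g(1)[OF \<alpha>] g(2)[OF \<alpha>] \<alpha> f0])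
    have off: "AE x in lebesgue. x \<notin> cball 0 R \<longrightarrow> g \<alpha> x = 0"
      by (rule weak_deriv_support[OF g(1)[OF \<alpha>] closed_cball f0])
    have Mm: "?M \<in> borel_measurable borel" by measurable
    show "integrable lborel (?U \<alpha> x)" "norm (LINT \<xi>|lborel. ?U \<alpha> x \<xi>) \<le> B"
      unfolding B_def by (rule multiplier_convolution_bound[OF R t N K0 gm gi L2 off Mm Mi K])+
  qed
  have ft: "fourier (g \<alpha>) \<xi> = (\<Prod>k\<in>UNIV. (\<i> * complex_of_real (\<xi> $ k)) ^ (\<alpha> $ k)) * fourier f \<xi>" if "mi_order \<alpha> \<le> 4" for \<alpha> \<xi>
    by (rule fourier_weak_deriv[OF g(1)[OF that] f0])
  let ?d = double_index
  have o: "mi_order 0 \<le> 4" "mi_order (?d i) \<le> 4" "mi_order (?d i + ?d j) \<le> 4" for i j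
    by (simp_all add: mi_order_double_index)
  have dec: "cis (x \<bullet> \<xi>) * (complex_of_real (\<mu> (norm \<xi>)) * fourier f \<xi>) =
     ?U 0 x \<xi> - 2 * (\<Sum>i\<in>UNIV. ?U (?d i) x \<xi>) + (\<Sum>i\<in>UNIV. \<Sum>j\<in>UNIV. ?U (?d i + ?d j) x \<xi>)" for x \<xi>
  proof -
    have "fourier f \<xi> = complex_of_real (bessel_weight (norm \<xi>)) * (fourier (g 0) \<xi> - 2 * (\<Sum>i\<in>UNIV. fourier (g (?d i)) \<xi>)
        + (\<Sum>i\<in>UNIV. \<Sum>j\<in>UNIV. fourier (g (?d i + ?d j)) \<xi>))"
      unfolding ft[OF o(1)] ft[OF o(2)] ft[OF o(3)] symbol_double_index symbol_double_index_add
      using bessel_symbol[of "fourier f \<xi>" \<xi>] by simp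
    then have "cis (x \<bullet> \<xi>) * (complex_of_real (\<mu> (norm \<xi>)) * fourier f \<xi>) =
       (cis (x \<bullet> \<xi>) * complex_of_real (?M (norm \<xi>))) * (fourier (g 0) \<xi> - 2 * (\<Sum>i\<in>UNIV. fourier (g (?d i)) \<xi>)
        + (\<Sum>i\<in>UNIV. \<Sum>j\<in>UNIV. fourier (g (?d i + ?d j)) \<xi>))"
      by (simp only: of_real_mult mult.assoc)
    then show ?thesis
      by (simp only: distrib_left right_diff_distrib sum_distrib_left mult.assoc mult.left_commute[of _ 2])
  qed
  let ?V = "\<lambda>\<alpha> x. LINT \<xi>|lborel. ?U \<alpha> x \<xi>"
  have tri: "norm (p - q + r) \<le> norm p + norm q + norm r" for p q r :: complex
    using norm_triangle_ineq[of "p - q" r] norm_triangle_ineq4[of p q] by linarith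
  have bound: "norm (LINT \<xi>|lborel. cis (x \<bullet> \<xi>) * (complex_of_real (\<mu> (norm \<xi>)) * fourier f \<xi>)) \<le> 16 * B" for x
  proof -
    have e: "(LINT \<xi>|lborel. cis (x \<bullet> \<xi>) * (complex_of_real (\<mu> (norm \<xi>)) * fourier f \<xi>)) =
       ?V 0 x - 2 * (\<Sum>i\<in>UNIV. ?V (?d i) x) + (\<Sum>i\<in>UNIV. \<Sum>j\<in>UNIV. ?V (?d i + ?d j) x)"
    proof -
      note I0 = U(1)[OF o(1), of x]
      have I1: "integrable lborel (\<lambda>\<xi>. \<Sum>i\<in>UNIV. ?U (?d i) x \<xi>)"
        by (rule Bochner_Integration.integrable_sum, rule U(1)[OF o(2)])
      have I2: "integrable lborel (\<lambda>\<xi>. \<Sum>i\<in>UNIV. \<Sum>j\<in>UNIV. ?U (?d i + ?d j) x \<xi>)"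
        by (rule Bochner_Integration.integrable_sum, rule Bochner_Integration.integrable_sum, rule U(1)[OF o(3)])
      have S1: "(LINT \<xi>|lborel. (\<Sum>i\<in>UNIV. ?U (?d i) x \<xi>)) = (\<Sum>i\<in>UNIV. ?V (?d i) x)"
        by (rule Bochner_Integration.integral_sum, rule U(1)[OF o(2)])
      have S2: "(LINT \<xi>|lborel. (\<Sum>i\<in>UNIV. \<Sum>j\<in>UNIV. ?U (?d i + ?d j) x \<xi>)) = (\<Sum>i\<in>UNIV. \<Sum>j\<in>UNIV. ?V (?d i + ?d j) x)"
        by (rule trans[OF Bochner_Integration.integral_sum], rule Bochner_Integration.integrable_sum, rule U(1)[OF o(3)],
            rule sum.cong[OF refl], rule Bochner_Integration.integral_sum, rule U(1)[OF o(3)])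
      show ?thesis unfolding dec
        by (simp only: Bochner_Integration.integral_add[OF Bochner_Integration.integrable_diff[OF I0 integrable_mult_right[OF I1]] I2]
            Bochner_Integration.integral_diff[OF I0 integrable_mult_right[OF I1]] integral_mult_right_zero S1 S2)
    qed
    have "norm (?V 0 x - 2 * (\<Sum>i\<in>UNIV. ?V (?d i) x) + (\<Sum>i\<in>UNIV. \<Sum>j\<in>UNIV. ?V (?d i + ?d j) x))
        \<le> norm (?V 0 x) + norm (2 * (\<Sum>i\<in>UNIV. ?V (?d i) x)) + norm (\<Sum>i\<in>UNIV. \<Sum>j\<in>UNIV. ?V (?d i + ?d j) x)"
      by (rule tri)
    also have "\<dots> \<le> B + 2 * (\<Sum>i\<in>(UNIV::3 set). B) + (\<Sum>i\<in>(UNIV::3 set). \<Sum>j\<in>(UNIV::3 set). B)"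
    proof -
      have n0: "norm (?V 0 x) \<le> B" by (rule U(2)[OF o(1)])
      have "norm (\<Sum>i\<in>UNIV. ?V (?d i) x) \<le> (\<Sum>i\<in>(UNIV::3 set). B)"
        by (rule sum_norm_le, rule U(2)[OF o(2)])
      then have n1: "norm (2 * (\<Sum>i\<in>UNIV. ?V (?d i) x)) \<le> 2 * (\<Sum>i\<in>(UNIV::3 set). B)"
        unfolding norm_mult norm_numeral by (rule mult_left_mono) simp
      have n2: "norm (\<Sum>i\<in>UNIV. \<Sum>j\<in>UNIV. ?V (?d i + ?d j) x) \<le> (\<Sum>i\<in>(UNIV::3 set). \<Sum>j\<in>(UNIV::3 set). B)"
        by (rule sum_norm_le, rule sum_norm_le, rule U(2)[OF o(3)])
      show ?thesis by (rule add_mono[OF add_mono[OF n0 n1] n2])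
    qed
    also have "\<dots> = 16 * B" by simp
    finally show ?thesis unfolding e .
  qed
  have Fm[measurable]: "fourier f \<in> borel_measurable borel" by (rule fourier_measurable[OF fm])
  define u where "u = fourier_multiplier (\<lambda>\<xi>. complex_of_real (\<mu> (norm \<xi>))) f"
  have u: "u x = (LINT \<xi>|lborel. cis (x \<bullet> \<xi>) * (complex_of_real (\<mu> (norm \<xi>)) * fourier f \<xi>)) / complex_of_real ((2 * pi) ^ 3)" for x
    unfolding u_def fourier_multiplier_def inverse_fourier_def by (subst integral_completion) simp_all
  have um: "u \<in> borel_measurable borel" unfolding u[abs_def] by measurable
  have "norm (u x) \<le> 16 * B / (2 * pi) ^ 3" for x
  proof -
    have "norm (complex_of_real ((2 * pi) ^ 3)) = (2 * pi) ^ 3" by (simp only: norm_of_real) simp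
    then show ?thesis unfolding u norm_divide by (simp only:) (rule divide_right_mono[OF bound], simp)
  qed
  then have "norm (u x) \<le> 16 * K0 * 6 * pi / (2 * pi) ^ 3 * min 1 (inverse (1 + t) * R) * N" for x
    by (simp add: B_def mult_ac)
  then have "AE x in lebesgue. ereal (norm (u x)) \<le> ereal (16 * K0 * 6 * pi / (2 * pi) ^ 3 * min 1 (inverse (1 + t) * R) * N)"
    by (intro AE_I2) simp
  moreover have "(\<lambda>x. ereal (norm (u x))) \<in> borel_measurable lebesgue"
  proof (rule measurable_completion)
    show "(\<lambda>x. ereal (norm (u x))) \<in> borel_measurable lborel" using um by measurable
  qed
  ultimately have "Linf_norm u \<le> ereal (16 * K0 * 6 * pi / (2 * pi) ^ 3 * min 1 (inverse (1 + t) * R) * N)"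
    unfolding Linf_norm_def by (intro esssup_I)
  then show ?thesis by (simp only: u_def N_def)
qed

theorem lemma3p3:
  shows "\<exists>C::real. C > 0 \<and>
    (\<forall>R::real. \<forall>f :: R3 \<Rightarrow> complex. \<forall>t::real.
       R > 0 \<longrightarrow> f \<in> sobolev_space 4 UNIV \<longrightarrow> ess_supp f \<subseteq> cball 0 R \<longrightarrow> t > 0 \<longrightarrow>
         Linf_norm (sin_propagator t f)
           \<le> ereal (C * min 1 (inverse (1 + t) * R) * sobolev_norm 4 (ball 0 R) f) \<and>
         Linf_norm (cos_propagator t f)
           \<le> ereal (C * min 1 (inverse (1 + t) * R) * sobolev_norm 4 (ball 0 R) f))"
proof (intro exI conjI allI impI)
  \<comment> \<open>16 counts the terms of (1 - \<Delta>)^2, \<open>7200 * pi\<^sup>2\<close> is the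
    kernel constant, 6 pi comes from Cauchy-Schwarz and (2 pi)^3 from the inverse transform.\<close>
  show "16 * (7200 * pi\<^sup>2) * 6 * pi / (2 * pi) ^ 3 > 0" by simp
  fix R t :: real and f :: "R3 \<Rightarrow> complex"
  assume R: "R > 0" and f: "f \<in> sobolev_space 4 UNIV" and supp: "ess_supp f \<subseteq> cball 0 R" and t: "t > 0"
  have K0: "7200 * pi\<^sup>2 \<ge> 0" by simp
  show "Linf_norm (sin_propagator t f)
      \<le> ereal (16 * (7200 * pi\<^sup>2) * 6 * pi / (2 * pi) ^ 3 * min 1 (inverse (1 + t) * R) * sobolev_norm 4 (ball 0 R) f)"
    unfolding sin_propagator_def
    by (rule radial_multiplier_Linf_bound[where \<mu>="\<lambda>\<rho>. sin (t * \<rho>) / \<rho>", OF R t K0 f supp _ radial_symbol_sin[OF t]]) measurable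
  show "Linf_norm (cos_propagator t f)
      \<le> ereal (16 * (7200 * pi\<^sup>2) * 6 * pi / (2 * pi) ^ 3 * min 1 (inverse (1 + t) * R) * sobolev_norm 4 (ball 0 R) f)"
    unfolding cos_propagator_def
    by (rule radial_multiplier_Linf_bound[where \<mu>="\<lambda>\<rho>. cos (t * \<rho>)", OF R t K0 f supp _ radial_symbol_cos[OF t]]) measurable
qed

end
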